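(* Let $\overline M=M\cup\partial M$ be a smooth manifold with boundary and let $g$ be a projectively pre-compact pseudo-Riemannian metric on $M$ with an asymptotic form $$g=\frac{C}{\rho^4}d\rho^2+\frac{h}{\rho^2}\quad\text{over }M$$ for a defining function $\rho$ for $\partial M$, where $C\in C^\infty(\overline M,\mathbb R)$ satisfies $C=\pm1+\mathcal O(\rho)$ (for a fixed sign) and $h\in\Gamma(S^2T^*\overline M)$ has boundary value non-degenerate on $T\partial M\times T\partial M$. Assume further that the Ricci curvature of $g$ admits a smooth extension to the boundary and that the boundary value of this curvature vanishes if one of the entries is tangent to the boundary. Then $g$ is projectively compact (of order $1$) if and only if $C=\pm1+\mathcal O(\rho^2)$.
   Context: Setting. $\overline M$ is a smooth manifold with boundary $\partial M$ and interior $M$. An object on $U\cap M$ ($U\subset\overline M$ open) "admits a smooth extension to the boundary" (is "smooth up to the boundary") if it is the restriction of a smooth object on $U$. A local defining function for $\partial M$ is a smooth $\rho:U\to\mathbb R$, $U\subset\overline M$ open, with $\rho^{-1}(0)=U\cap\partial M$ and $d\rho$ nowhere zero on $U\cap\partial M$; in the claim $\rho$ is defined on $\overline M$. $f=\mathcal O(\rho^k)$, $k\ge1$, means $f=\rho^kf_1$ with $f_1$ smooth up to the boundary. $\mathfrak X_\partial(U)\subset\mathfrak X(U)$ is the space of vector fields tangent to $\partial M$ along $U\cap\partial M$. Let $\nabla$ be the Levi-Civita connection of $g$ and put $\nabla^\rho_\xi\eta:=\nabla_\xi\eta+\frac{d\rho(\xi)}{\rho}\eta+\frac{d\rho(\eta)}{\rho}\xi$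 on $U\cap M$. The metric $g$ is projectively pre-compact (of order $1$) if for each $U$ and each local defining function $\rho:U\to\mathbb R$: (i) $d\rho(\nabla^\rho_\xi\eta)$ is smooth up to the boundary for all $\xi,\eta\in\mathfrak X(U)$; (ii) $\rho\nabla^\rho_\xi\eta$ is smooth up to the boundary for all $\xi,\eta\in\mathfrak X(U)$; (iii) $\nabla^\rho_\xi\eta$ is smooth up to the boundary if at least one of $\xi,\eta\in\mathfrak X(U)$ lies in $\mathfrak X_\partial(U)$. It is projectively compact (of order $1$) if $\nabla^\rho_\xi\eta$ is smooth up to the boundary for all $\xi,\eta\in\mathfrak X(U)$.
   Formalization: The manifold is assumed to have dimension at least 2; in dimension 1 the claim fails, e.g. g = (1+ρ)/ρ⁴ dρ² on [0,∞) is Ricci flat and projectively compact although C = 1+ρ is not 1+O(ρ²). *)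

theory Defs
  imports "HOL-Analysis.Analysis"
begin

section \<open>Smooth maps on open sets and on relatively open subsets of a half space\<close>

fun Ck_on :: "nat \<Rightarrow> 'a::euclidean_space set \<Rightarrow> ('a \<Rightarrow> 'b::real_normed_vector) \<Rightarrow> bool" where
  "Ck_on 0 S f \<longleftrightarrow> continuous_on S f"
| "Ck_on (Suc k) S f \<longleftrightarrow>
     (\<forall>x\<in>S. f differentiable (at x)) \<and>
     (\<forall>v. Ck_on k S (\<lambda>x. frechet_derivative f (at x) v))"

text \<open>As usual at boundary points, smoothness on an arbitrary set means the existence of local
  smooth extensions to open sets of the ambient space.\<close>

definition smooth_on :: "'a::euclidean_space set \<Rightarrow> ('a \<Rightarrow> 'b::real_normed_vector) \<Rightarrow> bool" where
  "smooth_on S f \<longleftrightarrow>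
     (\<forall>x\<in>S. \<exists>W F. open W \<and> x \<in> W \<and> (\<forall>k. Ck_on k W F) \<and> (\<forall>y\<in>W \<inter> S. F y = f y))"

definition normal_dir :: "'a::euclidean_space" where
  "normal_dir = (SOME b. b \<in> Basis)"

definition half_space :: "'a::euclidean_space set" where
  "half_space = {x. 0 \<le> x \<bullet> normal_dir}"


section \<open>Smooth manifolds with boundary\<close>

text \<open>The manifold with boundary is the whole (Hausdorff, second countable) type \<open>'m\<close>; its
  dimension is the dimension of the model space \<open>'a\<close>. A chart is a domain together with a map,
  whose values outside the domain are irrelevant.\<close>

type_synonym ('m, 'a) chart = "'m set \<times> ('m \<Rightarrow> 'a)"

abbreviation cdom :: "('m, 'a) chart \<Rightarrow> 'm set" where "cdom \<equiv> fst"
abbreviation cmap :: "('m, 'a) chart \<Rightarrow> 'm \<Rightarrow> 'a" where "cmap \<equiv> snd"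

definition cinv :: "('m, 'a) chart \<Rightarrow> 'a \<Rightarrow> 'm" where
  "cinv c = inv_into (cdom c) (cmap c)"

definition smooth_atlas ::
  "('m::{t2_space, second_countable_topology}, 'a::euclidean_space) chart set \<Rightarrow> bool" where
  "smooth_atlas A \<longleftrightarrow>
     (\<Union>c\<in>A. cdom c) = UNIV \<and>
     (\<forall>c\<in>A. open (cdom c) \<and>
        openin (top_of_set half_space) (cmap c ` cdom c) \<and>
        homeomorphism (cdom c) (cmap c ` cdom c) (cmap c) (cinv c)) \<and>
     (\<forall>c\<in>A. \<forall>d\<in>A. smooth_on (cmap c ` (cdom c \<inter> cdom d)) (cmap d \<circ> cinv c))"

definition mfd_boundary :: "('m, 'a::euclidean_space) chart set \<Rightarrow> 'm set" where
  "mfd_boundary A = {p. \<exists>c\<in>A. p \<in> cdom c \<and> cmap c p \<bullet> normal_dir = 0}"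

definition mfd_interior :: "('m, 'a::euclidean_space) chart set \<Rightarrow> 'm set" where
  "mfd_interior A = - mfd_boundary A"

definition smooth_fun ::
  "('m, 'a::euclidean_space) chart set \<Rightarrow> 'm set \<Rightarrow> ('m \<Rightarrow> real) \<Rightarrow> bool" where
  "smooth_fun A U f \<longleftrightarrow> (\<forall>c\<in>A. smooth_on (cmap c ` (U \<inter> cdom c)) (f \<circ> cinv c))"


section \<open>Tangent vectors, differentials and tensor fields\<close>

text \<open>Every tangent space is identified with the model space \<open>'a\<close>: a vector in \<open>'a\<close>, viewed as a
  tangent vector at \<open>p\<close>, is given by its components with respect to the preferred chart
  \<open>chart_at A p\<close>. Hence a vector field is a function \<open>'m \<Rightarrow> 'a\<close>, whose components with respect
  to any other chart are obtained from the Jacobian of the change of charts.\<close>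

definition chart_at :: "('m, 'a) chart set \<Rightarrow> 'm \<Rightarrow> ('m, 'a) chart" where
  "chart_at A p = (SOME c. c \<in> A \<and> p \<in> cdom c)"

definition jacobian ::
  "('m, 'a::euclidean_space) chart \<Rightarrow> ('m, 'a) chart \<Rightarrow> 'm \<Rightarrow> 'a \<Rightarrow> 'a" where
  "jacobian c d p =
     frechet_derivative (cmap d \<circ> cinv c) (at (cmap c p) within cmap c ` (cdom c \<inter> cdom d))"

definition components ::
  "('m, 'a::euclidean_space) chart set \<Rightarrow> ('m, 'a) chart \<Rightarrow> 'm \<Rightarrow> 'a \<Rightarrow> 'a" where
  "components A c p v = jacobian (chart_at A p) c p v"

text \<open>The local vector field on the domain of \<open>c\<close> with constant components \<open>v\<close> in the chart
  \<open>c\<close>; for \<open>v \<in> Basis\<close> these are the coordinate vector fields of \<open>c\<close>.\<close>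

definition coord_field ::
  "('m, 'a::euclidean_space) chart set \<Rightarrow> ('m, 'a) chart \<Rightarrow> 'a \<Rightarrow> 'm \<Rightarrow> 'a" where
  "coord_field A c v p = jacobian c (chart_at A p) p v"

definition differential ::
  "('m, 'a::euclidean_space) chart set \<Rightarrow> ('m \<Rightarrow> real) \<Rightarrow> 'm \<Rightarrow> 'a \<Rightarrow> real" where
  "differential A f p = (let c = chart_at A p in
     frechet_derivative (f \<circ> cinv c) (at (cmap c p) within cmap c ` cdom c))"

definition local_rep ::
  "('m, 'a::euclidean_space) chart set \<Rightarrow> ('m, 'a) chart \<Rightarrow> ('m \<Rightarrow> 'a) \<Rightarrow> 'a \<Rightarrow> 'a" where
  "local_rep A c \<xi> x = components A c (cinv c x) (\<xi> (cinv c x))"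

definition vector_field ::
  "('m, 'a::euclidean_space) chart set \<Rightarrow> 'm set \<Rightarrow> ('m \<Rightarrow> 'a) \<Rightarrow> bool" where
  "vector_field A U \<xi> \<longleftrightarrow> (\<forall>c\<in>A. smooth_on (cmap c ` (U \<inter> cdom c)) (local_rep A c \<xi>))"

text \<open>The tangent space of the boundary at \<open>p\<close>, for \<open>p\<close> in the boundary.\<close>

definition boundary_tangent :: "('m, 'a::euclidean_space) chart set \<Rightarrow> 'm \<Rightarrow> 'a set" where
  "boundary_tangent A p =
     {v. \<forall>c\<in>A. p \<in> cdom c \<longrightarrow> components A c p v \<bullet> normal_dir = 0}"

definition boundary_vector_field ::
  "('m, 'a::euclidean_space) chart set \<Rightarrow> 'm set \<Rightarrow> ('m \<Rightarrow> 'a) \<Rightarrow> bool" where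
  "boundary_vector_field A U \<xi> \<longleftrightarrow>
     vector_field A U \<xi> \<and> (\<forall>p\<in>U \<inter> mfd_boundary A. \<xi> p \<in> boundary_tangent A p)"

text \<open>In the preferred chart at \<open>p\<close> this is the formula
  \<open>[\<xi>,\<eta>]\<^sup>k = \<xi>\<^sup>i \<partial>\<^sub>i \<eta>\<^sup>k - \<eta>\<^sup>i \<partial>\<^sub>i \<xi>\<^sup>k\<close>.\<close>

definition lie_bracket ::
  "('m, 'a::euclidean_space) chart set \<Rightarrow> ('m \<Rightarrow> 'a) \<Rightarrow> ('m \<Rightarrow> 'a) \<Rightarrow> 'm \<Rightarrow> 'a" where
  "lie_bracket A \<xi> \<eta> p = (let c = chart_at A p; F = at (cmap c p) within cmap c ` cdom c in
     frechet_derivative (local_rep A c \<eta>) F (\<xi> p) - frechet_derivative (local_rep A c \<xi>) F (\<eta> p))"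

definition bilinear_form_field ::
  "('m, 'a::euclidean_space) chart set \<Rightarrow> 'm set \<Rightarrow> ('m \<Rightarrow> 'a \<Rightarrow> 'a \<Rightarrow> real) \<Rightarrow> bool" where
  "bilinear_form_field A U b \<longleftrightarrow>
     (\<forall>p\<in>U. bilinear (b p)) \<and>
     (\<forall>c\<in>A. \<forall>u v. smooth_on (cmap c ` (U \<inter> cdom c))
        ((\<lambda>p. b p (coord_field A c u p) (coord_field A c v p)) \<circ> cinv c))"

definition symmetric_form_field ::
  "('m, 'a::euclidean_space) chart set \<Rightarrow> 'm set \<Rightarrow> ('m \<Rightarrow> 'a \<Rightarrow> 'a \<Rightarrow> real) \<Rightarrow> bool" where
  "symmetric_form_field A U b \<longleftrightarrow>
     bilinear_form_field A U b \<and> (\<forall>p\<in>U. \<forall>u v. b p u v = b p v u)"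

definition nondegenerate_on :: "'a::real_vector set \<Rightarrow> ('a \<Rightarrow> 'a \<Rightarrow> real) \<Rightarrow> bool" where
  "nondegenerate_on T b \<longleftrightarrow> (\<forall>u\<in>T. (\<forall>v\<in>T. b u v = 0) \<longrightarrow> u = 0)"

definition pseudo_riemannian_metric ::
  "('m, 'a::euclidean_space) chart set \<Rightarrow> 'm set \<Rightarrow> ('m \<Rightarrow> 'a \<Rightarrow> 'a \<Rightarrow> real) \<Rightarrow> bool" where
  "pseudo_riemannian_metric A U g \<longleftrightarrow>
     symmetric_form_field A U g \<and> (\<forall>p\<in>U. nondegenerate_on UNIV (g p))"


section \<open>The Levi-Civita connection and its Ricci curvature\<close>

text \<open>A connection acts on local vector fields. Since these are represented by total functions,
  the axioms are imposed on every open subset of \<open>M\<close>; they determine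
  \<open>nabla \<xi> \<eta>\<close> on each open set on which both \<open>\<xi>\<close> and \<open>\<eta>\<close> are smooth.\<close>

definition levi_civita_connection ::
  "('m::topological_space, 'a::euclidean_space) chart set \<Rightarrow> 'm set \<Rightarrow>
   ('m \<Rightarrow> 'a \<Rightarrow> 'a \<Rightarrow> real) \<Rightarrow> (('m \<Rightarrow> 'a) \<Rightarrow> ('m \<Rightarrow> 'a) \<Rightarrow> 'm \<Rightarrow> 'a) \<Rightarrow> bool" where
  "levi_civita_connection A M g nabla \<longleftrightarrow>
     (\<forall>U \<xi> \<eta> \<zeta> f. open U \<and> U \<subseteq> M \<and> vector_field A U \<xi> \<and> vector_field A U \<eta> \<and>
        vector_field A U \<zeta> \<and> smooth_fun A U f \<longrightarrow>
        vector_field A U (nabla \<xi> \<eta>) \<and>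
        (\<forall>p\<in>U.
           nabla (\<lambda>q. \<xi> q + \<zeta> q) \<eta> p = nabla \<xi> \<eta> p + nabla \<zeta> \<eta> p \<and>
           nabla (\<lambda>q. f q *\<^sub>R \<xi> q) \<eta> p = f p *\<^sub>R nabla \<xi> \<eta> p \<and>
           nabla \<xi> (\<lambda>q. \<eta> q + \<zeta> q) p = nabla \<xi> \<eta> p + nabla \<xi> \<zeta> p \<and>
           nabla \<xi> (\<lambda>q. f q *\<^sub>R \<eta> q) p = differential A f p (\<xi> p) *\<^sub>R \<eta> p + f p *\<^sub>R nabla \<xi> \<eta> p \<and>
           nabla \<xi> \<eta> p - nabla \<eta> \<xi> p = lie_bracket A \<xi> \<eta> p \<and>
           differential A (\<lambda>q. g q (\<eta> q) (\<zeta> q)) p (\<xi> p) =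
             g p (nabla \<xi> \<eta> p) (\<zeta> p) + g p (\<eta> p) (nabla \<xi> \<zeta> p)))"

definition curvature ::
  "('m, 'a::euclidean_space) chart set \<Rightarrow> (('m \<Rightarrow> 'a) \<Rightarrow> ('m \<Rightarrow> 'a) \<Rightarrow> 'm \<Rightarrow> 'a) \<Rightarrow>
   ('m \<Rightarrow> 'a) \<Rightarrow> ('m \<Rightarrow> 'a) \<Rightarrow> ('m \<Rightarrow> 'a) \<Rightarrow> 'm \<Rightarrow> 'a" where
  "curvature A nabla \<xi> \<eta> \<zeta> p =
     nabla \<xi> (nabla \<eta> \<zeta>) p - nabla \<eta> (nabla \<xi> \<zeta>) p - nabla (lie_bracket A \<xi> \<eta>) \<zeta> p"

text \<open>The value of the Ricci tensor on tangent vectors \<open>u\<close>, \<open>v\<close> at \<open>p\<close> is the trace of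
  \<open>w \<mapsto> R(w,u)v\<close>; tangent vectors are extended to local vector fields by constant components
  in the preferred chart at \<open>p\<close>.\<close>

definition ricci ::
  "('m, 'a::euclidean_space) chart set \<Rightarrow> (('m \<Rightarrow> 'a) \<Rightarrow> ('m \<Rightarrow> 'a) \<Rightarrow> 'm \<Rightarrow> 'a) \<Rightarrow>
   'm \<Rightarrow> 'a \<Rightarrow> 'a \<Rightarrow> real" where
  "ricci A nabla p u v = (let E = coord_field A (chart_at A p) in
     (\<Sum>w\<in>Basis. curvature A nabla (E w) (E u) (E v) p \<bullet> w))"


section \<open>Behaviour at the boundary and projective compactness\<close>

definition defining_function ::
  "('m, 'a::euclidean_space) chart set \<Rightarrow> 'm set \<Rightarrow> ('m \<Rightarrow> real) \<Rightarrow> bool" where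
  "defining_function A U \<rho> \<longleftrightarrow>
     smooth_fun A U \<rho> \<and>
     {p\<in>U. \<rho> p = 0} = U \<inter> mfd_boundary A \<and>
     (\<forall>p\<in>U \<inter> mfd_boundary A. \<exists>v. differential A \<rho> p v \<noteq> 0)"

text \<open>\<open>f = O(\<rho>\<^sup>k)\<close> on \<open>U\<close>, in the sense of a factor \<open>f\<^sub>1\<close> that is smooth up to the boundary.\<close>

definition big_O_boundary ::
  "('m, 'a::euclidean_space) chart set \<Rightarrow> 'm set \<Rightarrow> ('m \<Rightarrow> real) \<Rightarrow> nat \<Rightarrow> ('m \<Rightarrow> real) \<Rightarrow> bool" where
  "big_O_boundary A U \<rho> k f \<longleftrightarrow> (\<exists>f\<^sub>1. smooth_fun A U f\<^sub>1 \<and> (\<forall>p\<in>U. f p = \<rho> p ^ k * f\<^sub>1 p))"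

definition fun_smooth_up_to_boundary ::
  "('m, 'a::euclidean_space) chart set \<Rightarrow> 'm set \<Rightarrow> ('m \<Rightarrow> real) \<Rightarrow> bool" where
  "fun_smooth_up_to_boundary A U f \<longleftrightarrow>
     (\<exists>F. smooth_fun A U F \<and> (\<forall>p\<in>U \<inter> mfd_interior A. F p = f p))"

definition field_smooth_up_to_boundary ::
  "('m, 'a::euclidean_space) chart set \<Rightarrow> 'm set \<Rightarrow> ('m \<Rightarrow> 'a) \<Rightarrow> bool" where
  "field_smooth_up_to_boundary A U \<xi> \<longleftrightarrow>
     (\<exists>\<zeta>. vector_field A U \<zeta> \<and> (\<forall>p\<in>U \<inter> mfd_interior A. \<zeta> p = \<xi> p))"

definition nabla_rho ::
  "('m, 'a::euclidean_space) chart set \<Rightarrow> (('m \<Rightarrow> 'a) \<Rightarrow> ('m \<Rightarrow> 'a) \<Rightarrow> 'm \<Rightarrow> 'a) \<Rightarrow>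
   ('m \<Rightarrow> real) \<Rightarrow> ('m \<Rightarrow> 'a) \<Rightarrow> ('m \<Rightarrow> 'a) \<Rightarrow> 'm \<Rightarrow> 'a" where
  "nabla_rho A nabla \<rho> \<xi> \<eta> p =
     nabla \<xi> \<eta> p + (differential A \<rho> p (\<xi> p) / \<rho> p) *\<^sub>R \<eta> p + (differential A \<rho> p (\<eta> p) / \<rho> p) *\<^sub>R \<xi> p"

text \<open>The following two notions are formulated for a connection \<open>nabla\<close> on the interior; for a
  metric they refer to its Levi-Civita connection.\<close>

definition projectively_precompact ::
  "('m::topological_space, 'a::euclidean_space) chart set \<Rightarrow>
   (('m \<Rightarrow> 'a) \<Rightarrow> ('m \<Rightarrow> 'a) \<Rightarrow> 'm \<Rightarrow> 'a) \<Rightarrow> bool" where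
  "projectively_precompact A nabla \<longleftrightarrow>
     (\<forall>U \<rho> \<xi> \<eta>. open U \<and> defining_function A U \<rho> \<and> vector_field A U \<xi> \<and> vector_field A U \<eta> \<longrightarrow>
        fun_smooth_up_to_boundary A U (\<lambda>p. differential A \<rho> p (nabla_rho A nabla \<rho> \<xi> \<eta> p)) \<and>
        field_smooth_up_to_boundary A U (\<lambda>p. \<rho> p *\<^sub>R nabla_rho A nabla \<rho> \<xi> \<eta> p) \<and>
        (boundary_vector_field A U \<xi> \<or> boundary_vector_field A U \<eta> \<longrightarrow>
           field_smooth_up_to_boundary A U (nabla_rho A nabla \<rho> \<xi> \<eta>)))"

definition projectively_compact ::
  "('m::topological_space, 'a::euclidean_space) chart set \<Rightarrow>
   (('m \<Rightarrow> 'a) \<Rightarrow> ('m \<Rightarrow> 'a) \<Rightarrow> 'm \<Rightarrow> 'a) \<Rightarrow> bool" where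
  "projectively_compact A nabla \<longleftrightarrow>
     (\<forall>U \<rho> \<xi> \<eta>. open U \<and> defining_function A U \<rho> \<and> vector_field A U \<xi> \<and> vector_field A U \<eta> \<longrightarrow>
        field_smooth_up_to_boundary A U (nabla_rho A nabla \<rho> \<xi> \<eta>))"

end

theory Submission
  imports Defs
begin

text \<open>The theorem is a statement about the first two terms of the Levi-Civita connection at the
  boundary, and everything follows from one identity. Write \<open>\<rho>\<^sub>u = d\<rho>(u)\<close> and so on for derivatives
  in a chart, and let \<open>N = \<nabla>\<^sup>\<rho>\<^sub>u v\<close> for constant \<open>u\<close>, \<open>v\<close>. In the Koszul formula for
  \<open>g = C d\<rho>\<^sup>2/\<rho>\<^sup>4 + h/\<rho>\<^sup>2\<close> the terms of order \<open>\<rho>\<close> to the power \<open>-5\<close> are exactly those which the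
  correction \<open>\<nabla>\<^sup>\<rho> - \<nabla>\<close> removes, and multiplication by twice the fourth power of \<open>\<rho>\<close> gives
  (\<open>rescaled_koszul\<close>)

  \<open>2(C \<rho>\<^sub>N \<rho>\<^sub>w + \<rho>\<^sup>2 h(N,w)) = C\<^sub>u \<rho>\<^sub>v \<rho>\<^sub>w + C\<^sub>v \<rho>\<^sub>u \<rho>\<^sub>w - C\<^sub>w \<rho>\<^sub>u \<rho>\<^sub>v + 2C \<rho>\<^sub>u\<^sub>v \<rho>\<^sub>w + O(\<rho>)\<close>,

  where the error is \<open>O(\<rho>\<^sup>2)\<close> if \<open>\<rho>\<^sub>w = 0\<close>.

  Suppose that \<open>C = s + O(\<rho>\<^sup>2)\<close>. Pre-compactness already provides a smooth extension \<open>Z\<close> of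
  \<open>\<rho> \<nabla>\<^sup>\<rho>\<^sub>\<xi> \<eta>\<close> with \<open>d\<rho>(Z) = 0\<close> on the boundary. If \<open>w\<close> is tangent to the level sets of \<open>\<rho>\<close>, then
  \<open>C\<^sub>w = O(\<rho>\<^sup>2)\<close>, and the identity shows that \<open>h(N,w)\<close> is bounded, so that \<open>h(Z,w)\<close> vanishes on the
  boundary. Since \<open>h\<close> is non-degenerate on the tangent spaces of the boundary, \<open>Z = 0\<close> there
  (\<open>rescaled_nabla_rho_vanishes\<close>), and by Hadamard's lemma (\<open>smooth_on_normal_quotient\<close>) \<open>Z\<close> is
  \<open>\<rho>\<close> times a smooth field, the extension of \<open>\<nabla>\<^sup>\<rho>\<^sub>\<xi> \<eta>\<close>.

  Conversely, let \<open>g\<close> be projectively compact, so that \<open>N\<close> is smooth up to the boundary. The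
  connections \<open>\<nabla>\<close> and \<open>\<nabla>\<^sup>\<rho>\<close> are projectively equivalent with respect to the one-form \<open>d\<rho>/\<rho>\<close>,
  and in dimension \<open>n\<close> their Ricci curvatures satisfy
  \<open>Ric(u,v) = Ric\<^sup>\<rho>(u,v) + (n - 1)(\<rho>\<^sub>u\<^sub>v - \<rho>\<^sub>N)/\<rho>\<close> (\<open>projective_change_curvature\<close>). Both Ricci
  curvatures extend to the boundary, hence \<open>\<rho>\<^sub>u\<^sub>v = \<rho>\<^sub>N\<close> there because \<open>n \<ge> 2\<close>
  (\<open>hessian_at_boundary\<close>). For three vectors equal to a vector \<open>\<nu>\<close> transversal to the boundary the
  identity then reduces to \<open>C\<^sub>\<nu> = 0\<close> on the boundary. With \<open>C = s + \<rho> C\<^sub>1\<close> this means that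
  \<open>C\<^sub>1\<close> vanishes on the boundary, and division by \<open>\<rho>\<close> gives \<open>C = s + O(\<rho>\<^sup>2)\<close>.

  The computations take place in a chart that need not be the preferred chart of the points
  considered. This requires the change of charts for the differential, the Lie bracket, the
  connection and the Ricci curvature.\<close>

section \<open>Functions of class \<open>C\<^sup>k\<close> on open sets\<close>

lemma linear_Basis_expansion:
  fixes L :: "'a::euclidean_space \<Rightarrow> 'b::real_vector"
  assumes "linear L"
  shows "L w = (\<Sum>b\<in>Basis. (w \<bullet> b) *\<^sub>R L b)"
proof -
  have "L w = L (\<Sum>b\<in>Basis. (w \<bullet> b) *\<^sub>R b)" by (simp add: euclidean_representation)
  also have "\<dots> = (\<Sum>b\<in>Basis. (w \<bullet> b) *\<^sub>R L b)" by (simp add: linear_sum[OF assms] linear_scale[OF assms])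
  finally show ?thesis .
qed

lemma Ck_on_cong:
  assumes "open W" "\<And>x. x \<in> W \<Longrightarrow> f x = g x" "Ck_on k W f"
  shows "Ck_on k W g"
  using assms(2,3)
proof (induction k arbitrary: f g)
  case 0
  then show ?case using continuous_on_cong by force
next
  case (Suc k)
  have der: "(g has_derivative frechet_derivative f (at x)) (at x)" if "x \<in> W" for x
    using Suc.prems that assms(1)
    by (auto simp: frechet_derivative_works intro: has_derivative_transform_within_open)
  then have eq: "frechet_derivative g (at x) = frechet_derivative f (at x)" if "x \<in> W" for x
    using frechet_derivative_at that by force
  have "Ck_on k W (\<lambda>x. frechet_derivative g (at x) v)" for v
    by (rule Suc.IH[of "\<lambda>x. frechet_derivative f (at x) v"]) (use Suc.prems eq in auto)
  then show ?case using der unfolding Ck_on.simps differentiable_def by blast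
qed

lemma Ck_on_subset: "Ck_on k W f \<Longrightarrow> V \<subseteq> W \<Longrightarrow> Ck_on k V f"
  by (induction k arbitrary: f) (auto intro: continuous_on_subset)

lemma Ck_on_Suc_imp: "Ck_on (Suc k) W f \<Longrightarrow> Ck_on k W f"
  by (induction k arbitrary: f)
    (auto intro: continuous_at_imp_continuous_on differentiable_imp_continuous_within)

text \<open>Every closure property below is an induction on \<open>k\<close> whose step is this rule, applied to the
  explicit derivative from the corresponding differentiation rule.\<close>

lemma Ck_on_SucI:
  assumes "open W" "\<And>x. x \<in> W \<Longrightarrow> (f has_derivative f' x) (at x)" "\<And>v. Ck_on k W (\<lambda>x. f' x v)"
  shows "Ck_on (Suc k) W f"
proof -
  have eq: "f' x = frechet_derivative f (at x)" if "x \<in> W" for x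
    using frechet_derivative_at[OF assms(2)[OF that]] .
  have "Ck_on k W (\<lambda>x. frechet_derivative f (at x) v)" for v
    using Ck_on_cong[OF assms(1) _ assms(3)[of v]] eq by auto
  then show ?thesis using assms(2) by (auto simp: differentiable_def)
qed

lemma Ck_on_D:
  assumes "Ck_on (Suc k) W f" "x \<in> W"
  shows "(f has_derivative frechet_derivative f (at x)) (at x)"
  using assms by (simp add: frechet_derivative_works)

lemma Ck_on_const: "open W \<Longrightarrow> Ck_on k W (\<lambda>x. c)"
proof (induction k arbitrary: c)
  case (Suc k)
  show ?case
    by (rule Ck_on_SucI[OF Suc.prems has_derivative_const]) (use Suc in auto)
qed auto

lemma Ck_on_bounded_linear:
  assumes "open W" "bounded_linear L" "Ck_on k W f"
  shows "Ck_on k W (\<lambda>x. L (f x))"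
  using assms(3)
proof (induction k arbitrary: f)
  case 0
  then show ?case using assms(2) by (auto intro: bounded_linear.continuous_on)
next
  case (Suc k)
  show ?case
    by (rule Ck_on_SucI[OF assms(1) bounded_linear.has_derivative[OF assms(2) Ck_on_D[OF Suc.prems]]])
      (use Suc in auto)
qed

lemma Ck_on_ident: "open W \<Longrightarrow> Ck_on k W (\<lambda>x. x)"
proof (cases k)
  case (Suc k)
  assume "open W"
  then show ?thesis unfolding Suc
    by (intro Ck_on_SucI[OF _ has_derivative_ident]) (auto intro: Ck_on_const)
qed auto

lemma Ck_on_add:
  assumes "open W" "Ck_on k W f" "Ck_on k W g"
  shows "Ck_on k W (\<lambda>x. f x + g x)"
  using assms(2,3)
proof (induction k arbitrary: f g)
  case (Suc k)
  show ?case
    by (rule Ck_on_SucI[OF assms(1) has_derivative_add[OF Ck_on_D[OF Suc.prems(1)] Ck_on_D[OF Suc.prems(2)]]])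
      (use Suc in auto)
qed (auto intro: continuous_intros)

lemma Ck_on_scaleR:
  fixes f :: "'a::euclidean_space \<Rightarrow> real"
  assumes "open W" "Ck_on k W f" "Ck_on k W g"
  shows "Ck_on k W (\<lambda>x. f x *\<^sub>R g x)"
  using assms(2,3)
proof (induction k arbitrary: f g)
  case (Suc k)
  show ?case
  proof (rule Ck_on_SucI[OF assms(1) has_derivative_scaleR[OF Ck_on_D[OF Suc.prems(1)] Ck_on_D[OF Suc.prems(2)]]])
    show "Ck_on k W (\<lambda>x. f x *\<^sub>R frechet_derivative g (at x) v + frechet_derivative f (at x) v *\<^sub>R g x)" for v
      by (intro Ck_on_add Suc.IH assms(1) Ck_on_Suc_imp[OF Suc.prems(1)] Ck_on_Suc_imp[OF Suc.prems(2)])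
        (use Suc.prems in auto)
  qed auto
qed (auto intro: continuous_intros)

lemma Ck_on_sum:
  assumes "open W" "\<And>i. i \<in> I \<Longrightarrow> Ck_on k W (f i)"
  shows "Ck_on k W (\<lambda>x. \<Sum>i\<in>I. f i x)"
  using assms(2)
  by (induction I rule: infinite_finite_induct) (auto simp: Ck_on_const Ck_on_add assms(1))

lemma Ck_on_inverse:
  fixes f :: "'a::euclidean_space \<Rightarrow> real"
  assumes "open W" "Ck_on k W f" "\<And>x. x \<in> W \<Longrightarrow> f x \<noteq> 0"
  shows "Ck_on k W (\<lambda>x. inverse (f x))"
  using assms(2)
proof (induction k)
  case 0
  then show ?case using assms(3) by (auto intro: continuous_intros)
next
  case (Suc k)
  show ?case
  proof (rule Ck_on_SucI[OF assms(1) Deriv.has_derivative_inverse[OF _ Ck_on_D[OF Suc.prems(1)]]])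
    fix v
    have "Ck_on k W (\<lambda>x. (-1) *\<^sub>R (inverse (f x) *\<^sub>R (frechet_derivative f (at x) v *\<^sub>R inverse (f x))))"
      by (intro Ck_on_scaleR assms(1) Suc.IH Ck_on_const Ck_on_Suc_imp[OF Suc.prems(1)]) (use Suc.prems in auto)
    then show "Ck_on k W (\<lambda>x. - (inverse (f x) * frechet_derivative f (at x) v * inverse (f x)))"
      by (simp add: algebra_simps)
  qed (use assms in auto)
qed

text \<open>By the chain rule the derivative of the composite is a combination of the partial derivatives
  of \<open>f\<close>, again composed with \<open>g\<close>. Hence the induction is over all \<open>f\<close> simultaneously, for fixed \<open>g\<close>.\<close>

lemma Ck_on_compose:
  fixes f :: "'b::euclidean_space \<Rightarrow> 'c::real_normed_vector"
  assumes "open W" "open V" "Ck_on k W g" "Ck_on k V f" "\<And>x. x \<in> W \<Longrightarrow> g x \<in> V"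
  shows "Ck_on k W (\<lambda>x. f (g x))"
  using assms(3,4)
proof (induction k arbitrary: f)
  case 0
  then show ?case using assms(5)
    by (auto intro!: continuous_on_compose2[of V f W g])
next
  case (Suc k)
  show ?case
  proof (rule Ck_on_SucI[OF assms(1)])
    fix x assume x: "x \<in> W"
    show "((\<lambda>x. f (g x)) has_derivative (\<lambda>v. \<Sum>b\<in>Basis. (frechet_derivative g (at x) v \<bullet> b) *\<^sub>R frechet_derivative f (at (g x)) b)) (at x)"
    proof -
      have F: "(f has_derivative frechet_derivative f (at (g x))) (at (g x))"
        using Ck_on_D[OF Suc.prems(2) assms(5)[OF x]] .
      have "linear (frechet_derivative f (at (g x)))" using F has_derivative_linear by blast
      then have exp: "frechet_derivative f (at (g x)) w = (\<Sum>b\<in>Basis. (w \<bullet> b) *\<^sub>R frechet_derivative f (at (g x)) b)" for w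
        by (rule linear_Basis_expansion)
      show ?thesis
        using has_derivative_compose[OF Ck_on_D[OF Suc.prems(1) x] F]
        by (subst (asm) exp)
    qed
  next
    fix v
    show "Ck_on k W (\<lambda>x. \<Sum>b\<in>Basis. (frechet_derivative g (at x) v \<bullet> b) *\<^sub>R frechet_derivative f (at (g x)) b)"
    proof (intro Ck_on_sum Ck_on_scaleR assms(1))
      fix b :: 'b
      show "Ck_on k W (\<lambda>x. frechet_derivative g (at x) v \<bullet> b)"
        by (rule Ck_on_bounded_linear[OF assms(1) bounded_linear_inner_left]) (use Suc.prems in auto)
      show "Ck_on k W (\<lambda>x. frechet_derivative f (at (g x)) b)"
        by (rule Suc.IH[of "\<lambda>y. frechet_derivative f (at y) b"]) (use Suc.prems Ck_on_Suc_imp in auto)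
    qed
  qed
qed

text \<open>Two applications of the mean value theorem to the second difference of \<open>f\<close> over a small
  parallelogram. The second difference is symmetric in \<open>u\<close> and \<open>v\<close>, whereas on the right-hand side
  \<open>u\<close> is used first; comparing the two orders gives Schwarz's theorem.\<close>

lemma second_derivative_MVT:
  fixes f :: "'a::euclidean_space \<Rightarrow> real"
  assumes B: "\<And>s t. 0 \<le> s \<Longrightarrow> s \<le> h \<Longrightarrow> 0 \<le> t \<Longrightarrow> t \<le> h \<Longrightarrow> x + s *\<^sub>R u + t *\<^sub>R v \<in> W"
    and f2: "Ck_on 2 W f" and h: "h > 0"
  shows "\<exists>s t. 0 < s \<and> s < h \<and> 0 < t \<and> t < h \<and>
    f (x + h *\<^sub>R u + h *\<^sub>R v) - f (x + h *\<^sub>R u) - f (x + h *\<^sub>R v) + f x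
    = h * h * frechet_derivative (\<lambda>y. frechet_derivative f (at y) u) (at (x + s *\<^sub>R u + t *\<^sub>R v)) v"
proof -
  let ?D = "\<lambda>y. frechet_derivative f (at y)"
  have df: "(f has_derivative ?D y) (at y)" if "y \<in> W" for y
    using f2 Ck_on_D[of 1 W f] that by (simp add: numeral_2_eq_2)
  have dDu: "((\<lambda>y. ?D y u) has_derivative frechet_derivative (\<lambda>y. ?D y u) (at y)) (at y)" if "y \<in> W" for y
    using f2 Ck_on_D[of 0 W "\<lambda>y. ?D y u"] that by (auto simp: numeral_2_eq_2)
  have d1: "((\<lambda>s. f (x + s *\<^sub>R u + t *\<^sub>R v)) has_real_derivative ?D (x + s *\<^sub>R u + t *\<^sub>R v) u) (at s)"
    if "0 \<le> s" "s \<le> h" "0 \<le> t" "t \<le> h" for s t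
  proof -
    have "((\<lambda>s. x + s *\<^sub>R u + t *\<^sub>R v) has_derivative (\<lambda>r. r *\<^sub>R u)) (at s)"
      by (auto intro!: derivative_eq_intros)
    from has_derivative_compose[OF this df[OF B[OF that]]]
    show ?thesis
      using has_derivative_linear[OF df[OF B[OF that]]]
      by (simp add: has_field_derivative_def linear_cmul mult_commute_abs)
  qed
  have d2: "((\<lambda>t. ?D (x + s *\<^sub>R u + t *\<^sub>R v) u) has_real_derivative
      frechet_derivative (\<lambda>y. ?D y u) (at (x + s *\<^sub>R u + t *\<^sub>R v)) v) (at t)"
    if "0 \<le> s" "s \<le> h" "0 \<le> t" "t \<le> h" for s t
  proof -
    have "((\<lambda>t. x + s *\<^sub>R u + t *\<^sub>R v) has_derivative (\<lambda>r. r *\<^sub>R v)) (at t)"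
      by (auto intro!: derivative_eq_intros)
    from has_derivative_compose[OF this dDu[OF B[OF that]]]
    show ?thesis
      using has_derivative_linear[OF dDu[OF B[OF that]]]
      by (simp add: has_field_derivative_def linear_cmul mult_commute_abs)
  qed
  let ?p = "\<lambda>s. f (x + s *\<^sub>R u + h *\<^sub>R v) - f (x + s *\<^sub>R u + 0 *\<^sub>R v)"
  have "\<exists>s>0. s < h \<and> ?p h - ?p 0 = (h - 0) * (?D (x + s *\<^sub>R u + h *\<^sub>R v) u - ?D (x + s *\<^sub>R u + 0 *\<^sub>R v) u)"
  proof (rule MVT2[OF h])
    fix s assume "0 \<le> s" "s \<le> h"
    then show "(?p has_real_derivative ?D (x + s *\<^sub>R u + h *\<^sub>R v) u - ?D (x + s *\<^sub>R u + 0 *\<^sub>R v) u) (at s)"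
      using h by (intro DERIV_diff d1) auto
  qed
  then obtain s where s: "0 < s" "s < h"
    "?p h - ?p 0 = h * (?D (x + s *\<^sub>R u + h *\<^sub>R v) u - ?D (x + s *\<^sub>R u + 0 *\<^sub>R v) u)" by auto
  have "\<exists>t>0. t < h \<and> ?D (x + s *\<^sub>R u + h *\<^sub>R v) u - ?D (x + s *\<^sub>R u + 0 *\<^sub>R v) u
     = (h - 0) * frechet_derivative (\<lambda>y. ?D y u) (at (x + s *\<^sub>R u + t *\<^sub>R v)) v"
    by (rule MVT2[OF h]) (use d2 s in auto)
  then obtain t where t: "0 < t" "t < h" "?D (x + s *\<^sub>R u + h *\<^sub>R v) u - ?D (x + s *\<^sub>R u + 0 *\<^sub>R v) u
     = h * frechet_derivative (\<lambda>y. ?D y u) (at (x + s *\<^sub>R u + t *\<^sub>R v)) v" by auto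
  show ?thesis
    apply (rule exI[of _ s], rule exI[of _ t])
    using s t by (simp add: algebra_simps)
qed

lemma second_derivative_symmetric_real:
  fixes f :: "'a::euclidean_space \<Rightarrow> real"
  assumes W: "open W" "x \<in> W" and f2: "Ck_on 2 W f"
  shows "frechet_derivative (\<lambda>y. frechet_derivative f (at y) u) (at x) v =
         frechet_derivative (\<lambda>y. frechet_derivative f (at y) v) (at x) u"
proof (rule ccontr)
  let ?DD = "\<lambda>u v y. frechet_derivative (\<lambda>y. frechet_derivative f (at y) u) (at y) v"
  assume ne: "\<not> ?thesis"
  define e where "e = \<bar>?DD u v x - ?DD v u x\<bar> / 2"
  have e: "e > 0" using ne by (simp add: e_def)
  have cont: "continuous_on W (?DD u v)" for u v
    using f2 by (simp add: numeral_2_eq_2)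
  have ev: "\<forall>\<^sub>F y in nhds x. dist (?DD u v y) (?DD u v x) < e" for u v
    using cont[of u v] W e by (simp add: continuous_on_eq_continuous_at continuous_at tendsto_iff eventually_nhds_conv_at)
  have "\<forall>\<^sub>F y in nhds x. y \<in> W \<and> dist (?DD u v y) (?DD u v x) < e \<and> dist (?DD v u y) (?DD v u x) < e"
    using ev[of u v] ev[of v u] eventually_nhds_in_open[OF W] by eventually_elim auto
  then obtain d where d: "d > 0" and dW: "\<And>y. dist y x < d \<Longrightarrow>
      y \<in> W \<and> dist (?DD u v y) (?DD u v x) < e \<and> dist (?DD v u y) (?DD v u x) < e"
    unfolding eventually_nhds_metric by blast
  \<comment> \<open>small enough for both parallelograms to lie in the ball of radius \<open>d\<close>\<close>
  define h where "h = d / (2 * (norm u + norm v + 1))"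
  have nn: "norm u + norm v + 1 > 0" by (smt (verit) norm_ge_zero)
  have h: "h > 0" using d nn by (simp add: h_def)
  have near: "dist (x + s *\<^sub>R u + t *\<^sub>R v) x < d"
    if "0 \<le> s" "s \<le> h" "0 \<le> t" "t \<le> h" and nuv: "norm u + norm v \<le> d / (2*h) - 1" for s t u v
  proof -
    have "dist (x + s *\<^sub>R u + t *\<^sub>R v) x \<le> norm (s *\<^sub>R u) + norm (t *\<^sub>R v)"
      using norm_triangle_ineq[of "s *\<^sub>R u" "t *\<^sub>R v"] by (simp add: dist_norm add.assoc)
    also have "\<dots> \<le> h * norm u + h * norm v"
      using that by (auto intro!: add_mono mult_right_mono)
    also have "\<dots> = h * (norm u + norm v)" by (simp add: algebra_simps)
    also have "\<dots> \<le> h * (d / (2*h) - 1)" using nuv h by (intro mult_left_mono) auto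
    also have "\<dots> < d" using h d by (simp add: field_simps add_pos_pos)
    finally show ?thesis .
  qed
  have n1: "norm u + norm v \<le> d / (2*h) - 1" using d nn by (simp add: h_def add_divide_distrib)
  then have n2: "norm v + norm u \<le> d / (2*h) - 1" by simp
  obtain s t where st: "0 < s" "s < h" "0 < t" "t < h"
    "f (x + h *\<^sub>R u + h *\<^sub>R v) - f (x + h *\<^sub>R u) - f (x + h *\<^sub>R v) + f x = h * h * ?DD u v (x + s *\<^sub>R u + t *\<^sub>R v)"
    using second_derivative_MVT[of h x u v W f, OF _ f2 h] near[OF _ _ _ _ n1, THEN dW, THEN conjunct1] by auto
  obtain s' t' where st': "0 < s'" "s' < h" "0 < t'" "t' < h"
    "f (x + h *\<^sub>R v + h *\<^sub>R u) - f (x + h *\<^sub>R v) - f (x + h *\<^sub>R u) + f x = h * h * ?DD v u (x + s' *\<^sub>R v + t' *\<^sub>R u)"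
    using second_derivative_MVT[of h x v u W f, OF _ f2 h] near[OF _ _ _ _ n2, THEN dW, THEN conjunct1] by auto
  have "h * h * ?DD u v (x + s *\<^sub>R u + t *\<^sub>R v) = h * h * ?DD v u (x + s' *\<^sub>R v + t' *\<^sub>R u)"
    unfolding st(5)[symmetric] st'(5)[symmetric] by (simp add: add_ac)
  then have eq: "?DD u v (x + s *\<^sub>R u + t *\<^sub>R v) = ?DD v u (x + s' *\<^sub>R v + t' *\<^sub>R u)" using h by simp
  have "dist (?DD u v (x + s *\<^sub>R u + t *\<^sub>R v)) (?DD u v x) < e"
    by (intro dW[THEN conjunct2, THEN conjunct1] near[OF _ _ _ _ n1]) (use st in auto)
  moreover have "dist (?DD v u (x + s' *\<^sub>R v + t' *\<^sub>R u)) (?DD v u x) < e"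
    by (intro dW[THEN conjunct2, THEN conjunct2] near[OF _ _ _ _ n2]) (use st' in auto)
  ultimately show False using eq unfolding e_def dist_real_def by argo
qed

lemma second_derivative_symmetric:
  fixes f :: "'a::euclidean_space \<Rightarrow> 'b::euclidean_space"
  assumes W: "open W" "x \<in> W" and f2: "Ck_on 2 W f"
  shows "frechet_derivative (\<lambda>y. frechet_derivative f (at y) u) (at x) v =
         frechet_derivative (\<lambda>y. frechet_derivative f (at y) v) (at x) u"
proof (rule euclidean_eqI)
  fix b :: 'b assume "b \<in> Basis"
  have d1: "frechet_derivative (\<lambda>y. f y \<bullet> b) (at y) w = frechet_derivative f (at y) w \<bullet> b" if "y \<in> W" for y w
  proof -
    have "(f has_derivative frechet_derivative f (at y)) (at y)"
      using f2 Ck_on_D[of 1 W f] that by (simp add: numeral_2_eq_2)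
    from frechet_derivative_at[OF has_derivative_inner_left[OF this, of b]] show ?thesis by metis
  qed
  have d2: "frechet_derivative (\<lambda>y. frechet_derivative (\<lambda>y. f y \<bullet> b) (at y) u) (at x) v
     = frechet_derivative (\<lambda>y. frechet_derivative f (at y) u) (at x) v \<bullet> b" for u v
  proof -
    have "((\<lambda>y. frechet_derivative f (at y) u) has_derivative
        frechet_derivative (\<lambda>y. frechet_derivative f (at y) u) (at x)) (at x)"
      using f2 Ck_on_D[of 0 W "\<lambda>y. frechet_derivative f (at y) u"] W by (auto simp: numeral_2_eq_2)
    from has_derivative_inner_left[OF this, of b]
    have "((\<lambda>y. frechet_derivative (\<lambda>y. f y \<bullet> b) (at y) u) has_derivative
        (\<lambda>v. frechet_derivative (\<lambda>y. frechet_derivative f (at y) u) (at x) v \<bullet> b)) (at x)"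
      by (rule has_derivative_transform_within_open[OF _ W]) (simp add: d1)
    from frechet_derivative_at[OF this] show ?thesis by metis
  qed
  have "Ck_on 2 W (\<lambda>y. f y \<bullet> b)"
    by (rule Ck_on_bounded_linear[OF W(1) bounded_linear_inner_left f2])
  from second_derivative_symmetric_real[OF W this, of u v]
  show "frechet_derivative (\<lambda>y. frechet_derivative f (at y) u) (at x) v \<bullet> b =
        frechet_derivative (\<lambda>y. frechet_derivative f (at y) v) (at x) u \<bullet> b"
    by (simp add: d2)
qed

section \<open>Smooth maps on subsets of the half space\<close>

lemma smooth_onE:
  assumes "smooth_on S f" "x \<in> S"
  obtains W F where "open W" "x \<in> W" "\<And>k. Ck_on k W F" "\<And>y. y \<in> W \<Longrightarrow> y \<in> S \<Longrightarrow> F y = f y"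
proof -
  obtain W F where "open W \<and> x \<in> W \<and> (\<forall>k. Ck_on k W F) \<and> (\<forall>y\<in>W \<inter> S. F y = f y)"
    using bspec[OF assms(1)[unfolded smooth_on_def] assms(2)] by (elim exE)
  then show ?thesis using that[of W F] by simp
qed

lemma smooth_onI:
  assumes "\<And>x. x \<in> S \<Longrightarrow> \<exists>W F. open W \<and> x \<in> W \<and> (\<forall>k. Ck_on k W F) \<and> (\<forall>y\<in>W \<inter> S. F y = f y)"
  shows "smooth_on S f"
  using assms unfolding smooth_on_def by blast

lemma smooth_on_Ck:
  assumes "open W" "\<And>k. Ck_on k W f" "S \<subseteq> W"
  shows "smooth_on S f"
  using assms by (intro smooth_onI) blast

lemma smooth_on_subset:
  assumes "smooth_on S f" "T \<subseteq> S" shows "smooth_on T f"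
proof (rule smooth_onI)
  fix x assume "x \<in> T"
  then obtain W F where "open W" "x \<in> W" "\<And>k. Ck_on k W F" "\<And>y. y \<in> W \<Longrightarrow> y \<in> S \<Longrightarrow> F y = f y"
    using smooth_onE[OF assms(1), of x] assms(2) by blast
  then show "\<exists>W F. open W \<and> x \<in> W \<and> (\<forall>k. Ck_on k W F) \<and> (\<forall>y\<in>W \<inter> T. F y = f y)"
    using assms(2) by (intro exI[of _ W] exI[of _ F]) auto
qed

lemma smooth_on_cong: "smooth_on S f \<Longrightarrow> (\<And>x. x \<in> S \<Longrightarrow> f x = g x) \<Longrightarrow> smooth_on S g"
  unfolding smooth_on_def by (metis Int_iff)

lemma smooth_on_local:
  assumes "\<And>x. x \<in> S \<Longrightarrow> \<exists>V. open V \<and> x \<in> V \<and> smooth_on (V \<inter> S) f"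
  shows "smooth_on S f"
proof (rule smooth_onI)
  fix x assume x: "x \<in> S"
  from assms[OF x] obtain V where V: "open V" "x \<in> V" "smooth_on (V \<inter> S) f" by blast
  obtain W F where "open W" "x \<in> W" "\<And>k. Ck_on k W F" "\<And>y. y \<in> W \<Longrightarrow> y \<in> V \<inter> S \<Longrightarrow> F y = f y"
    using smooth_onE[OF V(3), of x] x V by blast
  then show "\<exists>W F. open W \<and> x \<in> W \<and> (\<forall>k. Ck_on k W F) \<and> (\<forall>y\<in>W \<inter> S. F y = f y)"
    using V Ck_on_subset[of _ W F "W \<inter> V"] by (intro exI[of _ "W \<inter> V"] exI[of _ F]) auto
qed

lemma smooth_on_continuous: "smooth_on S f \<Longrightarrow> continuous_on S f"
proof -
  assume s: "smooth_on S f"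
  have "continuous (at x within S) f" if x: "x \<in> S" for x
  proof -
    obtain W F where W: "open W" "x \<in> W" "\<And>k. Ck_on k W F" "\<And>y. y \<in> W \<Longrightarrow> y \<in> S \<Longrightarrow> F y = f y"
      using smooth_onE[OF s x] by metis
    have "continuous_on W F" using W(3)[of 0] by simp
    then have "continuous (at x) F" using W by (simp add: continuous_on_eq_continuous_at)
    then have "continuous (at x within S) F" by (rule continuous_at_imp_continuous_at_within)
    then have "(F \<longlongrightarrow> F x) (at x within S)" by (simp add: continuous_within)
    moreover have "\<forall>\<^sub>F y in at x within S. F y = f y"
      using W by (auto simp: eventually_at_topological)
    ultimately have "(f \<longlongrightarrow> F x) (at x within S)" by (rule Lim_transform_eventually)
    then show ?thesis using W x by (simp add: continuous_within)
  qed
  then show ?thesis by (simp add: continuous_on_eq_continuous_within)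
qed

lemma smooth_on_const: "smooth_on S (\<lambda>x. c)"
  by (rule smooth_on_Ck[of UNIV]) (auto intro: Ck_on_const)

lemma smooth_on_ident: "smooth_on S (\<lambda>x. x)"
  by (rule smooth_on_Ck[of UNIV]) (auto intro: Ck_on_ident)

lemma smooth_on_bounded_linear:
  assumes "bounded_linear L" "smooth_on S f"
  shows "smooth_on S (\<lambda>x. L (f x))"
proof (rule smooth_onI)
  fix x assume x: "x \<in> S"
  obtain W F where "open W" "x \<in> W" "\<And>k. Ck_on k W F" "\<And>y. y \<in> W \<Longrightarrow> y \<in> S \<Longrightarrow> F y = f y"
    using smooth_onE[OF assms(2) x] by metis
  then show "\<exists>W F. open W \<and> x \<in> W \<and> (\<forall>k. Ck_on k W F) \<and> (\<forall>y\<in>W \<inter> S. F y = L (f y))"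
    by (intro exI[of _ W] exI[of _ "\<lambda>x. L (F x)"] conjI allI Ck_on_bounded_linear[OF _ assms(1)]) auto
qed

lemma smooth_on_add:
  assumes "smooth_on S f" "smooth_on S g"
  shows "smooth_on S (\<lambda>x. f x + g x)"
proof (rule smooth_onI)
  fix x assume x: "x \<in> S"
  obtain W F where W: "open W" "x \<in> W" "\<And>k. Ck_on k W F" "\<And>y. y \<in> W \<Longrightarrow> y \<in> S \<Longrightarrow> F y = f y"
    using smooth_onE[OF assms(1) x] by metis
  obtain V G where V: "open V" "x \<in> V" "\<And>k. Ck_on k V G" "\<And>y. y \<in> V \<Longrightarrow> y \<in> S \<Longrightarrow> G y = g y"
    using smooth_onE[OF assms(2) x] by metis
  show "\<exists>W F. open W \<and> x \<in> W \<and> (\<forall>k. Ck_on k W F) \<and> (\<forall>y\<in>W \<inter> S. F y = f y + g y)"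
    using W V by (intro exI[of _ "W \<inter> V"] exI[of _ "\<lambda>x. F x + G x"])
      (auto intro!: Ck_on_add intro: Ck_on_subset)
qed

lemma smooth_on_scaleR:
  fixes f :: "'a::euclidean_space \<Rightarrow> real"
  assumes "smooth_on S f" "smooth_on S g"
  shows "smooth_on S (\<lambda>x. f x *\<^sub>R g x)"
proof (rule smooth_onI)
  fix x assume x: "x \<in> S"
  obtain W F where W: "open W" "x \<in> W" "\<And>k. Ck_on k W F" "\<And>y. y \<in> W \<Longrightarrow> y \<in> S \<Longrightarrow> F y = f y"
    using smooth_onE[OF assms(1) x] by metis
  obtain V G where V: "open V" "x \<in> V" "\<And>k. Ck_on k V G" "\<And>y. y \<in> V \<Longrightarrow> y \<in> S \<Longrightarrow> G y = g y"
    using smooth_onE[OF assms(2) x] by metis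
  show "\<exists>W F. open W \<and> x \<in> W \<and> (\<forall>k. Ck_on k W F) \<and> (\<forall>y\<in>W \<inter> S. F y = f y *\<^sub>R g y)"
    using W V by (intro exI[of _ "W \<inter> V"] exI[of _ "\<lambda>x. F x *\<^sub>R G x"])
      (auto intro!: Ck_on_scaleR intro: Ck_on_subset)
qed

lemma smooth_on_sum:
  assumes "\<And>i. i \<in> I \<Longrightarrow> smooth_on S (f i)"
  shows "smooth_on S (\<lambda>x. \<Sum>i\<in>I. f i x)"
  using assms
  by (induction I rule: infinite_finite_induct) (auto simp: smooth_on_const smooth_on_add)

lemma smooth_on_inverse:
  fixes f :: "'a::euclidean_space \<Rightarrow> real"
  assumes "smooth_on S f" "\<And>x. x \<in> S \<Longrightarrow> f x \<noteq> 0"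
  shows "smooth_on S (\<lambda>x. inverse (f x))"
proof (rule smooth_onI)
  fix x assume x: "x \<in> S"
  obtain W F where W: "open W" "x \<in> W" "\<And>k. Ck_on k W F" "\<And>y. y \<in> W \<Longrightarrow> y \<in> S \<Longrightarrow> F y = f y"
    using smooth_onE[OF assms(1) x] by metis
  have "continuous_on W F" using W(3)[of 0] by simp
  then have o: "open (W \<inter> F -` (-{0}))" using W(1) by (intro continuous_open_preimage) auto
  show "\<exists>W F. open W \<and> x \<in> W \<and> (\<forall>k. Ck_on k W F) \<and> (\<forall>y\<in>W \<inter> S. F y = inverse (f y))"
    using W x assms(2) o
    by (intro exI[of _ "W \<inter> F -` (-{0})"] exI[of _ "\<lambda>x. inverse (F x)"])
      (auto intro!: Ck_on_inverse intro: Ck_on_subset)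
qed

lemma smooth_on_compose:
  fixes f :: "'b::euclidean_space \<Rightarrow> 'c::real_normed_vector"
  assumes "smooth_on T f" "smooth_on S g" "\<And>x. x \<in> S \<Longrightarrow> g x \<in> T"
  shows "smooth_on S (\<lambda>x. f (g x))"
proof (rule smooth_onI)
  fix x assume x: "x \<in> S"
  obtain V G where V: "open V" "x \<in> V" "\<And>k. Ck_on k V G" "\<And>y. y \<in> V \<Longrightarrow> y \<in> S \<Longrightarrow> G y = g y"
    using smooth_onE[OF assms(2) x] by metis
  obtain W F where W: "open W" "g x \<in> W" "\<And>k. Ck_on k W F" "\<And>y. y \<in> W \<Longrightarrow> y \<in> T \<Longrightarrow> F y = f y"
    using smooth_onE[OF assms(1) assms(3)[OF x]] by metis
  have "continuous_on V G" using V(3)[of 0] by simp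
  then have o: "open (V \<inter> G -` W)" using V(1) W(1) by (intro continuous_open_preimage) auto
  have "Ck_on k (V \<inter> G -` W) (\<lambda>x. F (G x))" for k
    by (rule Ck_on_compose[OF o W(1) Ck_on_subset[OF V(3)] W(3)]) auto
  then show "\<exists>W F. open W \<and> x \<in> W \<and> (\<forall>k. Ck_on k W F) \<and> (\<forall>y\<in>W \<inter> S. F y = f (g y))"
    using W(2,4) V(2,4) x assms(3) o
    by (intro exI[of _ "V \<inter> G -` W"] exI[of _ "\<lambda>x. F (G x)"]) auto
qed

text \<open>At a point of a relatively open subset \<open>S\<close> of the half space, the filters \<open>at x within S\<close> and
  \<open>at x within half_space\<close> agree. All derivatives are therefore taken within the half space, which
  makes derivatives on different chart images comparable.\<close>

abbreviation hopen :: "'a::euclidean_space set \<Rightarrow> bool" where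
  "hopen S \<equiv> openin (top_of_set half_space) S"

abbreviation Dh :: "('a::euclidean_space \<Rightarrow> 'b::real_normed_vector) \<Rightarrow> 'a \<Rightarrow> 'a \<Rightarrow> 'b" where
  "Dh f x \<equiv> frechet_derivative f (at x within half_space)"

lemma normal_dir_Basis [simp]: "normal_dir \<in> Basis"
  unfolding normal_dir_def by (rule someI_ex) (use nonempty_Basis in blast)

lemma normal_dir_inner [simp]: "normal_dir \<bullet> normal_dir = 1"
  by (simp add: inner_Basis)

lemma hopen_half: "hopen S \<Longrightarrow> x \<in> S \<Longrightarrow> x \<in> half_space"
  using openin_imp_subset by blast

lemma at_within_hopen: "hopen S \<Longrightarrow> x \<in> S \<Longrightarrow> at x within S = at x within half_space"
proof -
  assume "hopen S" "x \<in> S"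
  then obtain T where "open T" "S = half_space \<inter> T" unfolding openin_open by blast
  then show ?thesis using \<open>x \<in> S\<close> at_within_nhd[of x T S half_space] by auto
qed

lemma at_within_interior_half:
  assumes "x \<bullet> normal_dir > 0" shows "at x within half_space = at x"
proof -
  have "open {x::'a. x \<bullet> normal_dir > 0}"
    using open_halfspace_gt[of 0 "normal_dir::'a"] by (simp add: inner_commute)
  then show ?thesis
    using assms by (intro at_within_nhd[of x "{x. x \<bullet> normal_dir > 0}"]) (auto simp: half_space_def)
qed

text \<open>From a boundary point one can still move a little along every basis vector, inwards along the
  normal one, and this determines the derivative.\<close>

lemma half_space_derivative_unique:
  fixes f :: "'a::euclidean_space \<Rightarrow> 'b::real_normed_vector"
  assumes "(f has_derivative f') (at x within half_space)" "(f has_derivative f'') (at x within half_space)"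
    "x \<in> half_space"
  shows "f' = f''"
proof (rule frechet_derivative_unique_within[OF assms(1,2)])
  fix i :: 'a and e :: real assume "i \<in> Basis" "e > 0"
  then show "\<exists>d. 0 < \<bar>d\<bar> \<and> \<bar>d\<bar> < e \<and> x + d *\<^sub>R i \<in> half_space"
    using assms(3) by (intro exI[of _ "e/2"]) (auto simp: half_space_def inner_simps inner_Basis)
qed

lemma Dh_eq:
  assumes "(f has_derivative f') (at x within half_space)" "x \<in> half_space"
  shows "Dh f x = f'"
  using half_space_derivative_unique[OF assms(1) _ assms(2)] differentiableI[OF assms(1)]
  by (simp add: frechet_derivative_works)

lemma eventually_hopen:
  assumes "hopen S" "x \<in> S" shows "\<forall>\<^sub>F y in at x within half_space. y \<in> S"
  unfolding at_within_hopen[OF assms, symmetric] by (simp add: eventually_at_filter)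

lemma has_derivative_cong_hopen:
  assumes "hopen S" "x \<in> S" "\<And>y. y \<in> S \<Longrightarrow> f y = g y"
    "(f has_derivative f') (at x within half_space)"
  shows "(g has_derivative f') (at x within half_space)"
  using assms(4)
  by (rule has_derivative_transform_eventually)
    (use assms eventually_mono[OF eventually_hopen[OF assms(1,2)]] hopen_half in auto)

lemma Dh_cong:
  assumes "hopen S" "x \<in> S" "\<And>y. y \<in> S \<Longrightarrow> f y = g y"
  shows "Dh f x = Dh g x"
proof -
  have "(f has_derivative f') (at x within half_space) \<longleftrightarrow> (g has_derivative f') (at x within half_space)" for f'
    using has_derivative_cong_hopen[OF assms(1,2), of f g f'] has_derivative_cong_hopen[OF assms(1,2), of g f f'] assms(3)
    by auto
  then show ?thesis unfolding frechet_derivative_def by simp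
qed

lemma has_derivative_chain_hopen:
  assumes "hopen S" "x \<in> S" "\<And>y. y \<in> S \<Longrightarrow> g y \<in> half_space"
    "(g has_derivative g') (at x within half_space)"
    "(f has_derivative f') (at (g x) within half_space)"
  shows "((\<lambda>y. f (g y)) has_derivative (\<lambda>v. f' (g' v))) (at x within half_space)"
proof -
  have "(g has_derivative g') (at x within S)"
    using assms(4) unfolding at_within_hopen[OF assms(1,2)] .
  moreover have "(f has_derivative f') (at (g x) within g ` S)"
    by (rule has_derivative_subset[OF assms(5)]) (use assms(3) in auto)
  ultimately have "((\<lambda>y. f (g y)) has_derivative (\<lambda>v. f' (g' v))) (at x within S)"
    using diff_chain_within[of g g' x S f f'] by (simp add: o_def)
  then show ?thesis unfolding at_within_hopen[OF assms(1,2)] .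
qed

lemma family_derivative_linear:
  fixes L :: "'a::euclidean_space \<Rightarrow> 'b::real_vector \<Rightarrow> 'c::real_normed_vector"
  assumes S: "hopen S" "x \<in> S" and L: "\<And>z. z \<in> S \<Longrightarrow> linear (L z)"
    and L': "\<And>u. ((\<lambda>z. L z u) has_derivative (\<lambda>v. L' v u)) (at x within half_space)"
  shows "linear (L' v)"
proof -
  have uniq: "f' = f''" if "(f has_derivative f') (at x within half_space)" "(f has_derivative f'') (at x within half_space)"
    for f :: "'a \<Rightarrow> 'c" and f' f''
    using half_space_derivative_unique[OF that] hopen_half[OF S] by blast
  show ?thesis
  proof
    fix u w
    have "((\<lambda>z. L z (u + w)) has_derivative (\<lambda>v. L' v u + L' v w)) (at x within half_space)"
      by (rule has_derivative_cong_hopen[OF S _ has_derivative_add[OF L' L']]) (simp add: linear_add[OF L])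
    then have "(\<lambda>v. L' v (u + w)) = (\<lambda>v. L' v u + L' v w)" using uniq L' by blast
    then show "L' v (u + w) = L' v u + L' v w" by metis
  next
    fix r u
    have "((\<lambda>z. L z (r *\<^sub>R u)) has_derivative (\<lambda>v. r *\<^sub>R L' v u)) (at x within half_space)"
      by (rule has_derivative_cong_hopen[OF S _ has_derivative_scaleR_right[OF L']]) (simp add: linear_scale[OF L])
    then have "(\<lambda>v. L' v (r *\<^sub>R u)) = (\<lambda>v. r *\<^sub>R L' v u)" using uniq L' by blast
    then show "L' v (r *\<^sub>R u) = r *\<^sub>R L' v u" by metis
  qed
qed

text \<open>The product rule for a field of linear maps evaluated on a vector field, with the derivative of
  the field of linear maps known only on constant vectors.\<close>

lemma has_derivative_linear_family:
  fixes L :: "'a::euclidean_space \<Rightarrow> 'b::euclidean_space \<Rightarrow> 'c::real_normed_vector"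
  assumes S: "hopen S" "x \<in> S" and L: "\<And>z. z \<in> S \<Longrightarrow> linear (L z)"
    and L': "\<And>u. ((\<lambda>z. L z u) has_derivative (\<lambda>v. L' v u)) (at x within half_space)"
    and X: "(X has_derivative X') (at x within half_space)"
  shows "((\<lambda>z. L z (X z)) has_derivative (\<lambda>v. L x (X' v) + L' v (X x))) (at x within half_space)"
proof -
  have L'X: "L' v (X x) = (\<Sum>b\<in>Basis. (X x \<bullet> b) *\<^sub>R L' v b)" for v
    by (rule linear_Basis_expansion[OF family_derivative_linear[OF S L L']])
  have LX: "L z w = (\<Sum>b\<in>Basis. (w \<bullet> b) *\<^sub>R L z b)" if "z \<in> S" for z w
    by (rule linear_Basis_expansion[OF L[OF that]])
  have "((\<lambda>z. \<Sum>b\<in>Basis. (X z \<bullet> b) *\<^sub>R L z b) has_derivative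
      (\<lambda>v. \<Sum>b\<in>Basis. (X x \<bullet> b) *\<^sub>R L' v b + (X' v \<bullet> b) *\<^sub>R L x b)) (at x within half_space)"
    by (intro has_derivative_sum has_derivative_scaleR has_derivative_inner_left X L')
  then have "((\<lambda>z. L z (X z)) has_derivative
      (\<lambda>v. \<Sum>b\<in>Basis. (X x \<bullet> b) *\<^sub>R L' v b + (X' v \<bullet> b) *\<^sub>R L x b)) (at x within half_space)"
    by (rule has_derivative_cong_hopen[OF S, rotated]) (rule LX[symmetric])
  moreover have "(\<Sum>b\<in>Basis. (X x \<bullet> b) *\<^sub>R L' v b + (X' v \<bullet> b) *\<^sub>R L x b) = L x (X' v) + L' v (X x)" for v
    unfolding L'X LX[OF S(2), of "X' v"] by (simp add: sum.distrib)
  ultimately show ?thesis by simp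
qed

lemma has_derivative_bilinear_family:
  fixes B :: "'a::euclidean_space \<Rightarrow> 'b::euclidean_space \<Rightarrow> 'd::euclidean_space \<Rightarrow> 'c::real_normed_vector"
  assumes S: "hopen S" "x \<in> S" and B: "\<And>z. z \<in> S \<Longrightarrow> bilinear (B z)"
    and B': "\<And>u w. ((\<lambda>z. B z u w) has_derivative (\<lambda>v. B' v u w)) (at x within half_space)"
    and X: "(X has_derivative X') (at x within half_space)"
    and Y: "(Y has_derivative Y') (at x within half_space)"
  shows "((\<lambda>z. B z (X z) (Y z)) has_derivative
     (\<lambda>v. B x (X' v) (Y x) + (B x (X x) (Y' v) + B' v (X x) (Y x)))) (at x within half_space)"
proof (rule has_derivative_linear_family[OF S _ _ X])
  show "linear (\<lambda>u. B z u (Y z))" if "z \<in> S" for z using B[OF that] by (simp add: bilinear_def)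
  show "((\<lambda>z. B z u (Y z)) has_derivative (\<lambda>v. B x u (Y' v) + B' v u (Y x))) (at x within half_space)" for u
    by (rule has_derivative_linear_family[OF S _ B' Y]) (use B in \<open>simp add: bilinear_def\<close>)
qed

lemma hopen_Int_open: "hopen S \<Longrightarrow> open W \<Longrightarrow> hopen (W \<inter> S)"
  by (simp add: openin_Int_open Int_commute)

lemma smooth_on_D:
  assumes "hopen S" "smooth_on S f" "x \<in> S"
  shows "(f has_derivative Dh f x) (at x within half_space)"
proof -
  obtain W F where W: "open W" "x \<in> W" "\<And>k. Ck_on k W F" "\<And>y. y \<in> W \<Longrightarrow> y \<in> S \<Longrightarrow> F y = f y"
    using smooth_onE[OF assms(2,3)] by metis
  have "(F has_derivative frechet_derivative F (at x)) (at x within half_space)"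
    using Ck_on_D[OF W(3) W(2)] has_derivative_at_withinI by blast
  then have "(f has_derivative frechet_derivative F (at x)) (at x within half_space)"
    using has_derivative_cong_hopen[OF hopen_Int_open[OF assms(1) W(1)], of x F f] W assms(3) by auto
  then show ?thesis using Dh_eq[OF _ hopen_half[OF assms(1,3)]] by metis
qed

lemma Dh_interior: "x \<bullet> normal_dir > 0 \<Longrightarrow> Dh f x = frechet_derivative f (at x)"
  by (simp add: at_within_interior_half)

lemma smooth_on_Dh:
  assumes "hopen S" "smooth_on S f"
  shows "smooth_on S (\<lambda>x. Dh f x v)"
proof (rule smooth_onI)
  fix x assume x: "x \<in> S"
  obtain W F where W: "open W" "x \<in> W" "\<And>k. Ck_on k W F" "\<And>y. y \<in> W \<Longrightarrow> y \<in> S \<Longrightarrow> F y = f y"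
    using smooth_onE[OF assms(2) x] by metis
  have "frechet_derivative F (at y) v = Dh f y v" if y: "y \<in> W" "y \<in> S" for y
  proof -
    have "(F has_derivative frechet_derivative F (at y)) (at y within half_space)"
      using Ck_on_D[OF W(3) y(1)] has_derivative_at_withinI by blast
    then have "(f has_derivative frechet_derivative F (at y)) (at y within half_space)"
      using has_derivative_cong_hopen[OF hopen_Int_open[OF assms(1) W(1)], of y F f] W y by auto
    then show ?thesis using Dh_eq[OF _ hopen_half[OF assms(1) y(2)]] by metis
  qed
  moreover have "Ck_on k W (\<lambda>y. frechet_derivative F (at y) v)" for k
    using W(3)[of "Suc k"] by simp
  ultimately show "\<exists>W F. open W \<and> x \<in> W \<and> (\<forall>k. Ck_on k W F) \<and> (\<forall>y\<in>W \<inter> S. F y = Dh f y v)"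
    using W by (intro exI[of _ W] exI[of _ "\<lambda>y. frechet_derivative F (at y) v"]) auto
qed

lemma smooth_on_Dh_linear:
  assumes "hopen S" "smooth_on S f" "x \<in> S"
  shows "linear (Dh f x)"
  using smooth_on_D[OF assms] has_derivative_linear by blast

lemma smooth_on_interior_Ck:
  assumes S: "hopen S" "smooth_on S f" and x: "x \<in> S" "x \<bullet> normal_dir > 0"
  obtains W where "open W" "x \<in> W" "W \<subseteq> S" "\<And>y. y \<in> W \<Longrightarrow> y \<bullet> normal_dir > 0" "\<And>k. Ck_on k W f"
proof -
  obtain W F where W: "open W" "x \<in> W" "\<And>k. Ck_on k W F" "\<And>y. y \<in> W \<Longrightarrow> y \<in> S \<Longrightarrow> F y = f y"
    using smooth_onE[OF S(2) x(1)] by metis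
  obtain T where T: "open T" "S = half_space \<inter> T" using S(1) unfolding openin_open by blast
  have oh: "open {x::'a. x \<bullet> normal_dir > 0}"
    using open_halfspace_gt[of 0 "normal_dir::'a"] by (simp add: inner_commute)
  let ?V = "W \<inter> T \<inter> {x::'a. x \<bullet> normal_dir > 0}"
  have o: "open ?V" using W T oh by auto
  have sub: "?V \<subseteq> S" using T(2) by (auto simp: half_space_def)
  have "Ck_on k ?V f" for k
    by (rule Ck_on_cong[OF o _ Ck_on_subset[OF W(3)]]) (use W(4) sub in auto)
  moreover have "x \<in> ?V" using x T W by auto
  ultimately show ?thesis by (intro that[OF o _ sub]) auto
qed

text \<open>Near an interior point \<open>Dh\<close> is the ordinary derivative, to which Schwarz's theorem applies.\<close>

lemma Dh_Dh_symmetric: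
  fixes f :: "'a::euclidean_space \<Rightarrow> 'b::euclidean_space"
  assumes S: "hopen S" "smooth_on S f" and x: "x \<in> S" "x \<bullet> normal_dir > 0"
  shows "Dh (\<lambda>y. Dh f y u) x v = Dh (\<lambda>y. Dh f y v) x u"
proof -
  obtain W where W: "open W" "x \<in> W" "W \<subseteq> S" "\<And>y. y \<in> W \<Longrightarrow> y \<bullet> normal_dir > 0" "\<And>k. Ck_on k W f"
    using smooth_on_interior_Ck[OF S x] by metis
  have ho: "hopen W" using W by (intro open_subset) (auto simp: half_space_def intro: less_imp_le)
  have "Dh (\<lambda>y. Dh f y u) x = frechet_derivative (\<lambda>y. frechet_derivative f (at y) u) (at x)" for u
    using Dh_cong[OF ho W(2), of "\<lambda>y. Dh f y u" "\<lambda>y. frechet_derivative f (at y) u"] Dh_interior[OF x(2)] W(4)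
    by (auto simp: Dh_interior)
  then show ?thesis using second_derivative_symmetric[OF W(1,2,5)] by simp
qed

text \<open>The passage to the boundary in all arguments below: an identity is proved at interior points,
  where one may divide by \<open>\<rho>\<close>, in a form in which both sides are continuous up to the boundary.\<close>

lemma eq_at_boundary_by_continuity:
  fixes f g :: "'a::euclidean_space \<Rightarrow> 'b::t2_space"
  assumes "hopen S" "continuous_on S f" "continuous_on S g"
    "\<And>y. y \<in> S \<Longrightarrow> y \<bullet> normal_dir > 0 \<Longrightarrow> f y = g y" "x \<in> S"
  shows "f x = g x"
proof (cases "x \<bullet> normal_dir > 0")
  case False
  obtain T where T: "open T" "S = half_space \<inter> T" using assms(1) unfolding openin_open by blast
  have xh: "x \<bullet> normal_dir \<ge> 0" "x \<in> T" using assms(5) T by (auto simp: half_space_def)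
  let ?y = "\<lambda>n. x + inverse (real (Suc n)) *\<^sub>R normal_dir"
  have lim: "?y \<longlonglongrightarrow> x"
    using tendsto_add[OF tendsto_const tendsto_scaleR[OF LIMSEQ_inverse_real_of_nat tendsto_const], of x "normal_dir::'a"]
    by simp
  have "\<forall>\<^sub>F n in sequentially. ?y n \<in> T" using topological_tendstoD[OF lim T(1) xh(2)] .
  then have ev: "\<forall>\<^sub>F n in sequentially. ?y n \<in> S \<and> ?y n \<bullet> normal_dir > 0"
    by eventually_elim (use xh T in \<open>auto simp: half_space_def inner_simps add_nonneg_pos\<close>)
  have evS: "\<forall>\<^sub>F n in sequentially. ?y n \<in> S" using ev by eventually_elim simp
  have "(\<lambda>n. f (?y n)) \<longlonglongrightarrow> f x" "(\<lambda>n. g (?y n)) \<longlonglongrightarrow> g x"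
    using continuous_on_tendsto_compose[OF assms(2) lim assms(5) evS]
      continuous_on_tendsto_compose[OF assms(3) lim assms(5) evS] by simp_all
  moreover have "\<forall>\<^sub>F n in sequentially. f (?y n) = g (?y n)"
    using ev by eventually_elim (use assms(4) in auto)
  ultimately show ?thesis
    using LIMSEQ_unique[of "\<lambda>n. g (?y n)"] tendsto_cong[of "\<lambda>n. f (?y n)" "\<lambda>n. g (?y n)"] by simp
qed (use assms in auto)

section \<open>Division by the normal coordinate\<close>

text \<open>As \<open>t\<close> runs from \<open>0\<close> to \<open>1\<close>, the point moves from the orthogonal projection of \<open>x\<close> to the
  boundary hyperplane to \<open>x\<close> itself.\<close>

definition to_boundary :: "real \<Rightarrow> 'a::euclidean_space \<Rightarrow> 'a" where
  "to_boundary t x = x - ((1 - t) * (x \<bullet> normal_dir)) *\<^sub>R normal_dir"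

lemma to_boundary_bounded_linear: "bounded_linear (to_boundary t)"
  unfolding to_boundary_def
  by (intro bounded_linear_sub bounded_linear_ident bounded_linear_scaleR_const
     bounded_linear_const_mult bounded_linear_inner_left)

lemma to_boundary_split: "to_boundary t v = to_boundary 0 v + (t * (v \<bullet> normal_dir)) *\<^sub>R normal_dir"
  unfolding to_boundary_def by (simp add: algebra_simps)

lemma to_boundary_ball:
  assumes "x0 \<bullet> normal_dir = 0" "x \<in> ball x0 r" "0 \<le> t" "t \<le> 1"
  shows "to_boundary t x \<in> ball x0 r"
proof -
  have "norm (x0 - to_boundary t x) \<le> norm (x0 - x)"
  proof (rule norm_le_componentwise)
    fix b :: 'a assume "b \<in> Basis"
    then have "to_boundary t x \<bullet> b = (if b = normal_dir then t * (x \<bullet> normal_dir) else x \<bullet> b)"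
      by (auto simp: to_boundary_def inner_simps inner_Basis algebra_simps)
    then show "\<bar>(x0 - to_boundary t x) \<bullet> b\<bar> \<le> \<bar>(x0 - x) \<bullet> b\<bar>"
      using assms(1,3,4) by (auto simp: inner_diff_left abs_mult mult_left_le_one_le)
  qed
  then show ?thesis using assms(2) by (simp add: dist_norm)
qed

lemma continuous_to_boundary: "continuous_on A (\<lambda>(x, t). to_boundary t x)"
  unfolding to_boundary_def split_def by (intro continuous_intros)

text \<open>Differentiation under the integral sign in the normal direction produces a factor \<open>t\<close>. The
  powers of \<open>t\<close> are included in the integrand to make this class of functions closed under
  differentiation.\<close>

lemma Ck_on_weighted_ray_integral:
  fixes K :: "'a::euclidean_space \<Rightarrow> 'b::banach"
  assumes x0: "x0 \<bullet> normal_dir = 0" and K: "\<And>k. Ck_on k (ball x0 r) K"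
  shows "Ck_on k (ball x0 r) (\<lambda>x. integral (cbox 0 1) (\<lambda>t. t ^ m *\<^sub>R K (to_boundary t x)))"
  using K
proof (induction k arbitrary: m K)
  let ?W = "ball x0 r"
  have cont: "continuous_on (?W \<times> cbox 0 1) (\<lambda>(x, t). t ^ m *\<^sub>R L (to_boundary t x))"
    if "continuous_on ?W L" for L :: "'a \<Rightarrow> 'b" and m
  proof -
    have "continuous_on (?W \<times> cbox 0 1) (\<lambda>p. L (case p of (x, t) \<Rightarrow> to_boundary t x))"
      by (rule continuous_on_compose2[OF that continuous_to_boundary])
        (auto simp del: mem_ball intro!: to_boundary_ball x0)
    then show ?thesis unfolding split_def by (intro continuous_intros) auto
  qed
  have cont1: "continuous_on (cbox 0 1) (\<lambda>t. t ^ m *\<^sub>R L (to_boundary t x))"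
    if "continuous_on ?W L" "x \<in> ?W" for L :: "'a \<Rightarrow> 'b" and m x
  proof -
    have "continuous_on (cbox 0 1) (\<lambda>t::real. (x, t))" by (intro continuous_intros)
    from continuous_on_compose2[OF cont[OF that(1), of m] this] that(2) show ?thesis
      by (auto simp: image_subset_iff)
  qed
  {
    case 0
    have "continuous_on ?W K" using "0.prems"[of 0] by simp
    from integral_continuous_on_param[OF cont[OF this]] show ?case by simp
  next
    case (Suc k)
    let ?D = "\<lambda>x. frechet_derivative K (at x)"
    have DK: "(K has_derivative ?D x) (at x)" if "x \<in> ?W" for x
      using Ck_on_D[OF Suc.prems that] .
    have CD: "Ck_on k ?W (\<lambda>x. ?D x v)" for k v using Suc.prems[of "Suc k"] by simp
    have cD: "continuous_on ?W (\<lambda>x. ?D x v)" for v using CD[of 0 v] by simp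
    have cK: "continuous_on ?W K" using Suc.prems[of 0] by simp
    define fx where "fx = (\<lambda>x t. Blinfun (\<lambda>v. t ^ m *\<^sub>R ?D (to_boundary t x) (to_boundary t v)))"
    have bl: "bounded_linear (\<lambda>v. t ^ m *\<^sub>R ?D (to_boundary t x) (to_boundary t v))" if "x \<in> ?W" "t \<in> cbox 0 1" for x t
      using bounded_linear_compose[OF has_derivative_bounded_linear[OF DK] to_boundary_bounded_linear]
        to_boundary_ball[OF x0 that(1)] that(2)
      by (intro bounded_linear_const_scaleR) auto
    have fx_apply: "fx x t v = t ^ m *\<^sub>R ?D (to_boundary t x) (to_boundary t v)" if "x \<in> ?W" "t \<in> cbox 0 1" for x t v
      unfolding fx_def using bounded_linear_Blinfun_apply[OF bl[OF that]] by simp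
    have fx_split: "fx x t v = t ^ m *\<^sub>R ?D (to_boundary t x) (to_boundary 0 v)
        + (v \<bullet> normal_dir) *\<^sub>R (t ^ Suc m *\<^sub>R ?D (to_boundary t x) normal_dir)" if "x \<in> ?W" "t \<in> cbox 0 1" for x t v
    proof -
      have "linear (?D (to_boundary t x))"
        using DK to_boundary_ball[OF x0 that(1), of t] that has_derivative_linear by auto
      then show ?thesis
        unfolding fx_apply[OF that] to_boundary_split[of t v]
        by (simp add: linear_add linear_scale algebra_simps)
    qed
    have der: "((\<lambda>x. integral (cbox 0 1) (\<lambda>t. t ^ m *\<^sub>R K (to_boundary t x))) has_derivative integral (cbox 0 1) (fx x)) (at x)"
      if x: "x \<in> ?W" for x
    proof -
      have "((\<lambda>x. integral (cbox 0 1) (\<lambda>t. t ^ m *\<^sub>R K (to_boundary t x))) has_derivative integral (cbox 0 1) (fx x)) (at x within ?W)"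
      proof (rule leibniz_rule[OF _ _ _ x convex_ball])
        fix x t assume xt: "x \<in> ?W" "t \<in> cbox (0::real) 1"
        have "((\<lambda>x. t ^ m *\<^sub>R K (to_boundary t x)) has_derivative (\<lambda>v. t ^ m *\<^sub>R ?D (to_boundary t x) (to_boundary t v))) (at x within ?W)"
          using has_derivative_compose[OF bounded_linear_imp_has_derivative[OF to_boundary_bounded_linear], OF DK] to_boundary_ball[OF x0 xt(1)] xt(2)
          by (intro has_derivative_scaleR_right) auto
        then show "((\<lambda>x. t ^ m *\<^sub>R K (to_boundary t x)) has_derivative blinfun_apply (fx x t)) (at x within ?W)"
          by (subst ext[of "blinfun_apply (fx x t)", OF fx_apply[OF xt]])
      next
        fix x assume "x \<in> ?W"
        then show "(\<lambda>t. t ^ m *\<^sub>R K (to_boundary t x)) integrable_on cbox 0 1"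
          by (intro integrable_continuous cont1 cK)
      next
        show "continuous_on (?W \<times> cbox 0 1) (\<lambda>(x, t). fx x t)"
        proof (rule continuous_on_blinfun_componentwise)
          fix i :: 'a assume "i \<in> Basis"
          have "continuous_on (?W \<times> cbox 0 1) (\<lambda>p. (case p of (x, t) \<Rightarrow> t ^ m *\<^sub>R ?D (to_boundary t x) (to_boundary 0 i))
               + (i \<bullet> normal_dir) *\<^sub>R (case p of (x, t) \<Rightarrow> t ^ Suc m *\<^sub>R ?D (to_boundary t x) normal_dir))"
            by (intro continuous_intros cont cD)
          then show "continuous_on (?W \<times> cbox 0 1) (\<lambda>p. blinfun_apply (case p of (x, t) \<Rightarrow> fx x t) i)"
            by (rule continuous_on_eq) (auto simp: fx_split simp del: mem_ball)
        qed
      qed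
      then show ?thesis using at_within_open[OF x open_ball] by simp
    qed
    show ?case
    proof (rule Ck_on_SucI[OF open_ball der])
      fix v
      have "Ck_on k ?W (\<lambda>x. integral (cbox 0 1) (\<lambda>t. t ^ m *\<^sub>R ?D (to_boundary t x) (to_boundary 0 v))
         + (v \<bullet> normal_dir) *\<^sub>R integral (cbox 0 1) (\<lambda>t. t ^ Suc m *\<^sub>R ?D (to_boundary t x) normal_dir))"
        by (intro Ck_on_add Ck_on_scaleR Ck_on_const open_ball Suc.IH CD)
      then show "Ck_on k ?W (\<lambda>x. blinfun_apply (integral (cbox 0 1) (fx x)) v)"
      proof (rule Ck_on_cong[OF open_ball, rotated])
        fix x assume x: "x \<in> ?W"
        have int: "fx x integrable_on cbox 0 1"
        proof (intro integrable_continuous continuous_on_blinfun_componentwise)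
          fix i :: 'a
          have "continuous_on (cbox 0 1) (\<lambda>t. t ^ m *\<^sub>R ?D (to_boundary t x) (to_boundary 0 i)
               + (i \<bullet> normal_dir) *\<^sub>R (t ^ Suc m *\<^sub>R ?D (to_boundary t x) normal_dir))"
            by (intro continuous_intros cont1 cD x)
          then show "continuous_on (cbox 0 1) (\<lambda>t. blinfun_apply (fx x t) i)"
            by (rule continuous_on_eq) (use x fx_split in auto)
        qed
        have "blinfun_apply (integral (cbox 0 1) (fx x)) v = integral (cbox 0 1) (\<lambda>t. fx x t v)"
          by (rule blinfun_apply_integral[OF int])
        also have "\<dots> = integral (cbox 0 1) (\<lambda>t. t ^ m *\<^sub>R ?D (to_boundary t x) (to_boundary 0 v)
        + (v \<bullet> normal_dir) *\<^sub>R (t ^ Suc m *\<^sub>R ?D (to_boundary t x) normal_dir))"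
          by (rule integral_cong) (use fx_split x in auto)
        also have "\<dots> = integral (cbox 0 1) (\<lambda>t. t ^ m *\<^sub>R ?D (to_boundary t x) (to_boundary 0 v))
           + integral (cbox 0 1) (\<lambda>t. (v \<bullet> normal_dir) *\<^sub>R (t ^ Suc m *\<^sub>R ?D (to_boundary t x) normal_dir))"
          by (intro integral_add integrable_continuous continuous_intros cont1 cD x)
        finally show "integral (cbox 0 1) (\<lambda>t. t ^ m *\<^sub>R ?D (to_boundary t x) (to_boundary 0 v))
         + (v \<bullet> normal_dir) *\<^sub>R integral (cbox 0 1) (\<lambda>t. t ^ Suc m *\<^sub>R ?D (to_boundary t x) normal_dir)
          = blinfun_apply (integral (cbox 0 1) (fx x)) v" unfolding integral_cmul by (rule sym)
      qed
    qed
  }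
qed

text \<open>The fundamental theorem of calculus on the segment from the projection of \<open>x\<close> to \<open>x\<close>.\<close>

lemma hadamard_ball:
  fixes F :: "'a::euclidean_space \<Rightarrow> 'b::banach"
  assumes x0: "x0 \<bullet> normal_dir = 0" and F: "\<And>k. Ck_on k (ball x0 r) F" and x: "x \<in> ball x0 r"
  shows "F x = F (to_boundary 0 x) + (x \<bullet> normal_dir) *\<^sub>R
    integral (cbox 0 1) (\<lambda>t. t ^ 0 *\<^sub>R frechet_derivative F (at (to_boundary t x)) normal_dir)"
proof -
  let ?D = "\<lambda>t. frechet_derivative F (at (to_boundary t x))"
  have vd: "((\<lambda>t. F (to_boundary t x)) has_vector_derivative (x \<bullet> normal_dir) *\<^sub>R ?D t normal_dir) (at t within {0..1})"
    if t: "t \<in> {0..1}" for t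
  proof -
    have DF: "(F has_derivative ?D t) (at (to_boundary t x))"
      using Ck_on_D[OF F] to_boundary_ball[OF x0 x] t by auto
    have "((\<lambda>t. to_boundary t x) has_derivative (\<lambda>r. (r * (x \<bullet> normal_dir)) *\<^sub>R normal_dir)) (at t within {0..1})"
      unfolding to_boundary_def by (auto intro!: derivative_eq_intros simp: algebra_simps)
    from has_derivative_compose[OF this DF]
    show ?thesis using has_derivative_linear[OF DF]
      by (simp add: has_vector_derivative_def linear_scale)
  qed
  have "((\<lambda>t. (x \<bullet> normal_dir) *\<^sub>R ?D t normal_dir) has_integral F (to_boundary 1 x) - F (to_boundary 0 x)) {0..1}"
    by (rule fundamental_theorem_of_calculus) (use vd in auto)
  then have "integral {0..1} (\<lambda>t. (x \<bullet> normal_dir) *\<^sub>R ?D t normal_dir) = F (to_boundary 1 x) - F (to_boundary 0 x)"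
    by (rule integral_unique)
  then show ?thesis by (simp add: to_boundary_def algebra_simps)
qed

text \<open>The quotient of a function by the normal coordinate. For a function vanishing on the boundary
  hyperplane, the normal derivative is the limit of the quotient at boundary points.\<close>

definition normal_quotient :: "('a::euclidean_space \<Rightarrow> 'b::real_normed_vector) \<Rightarrow> 'a \<Rightarrow> 'b" where
  "normal_quotient f x = (if x \<bullet> normal_dir = 0 then Dh f x normal_dir else inverse (x \<bullet> normal_dir) *\<^sub>R f x)"

lemma normal_quotient_eq:
  assumes "x \<bullet> normal_dir = 0 \<Longrightarrow> f x = 0"
  shows "f x = (x \<bullet> normal_dir) *\<^sub>R normal_quotient f x"
  using assms by (auto simp: normal_quotient_def)

text \<open>Hadamard's lemma: near the boundary the quotient is the integral of the normal derivative over
  the segment to the boundary, which is smooth across it.\<close>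

lemma smooth_on_normal_quotient:
  fixes f :: "'a::euclidean_space \<Rightarrow> 'b::banach"
  assumes S: "hopen S" and f: "smooth_on S f" and zero: "\<And>x. x \<in> S \<Longrightarrow> x \<bullet> normal_dir = 0 \<Longrightarrow> f x = 0"
  shows "smooth_on S (normal_quotient f)"
proof (rule smooth_on_local)
  fix x0 assume x0: "x0 \<in> S"
  show "\<exists>V. open V \<and> x0 \<in> V \<and> smooth_on (V \<inter> S) (normal_quotient f)"
  proof (cases "x0 \<bullet> normal_dir = 0")
    case False
    let ?V = "{x::'a. x \<bullet> normal_dir \<noteq> 0}"
    have o: "open ?V" by (intro open_Collect_neq continuous_intros)
    have "smooth_on (?V \<inter> S) (\<lambda>x. inverse (x \<bullet> normal_dir) *\<^sub>R f x)"
      by (intro smooth_on_scaleR smooth_on_inverse smooth_on_bounded_linear[OF bounded_linear_inner_left] smooth_on_ident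
         smooth_on_subset[OF f]) auto
    then have "smooth_on (?V \<inter> S) (normal_quotient f)"
      by (rule smooth_on_cong) (auto simp: normal_quotient_def)
    then show ?thesis using o False by blast
  next
    case True
    obtain W F where W: "open W" "x0 \<in> W" "\<And>k. Ck_on k W F" "\<And>y. y \<in> W \<Longrightarrow> y \<in> S \<Longrightarrow> F y = f y"
      using smooth_onE[OF f x0] by metis
    obtain T where T: "open T" "S = half_space \<inter> T" using S unfolding openin_open by blast
    have "open (W \<inter> T)" "x0 \<in> W \<inter> T" using W T x0 by auto
    then obtain r where r: "r > 0" "ball x0 r \<subseteq> W \<inter> T" by (meson openE)
    let ?B = "ball x0 r"
    have F: "Ck_on k ?B F" for k using Ck_on_subset[OF W(3)] r by blast
    define G where "G x = integral (cbox 0 1) (\<lambda>t. t ^ 0 *\<^sub>R frechet_derivative F (at (to_boundary t x)) normal_dir)" for x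
    have G: "Ck_on k ?B G" for k
      unfolding G_def by (rule Ck_on_weighted_ray_integral[OF True]) (use F[of "Suc _"] in auto)
    have bS: "to_boundary 0 x \<in> ?B \<inter> S" "to_boundary 0 x \<bullet> normal_dir = 0" if "x \<in> ?B" for x
      using to_boundary_ball[OF True that, of 0] r T
      by (auto simp: half_space_def to_boundary_def inner_simps)
    have Fz: "F x = (x \<bullet> normal_dir) *\<^sub>R G x" if x: "x \<in> ?B" for x
    proof -
      have "F (to_boundary 0 x) = 0" using bS[OF x] W(4)[of "to_boundary 0 x"] zero r by auto
      then show ?thesis using hadamard_ball[OF True F x] by (simp add: G_def)
    qed
    have "G x = normal_quotient f x" if x: "x \<in> ?B \<inter> S" for x
    proof (cases "x \<bullet> normal_dir = 0")
      case xz: True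
      have "((\<lambda>x. (x \<bullet> normal_dir) *\<^sub>R G x) has_derivative
          (\<lambda>h. (x \<bullet> normal_dir) *\<^sub>R frechet_derivative G (at x) h + (h \<bullet> normal_dir) *\<^sub>R G x)) (at x)"
        by (intro has_derivative_scaleR has_derivative_inner_left has_derivative_ident Ck_on_D[OF G]) (use x in auto)
      then have "((\<lambda>x. (x \<bullet> normal_dir) *\<^sub>R G x) has_derivative (\<lambda>h. (h \<bullet> normal_dir) *\<^sub>R G x)) (at x within half_space)"
        using xz has_derivative_at_withinI by fastforce
      then have "(f has_derivative (\<lambda>h. (h \<bullet> normal_dir) *\<^sub>R G x)) (at x within half_space)"
        by (rule has_derivative_cong_hopen[OF hopen_Int_open[OF S open_ball] x, rotated])
          (use Fz W(4) r in force)
      then have "Dh f x normal_dir = G x" using Dh_eq hopen_half[OF S, of x] x by fastforce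
      then show ?thesis using xz by (simp add: normal_quotient_def)
    next
      case xz: False
      have "f x = (x \<bullet> normal_dir) *\<^sub>R G x" using Fz W(4)[of x] x r by auto
      then show ?thesis using xz by (simp add: normal_quotient_def)
    qed
    moreover have "smooth_on (?B \<inter> S) G" by (rule smooth_on_Ck[OF open_ball G]) auto
    ultimately have "smooth_on (?B \<inter> S) (normal_quotient f)" using smooth_on_cong by blast
    then show ?thesis using r(1) by (intro exI[of _ ?B]) auto
  qed
qed

section \<open>Charts\<close>

locale boundary_atlas =
  fixes A :: "('m::{t2_space, second_countable_topology}, 'a::euclidean_space) chart set"
  assumes atlas: "smooth_atlas A"
begin

lemma chart_open: "c \<in> A \<Longrightarrow> open (cdom c)"
  using atlas unfolding smooth_atlas_def by blast

lemma chart_homeo: "c \<in> A \<Longrightarrow> homeomorphism (cdom c) (cmap c ` cdom c) (cmap c) (cinv c)"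
  using atlas unfolding smooth_atlas_def by blast

lemma chart_image_hopen: "c \<in> A \<Longrightarrow> hopen (cmap c ` cdom c)"
  using atlas unfolding smooth_atlas_def by blast

lemma image_hopen: "c \<in> A \<Longrightarrow> open U \<Longrightarrow> hopen (cmap c ` (U \<inter> cdom c))"
  using homeomorphism_imp_open_map[OF chart_homeo, of c "U \<inter> cdom c"] chart_image_hopen
  by (metis Int_commute openin_open_Int openin_trans)

lemma cinv_cmap [simp]: "c \<in> A \<Longrightarrow> p \<in> cdom c \<Longrightarrow> cinv c (cmap c p) = p"
  using chart_homeo homeomorphism_apply1 by metis

lemma chart_at_mem: "chart_at A p \<in> A" "p \<in> cdom (chart_at A p)"
proof -
  have "p \<in> (\<Union>c\<in>A. cdom c)" using atlas unfolding smooth_atlas_def by blast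
  then have "\<exists>c. c \<in> A \<and> p \<in> cdom c" by blast
  from someI_ex[OF this] show "chart_at A p \<in> A" "p \<in> cdom (chart_at A p)"
    unfolding chart_at_def by blast+
qed

lemma transition_smooth:
  assumes "c \<in> A" "d \<in> A"
  shows "smooth_on (cmap c ` (cdom d \<inter> cdom c)) (\<lambda>x. cmap d (cinv c x))"
  using assms atlas unfolding smooth_atlas_def o_def by (metis Int_commute)

lemma cmap_half: "c \<in> A \<Longrightarrow> p \<in> cdom c \<Longrightarrow> cmap c p \<in> half_space"
  using hopen_half[OF chart_image_hopen] by blast

lemma jacobian_eq:
  assumes "c \<in> A" "d \<in> A" "p \<in> cdom c" "p \<in> cdom d"
  shows "jacobian c d p = Dh (\<lambda>x. cmap d (cinv c x)) (cmap c p)"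
proof -
  have "at (cmap c p) within cmap c ` (cdom c \<inter> cdom d) = at (cmap c p) within half_space"
    using at_within_hopen[OF image_hopen[OF assms(1) chart_open[OF assms(2)]]] assms
    by (simp add: Int_commute)
  then show ?thesis unfolding jacobian_def o_def by simp
qed

lemma jacobian_has_derivative:
  assumes "c \<in> A" "d \<in> A" "p \<in> cdom c" "p \<in> cdom d"
  shows "((\<lambda>x. cmap d (cinv c x)) has_derivative jacobian c d p) (at (cmap c p) within half_space)"
  using smooth_on_D[OF image_hopen[OF assms(1) chart_open[OF assms(2)]] transition_smooth[OF assms(1,2)], of "cmap c p"]
    assms by (simp add: jacobian_eq)

lemma jacobian_linear:
  assumes "c \<in> A" "d \<in> A" "p \<in> cdom c" "p \<in> cdom d"
  shows "linear (jacobian c d p)"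
  using jacobian_has_derivative[OF assms] has_derivative_linear by blast

lemma jacobian_unique:
  assumes "c \<in> A" "p \<in> cdom c" "(f has_derivative f') (at (cmap c p) within half_space)"
    "(f has_derivative f'') (at (cmap c p) within half_space)"
  shows "f' = f''"
  using half_space_derivative_unique[OF assms(3,4)] cmap_half[OF assms(1,2)] by blast

lemma jacobian_id [simp]:
  assumes "c \<in> A" "p \<in> cdom c" shows "jacobian c c p v = v"
proof -
  have "((\<lambda>x. cmap c (cinv c x)) has_derivative (\<lambda>v. v)) (at (cmap c p) within half_space)"
    by (rule has_derivative_cong_hopen[OF chart_image_hopen[OF assms(1)] _ _ has_derivative_ident])
      (use assms in auto)
  from jacobian_unique[OF assms jacobian_has_derivative this] assms show ?thesis by metis
qed

text \<open>The chain rule for the changes of charts from \<open>c\<close> through \<open>d\<close> to \<open>e\<close>.\<close>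

lemma jacobian_cocycle:
  assumes "c \<in> A" "d \<in> A" "e \<in> A" "p \<in> cdom c" "p \<in> cdom d" "p \<in> cdom e"
  shows "jacobian d e p (jacobian c d p v) = jacobian c e p v"
proof -
  let ?S = "cmap c ` ((cdom d \<inter> cdom e) \<inter> cdom c)"
  have S: "hopen ?S" "cmap c p \<in> ?S"
    using assms chart_open[OF assms(2)] chart_open[OF assms(3)] by (auto intro!: image_hopen)
  have "((\<lambda>x. cmap e (cinv d (cmap d (cinv c x)))) has_derivative (\<lambda>v. jacobian d e p (jacobian c d p v)))
     (at (cmap c p) within half_space)"
    by (rule has_derivative_chain_hopen[OF S, of "\<lambda>x. cmap d (cinv c x)" "jacobian c d p" "\<lambda>x. cmap e (cinv d x)" "jacobian d e p"])
      (use assms jacobian_has_derivative[of c d p] jacobian_has_derivative[of d e p] cmap_half[OF assms(2)] in auto)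
  then have "((\<lambda>x. cmap e (cinv c x)) has_derivative (\<lambda>v. jacobian d e p (jacobian c d p v)))
     (at (cmap c p) within half_space)"
    by (rule has_derivative_cong_hopen[OF S, rotated]) (use assms in auto)
  from jacobian_unique[OF assms(1,4) this jacobian_has_derivative] assms show ?thesis by metis
qed

lemma jacobian_inverse [simp]:
  assumes "c \<in> A" "d \<in> A" "p \<in> cdom c" "p \<in> cdom d"
  shows "jacobian d c p (jacobian c d p v) = v"
  using jacobian_cocycle[of c d c p v] assms by simp

lemma jacobian_smooth:
  assumes "c \<in> A" "d \<in> A"
  shows "smooth_on (cmap c ` (cdom d \<inter> cdom c)) (\<lambda>x. jacobian c d (cinv c x) v)"
  by (rule smooth_on_cong[OF smooth_on_Dh[OF image_hopen[OF assms(1) chart_open[OF assms(2)]] transition_smooth[OF assms], of v]])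
    (use assms in \<open>auto simp: jacobian_eq\<close>)

lemma components_linear: "c \<in> A \<Longrightarrow> p \<in> cdom c \<Longrightarrow> linear (components A c p)"
  unfolding components_def using jacobian_linear chart_at_mem by blast

lemma coord_field_linear: "c \<in> A \<Longrightarrow> p \<in> cdom c \<Longrightarrow> linear (\<lambda>v. coord_field A c v p)"
  unfolding coord_field_def using jacobian_linear chart_at_mem by blast

lemma components_coord_field [simp]: "c \<in> A \<Longrightarrow> p \<in> cdom c \<Longrightarrow> components A c p (coord_field A c v p) = v"
  unfolding coord_field_def components_def using chart_at_mem by simp

lemma coord_field_components [simp]: "c \<in> A \<Longrightarrow> p \<in> cdom c \<Longrightarrow> coord_field A c (components A c p v) p = v"
  unfolding coord_field_def components_def using chart_at_mem by simp

lemma components_change: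
  "c \<in> A \<Longrightarrow> d \<in> A \<Longrightarrow> p \<in> cdom c \<Longrightarrow> p \<in> cdom d \<Longrightarrow> components A d p v = jacobian c d p (components A c p v)"
  unfolding components_def using chart_at_mem jacobian_cocycle by simp

lemma components_chart_at [simp]: "components A (chart_at A p) p v = v"
  unfolding components_def using chart_at_mem by simp

lemma smooth_fun_subset: "smooth_fun A U f \<Longrightarrow> V \<subseteq> U \<Longrightarrow> smooth_fun A V f"
  unfolding smooth_fun_def by (blast intro: smooth_on_subset)

lemma vector_field_subset: "vector_field A U f \<Longrightarrow> V \<subseteq> U \<Longrightarrow> vector_field A V f"
  unfolding vector_field_def by (blast intro: smooth_on_subset)

lemma smooth_fun_in_chart:
  "smooth_fun A U f \<Longrightarrow> c \<in> A \<Longrightarrow> smooth_on (cmap c ` (U \<inter> cdom c)) (\<lambda>x. f (cinv c x))"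
  unfolding smooth_fun_def o_def by blast

lemma vector_field_in_chart:
  "vector_field A U \<xi> \<Longrightarrow> c \<in> A \<Longrightarrow> smooth_on (cmap c ` (U \<inter> cdom c)) (local_rep A c \<xi>)"
  unfolding vector_field_def by blast

lemma transition_mem:
  "c \<in> A \<Longrightarrow> d \<in> A \<Longrightarrow> U \<subseteq> cdom c \<Longrightarrow> y \<in> cmap d ` (U \<inter> cdom d) \<Longrightarrow> cmap c (cinv d y) \<in> cmap c ` (U \<inter> cdom c)"
  by auto

lemma transition_smooth_subset:
  assumes "c \<in> A" "d \<in> A" "U \<subseteq> cdom c"
  shows "smooth_on (cmap d ` (U \<inter> cdom d)) (\<lambda>y. cmap c (cinv d y))"
  by (rule smooth_on_subset[OF transition_smooth[OF assms(2,1)]]) (use assms in auto)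

lemma smooth_funI_chart:
  assumes c: "c \<in> A" "U \<subseteq> cdom c" and f: "smooth_on (cmap c ` (U \<inter> cdom c)) (\<lambda>x. f (cinv c x))"
  shows "smooth_fun A U f"
  unfolding smooth_fun_def o_def
proof
  fix d assume d: "d \<in> A"
  show "smooth_on (cmap d ` (U \<inter> cdom d)) (\<lambda>x. f (cinv d x))"
    by (rule smooth_on_cong[OF smooth_on_compose[OF f transition_smooth_subset[OF c(1) d c(2)] transition_mem[OF c(1) d c(2)]]])
      (use c d in auto)
qed

text \<open>Smoothness in one chart is enough, because the components in any other chart arise from
  the Jacobian, whose entries are smooth.\<close>

lemma vector_fieldI_chart:
  assumes c: "c \<in> A" "U \<subseteq> cdom c" and f: "smooth_on (cmap c ` (U \<inter> cdom c)) (local_rep A c \<xi>)"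
  shows "vector_field A U \<xi>"
  unfolding vector_field_def
proof
  fix d assume d: "d \<in> A"
  have J: "smooth_on (cmap c ` (cdom d \<inter> cdom c)) (\<lambda>x. jacobian c d (cinv c x) b)" for b
    using jacobian_smooth[OF c(1) d] .
  have "smooth_on (cmap d ` (U \<inter> cdom d)) (\<lambda>y. \<Sum>b\<in>Basis. (local_rep A c \<xi> (cmap c (cinv d y)) \<bullet> b) *\<^sub>R
      jacobian c d (cinv c (cmap c (cinv d y))) b)"
    by (intro smooth_on_sum smooth_on_scaleR smooth_on_bounded_linear[OF bounded_linear_inner_left]
      smooth_on_compose[OF f transition_smooth_subset[OF c(1) d c(2)] transition_mem[OF c(1) d c(2)]]
      smooth_on_compose[OF J transition_smooth_subset[OF c(1) d c(2)]]) (use c d in auto)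
  then show "smooth_on (cmap d ` (U \<inter> cdom d)) (local_rep A d \<xi>)"
  proof (rule smooth_on_cong)
    fix y assume "y \<in> cmap d ` (U \<inter> cdom d)"
    then obtain p where p: "p \<in> U" "p \<in> cdom d" "y = cmap d p" "p \<in> cdom c" using c by auto
    have "local_rep A d \<xi> y = jacobian c d p (components A c p (\<xi> p))"
      using p c d components_change[of c d p] by (simp add: local_rep_def)
    also have "\<dots> = (\<Sum>b\<in>Basis. (components A c p (\<xi> p) \<bullet> b) *\<^sub>R jacobian c d p b)"
      by (rule linear_Basis_expansion[OF jacobian_linear]) (use p c d in auto)
    finally show "(\<Sum>b\<in>Basis. (local_rep A c \<xi> (cmap c (cinv d y)) \<bullet> b) *\<^sub>R
      jacobian c d (cinv c (cmap c (cinv d y))) b) = local_rep A d \<xi> y"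
      using p c d by (simp add: local_rep_def)
  qed
qed

lemma local_rep_coord_field [simp]:
  "c \<in> A \<Longrightarrow> p \<in> cdom c \<Longrightarrow> local_rep A c (coord_field A c v) (cmap c p) = v"
  by (simp add: local_rep_def)

lemma coord_field_vector_field: "c \<in> A \<Longrightarrow> U \<subseteq> cdom c \<Longrightarrow> vector_field A U (coord_field A c v)"
  by (rule vector_fieldI_chart, assumption+, rule smooth_on_cong[OF smooth_on_const[of _ v]]) auto

lemma differential_in_chart:
  assumes c: "c \<in> A" "p \<in> cdom c" and U: "open U" "p \<in> U" and f: "smooth_fun A U f"
  shows "differential A f p v = Dh (\<lambda>x. f (cinv c x)) (cmap c p) (components A c p v)"
proof -
  let ?d = "chart_at A p"
  have d: "?d \<in> A" "p \<in> cdom ?d" using chart_at_mem by auto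
  have df: "((\<lambda>x. f (cinv e x)) has_derivative Dh (\<lambda>x. f (cinv e x)) (cmap e p)) (at (cmap e p) within half_space)"
    if "e \<in> A" "p \<in> cdom e" for e
    using smooth_on_D[OF image_hopen[OF that(1) U(1)] smooth_fun_in_chart[OF f that(1)]] that U by auto
  let ?S = "cmap ?d ` ((U \<inter> cdom c) \<inter> cdom ?d)"
  have S: "hopen ?S" "cmap ?d p \<in> ?S"
    using c d U chart_open[OF c(1)] by (auto intro!: image_hopen)
  have "((\<lambda>x. f (cinv c (cmap c (cinv ?d x)))) has_derivative (\<lambda>v. Dh (\<lambda>x. f (cinv c x)) (cmap c p) (jacobian ?d c p v)))
     (at (cmap ?d p) within half_space)"
    by (rule has_derivative_chain_hopen[OF S, of "\<lambda>x. cmap c (cinv ?d x)" "jacobian ?d c p" "\<lambda>x. f (cinv c x)" "Dh (\<lambda>x. f (cinv c x)) (cmap c p)"])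
      (use c d jacobian_has_derivative[of ?d c p] cmap_half[OF c(1)] df[OF c] in auto)
  then have "((\<lambda>x. f (cinv ?d x)) has_derivative (\<lambda>v. Dh (\<lambda>x. f (cinv c x)) (cmap c p) (jacobian ?d c p v)))
     (at (cmap ?d p) within half_space)"
    by (rule has_derivative_cong_hopen[OF S, rotated]) (use c d in auto)
  from jacobian_unique[OF d this df[OF d]]
  have "Dh (\<lambda>x. f (cinv ?d x)) (cmap ?d p) v = Dh (\<lambda>x. f (cinv c x)) (cmap c p) (components A c p v)"
    unfolding components_def by metis
  moreover have "at (cmap ?d p) within cmap ?d ` cdom ?d = at (cmap ?d p) within half_space"
    using at_within_hopen[OF chart_image_hopen[OF d(1)]] d by simp
  ultimately show ?thesis unfolding differential_def Let_def o_def by simp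
qed

text \<open>If \<open>d\<close> maps \<open>p\<close> to the boundary hyperplane, then the normal coordinate of \<open>d\<close>, expressed in
  the chart \<open>c\<close>, has a minimum at an interior point. So the Jacobian has its range in the boundary
  hyperplane and is not invertible, a contradiction.\<close>

lemma boundary_chart_invariant:
  assumes c: "c \<in> A" "p \<in> cdom c" and d: "d \<in> A" "p \<in> cdom d" and pos: "cmap c p \<bullet> normal_dir > 0"
  shows "cmap d p \<bullet> normal_dir > 0"
proof (rule ccontr)
  assume "\<not> ?thesis"
  moreover have "cmap d p \<bullet> normal_dir \<ge> 0" using cmap_half[OF d] by (simp add: half_space_def)
  ultimately have z: "cmap d p \<bullet> normal_dir = 0" by simp
  let ?x = "cmap c p" and ?S = "cmap c ` (cdom d \<inter> cdom c)"
  have S: "hopen ?S" "?x \<in> ?S" using c d chart_open[OF d(1)] by (auto intro!: image_hopen)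
  obtain W where W: "open W" "?x \<in> W" "W \<subseteq> ?S"
    using smooth_on_interior_Ck[OF S(1) transition_smooth[OF c(1) d(1)] S(2) pos] by metis
  have "((\<lambda>x. cmap d (cinv c x) \<bullet> normal_dir) has_derivative (\<lambda>v. jacobian c d p v \<bullet> normal_dir)) (at ?x)"
    using has_derivative_inner_left[OF jacobian_has_derivative[OF c(1) d(1) c(2) d(2)]]
    by (simp add: at_within_interior_half[OF pos])
  from differential_zero_maxmin[OF W(2,1) this]
  have "(\<lambda>v. jacobian c d p v \<bullet> normal_dir) = (\<lambda>v. 0)"
    using W(3) z c d cmap_half[OF d(1)] by (fastforce simp: half_space_def)
  then have "jacobian c d p (jacobian d c p normal_dir) \<bullet> normal_dir = 0" by metis
  then show False using c d by simp
qed

lemma boundary_iff: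
  assumes c: "c \<in> A" "p \<in> cdom c"
  shows "p \<in> mfd_boundary A \<longleftrightarrow> cmap c p \<bullet> normal_dir = 0"
proof
  assume "p \<in> mfd_boundary A"
  then obtain d where d: "d \<in> A" "p \<in> cdom d" "cmap d p \<bullet> normal_dir = 0" unfolding mfd_boundary_def by blast
  have "cmap c p \<bullet> normal_dir \<ge> 0" using cmap_half[OF c] by (simp add: half_space_def)
  then show "cmap c p \<bullet> normal_dir = 0"
    using boundary_chart_invariant[OF c d(1,2)] d(3) by force
qed (use c in \<open>auto simp: mfd_boundary_def\<close>)

lemma interior_iff:
  assumes c: "c \<in> A" "p \<in> cdom c"
  shows "p \<in> mfd_interior A \<longleftrightarrow> cmap c p \<bullet> normal_dir > 0"
  using boundary_iff[OF c] cmap_half[OF c] by (auto simp: mfd_interior_def half_space_def)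

lemma mfd_interior_open: "open (mfd_interior A)"
proof (subst open_subopen, intro ballI)
  fix p assume p: "p \<in> mfd_interior A"
  let ?c = "chart_at A p"
  have c: "?c \<in> A" "p \<in> cdom ?c" using chart_at_mem by auto
  have "continuous_on (cdom ?c) (\<lambda>q. cmap ?c q \<bullet> normal_dir)"
    using chart_homeo[OF c(1)] by (auto simp: homeomorphism_def intro!: continuous_intros)
  then have "open (cdom ?c \<inter> (\<lambda>q. cmap ?c q \<bullet> normal_dir) -` {0<..})"
    using chart_open[OF c(1)] by (intro continuous_open_preimage) auto
  then show "\<exists>T. open T \<and> p \<in> T \<and> T \<subseteq> mfd_interior A"
    using p c by (intro exI[of _ "cdom ?c \<inter> (\<lambda>q. cmap ?c q \<bullet> normal_dir) -` {0<..}"])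
      (auto simp: interior_iff[OF c(1)])
qed

end

context boundary_atlas begin

section \<open>Lie brackets and the module of vector fields\<close>

text \<open>The second derivative of the change of charts to the preferred chart enters both terms of the
  bracket, and by symmetry the two contributions cancel.\<close>

lemma lie_bracket_in_chart:
  assumes c: "c \<in> A" "p \<in> cdom c" and U: "open U" "p \<in> U" "U \<subseteq> mfd_interior A"
    and vf: "vector_field A U \<xi>" "vector_field A U \<eta>"
  shows "components A c p (lie_bracket A \<xi> \<eta> p) =
    Dh (local_rep A c \<eta>) (cmap c p) (local_rep A c \<xi> (cmap c p)) -
    Dh (local_rep A c \<xi>) (cmap c p) (local_rep A c \<eta> (cmap c p))"
proof -
  let ?d = "chart_at A p"
  have d: "?d \<in> A" "p \<in> cdom ?d" using chart_at_mem by auto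
  let ?x = "cmap c p" and ?y = "cmap ?d p" and ?\<phi> = "\<lambda>x. cmap ?d (cinv c x)"
  let ?S = "cmap c ` ((U \<inter> cdom ?d) \<inter> cdom c)"
  have S: "hopen ?S" "?x \<in> ?S" using c d U chart_open[OF d(1)] by (auto intro!: image_hopen)
  have pos: "?x \<bullet> normal_dir > 0" using interior_iff[OF c] U by blast
  have smphi: "smooth_on ?S ?\<phi>"
    by (rule smooth_on_subset[OF transition_smooth[OF c(1) d(1)]]) auto
  have J: "jacobian c ?d p = Dh ?\<phi> ?x" using jacobian_eq c d by blast
  have der: "(local_rep A e \<zeta> has_derivative Dh (local_rep A e \<zeta>) (cmap e p)) (at (cmap e p) within half_space)"
    if "e \<in> A" "p \<in> cdom e" "vector_field A U \<zeta>" for e \<zeta>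
    using smooth_on_D[OF image_hopen[OF that(1) U(1)] vector_field_in_chart[OF that(3,1)]] that U by blast
  have trans: "local_rep A ?d \<zeta> (?\<phi> z) = Dh ?\<phi> z (local_rep A c \<zeta> z)" if "z \<in> ?S" for z \<zeta>
    using that c d components_change[of c ?d] by (auto simp: local_rep_def jacobian_eq)
  have push: "Dh (local_rep A ?d \<zeta>) ?y (Dh ?\<phi> ?x v) =
      Dh ?\<phi> ?x (Dh (local_rep A c \<zeta>) ?x v) + Dh (\<lambda>z. Dh ?\<phi> z (local_rep A c \<zeta> ?x)) ?x v"
    if \<zeta>: "vector_field A U \<zeta>" for \<zeta> v
  proof -
    have h1: "((\<lambda>z. local_rep A ?d \<zeta> (?\<phi> z)) has_derivative (\<lambda>v. Dh (local_rep A ?d \<zeta>) ?y (Dh ?\<phi> ?x v))) (at ?x within half_space)"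
      by (rule has_derivative_chain_hopen[OF S, of ?\<phi> "Dh ?\<phi> ?x" "local_rep A ?d \<zeta>" "Dh (local_rep A ?d \<zeta>) ?y"])
        (use c d der[OF d \<zeta>] cmap_half[OF d(1)] smooth_on_D[OF S(1) smphi S(2)] in auto)
    have "((\<lambda>z. Dh ?\<phi> z (local_rep A c \<zeta> z)) has_derivative
       (\<lambda>v. Dh ?\<phi> ?x (Dh (local_rep A c \<zeta>) ?x v) + Dh (\<lambda>z. Dh ?\<phi> z (local_rep A c \<zeta> ?x)) ?x v)) (at ?x within half_space)"
      by (rule has_derivative_linear_family[OF S _ _ der[OF c \<zeta>]])
        (erule smooth_on_Dh_linear[OF S(1) smphi], rule smooth_on_D[OF S(1) smooth_on_Dh[OF S(1) smphi] S(2)])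
    then have h2: "((\<lambda>z. local_rep A ?d \<zeta> (?\<phi> z)) has_derivative
       (\<lambda>v. Dh ?\<phi> ?x (Dh (local_rep A c \<zeta>) ?x v) + Dh (\<lambda>z. Dh ?\<phi> z (local_rep A c \<zeta> ?x)) ?x v)) (at ?x within half_space)"
      by (rule has_derivative_cong_hopen[OF S, rotated]) (rule trans[symmetric])
    from fun_cong[OF jacobian_unique[OF c h1 h2], of v] show ?thesis .
  qed
  have at: "local_rep A ?d \<zeta> ?y = Dh ?\<phi> ?x (local_rep A c \<zeta> ?x)" for \<zeta> using trans[OF S(2)] c by simp
  have own: "local_rep A ?d \<zeta> ?y = \<zeta> p" for \<zeta> using d by (simp add: local_rep_def)
  have w: "at ?y within cmap ?d ` cdom ?d = at ?y within half_space"
    by (rule at_within_hopen[OF chart_image_hopen[OF d(1)]]) (use d in simp)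
  have "lie_bracket A \<xi> \<eta> p = Dh (local_rep A ?d \<eta>) ?y (local_rep A ?d \<xi> ?y) - Dh (local_rep A ?d \<xi>) ?y (local_rep A ?d \<eta> ?y)"
    unfolding lie_bracket_def Let_def w own ..
  also have "\<dots> = Dh ?\<phi> ?x (Dh (local_rep A c \<eta>) ?x (local_rep A c \<xi> ?x)) - Dh ?\<phi> ?x (Dh (local_rep A c \<xi>) ?x (local_rep A c \<eta> ?x))"
    unfolding at push[OF vf(1)] push[OF vf(2)]
    using Dh_Dh_symmetric[OF S(1) smphi S(2) pos, of "local_rep A c \<xi> ?x" "local_rep A c \<eta> ?x"] by simp
  also have "\<dots> = jacobian c ?d p (Dh (local_rep A c \<eta>) ?x (local_rep A c \<xi> ?x) - Dh (local_rep A c \<xi>) ?x (local_rep A c \<eta> ?x))"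
    unfolding J[symmetric] using linear_diff[OF jacobian_linear[OF c(1) d(1) c(2) d(2)]] by simp
  finally show ?thesis unfolding components_def using c d by simp
qed

lemma local_rep_coord_field_Dh:
  assumes "c \<in> A" "p \<in> cdom c"
  shows "Dh (local_rep A c (coord_field A c v)) (cmap c p) w = 0"
proof -
  have "Dh (local_rep A c (coord_field A c v)) (cmap c p) = Dh (\<lambda>x. v) (cmap c p)"
    by (rule Dh_cong[OF chart_image_hopen[OF assms(1)]]) (use assms in auto)
  also have "\<dots> = (\<lambda>_. 0)" by (rule Dh_eq[OF has_derivative_const cmap_half[OF assms]])
  finally show ?thesis by simp
qed

lemma smooth_fun_const: "smooth_fun A U (\<lambda>_. r)"
  unfolding smooth_fun_def o_def by (simp add: smooth_on_const)

lemma local_rep_add: "x \<in> cmap c ` cdom c \<Longrightarrow> c \<in> A \<Longrightarrow>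
    local_rep A c (\<lambda>q. \<xi> q + \<eta> q) x = local_rep A c \<xi> x + local_rep A c \<eta> x"
  by (auto simp: local_rep_def linear_add[OF components_linear])

lemma local_rep_scale: "x \<in> cmap c ` cdom c \<Longrightarrow> c \<in> A \<Longrightarrow>
    local_rep A c (\<lambda>q. f q *\<^sub>R \<xi> q) x = f (cinv c x) *\<^sub>R local_rep A c \<xi> x"
  by (auto simp: local_rep_def linear_scale[OF components_linear])

lemma vector_field_cong:
  assumes "vector_field A U \<xi>" "\<And>q. q \<in> U \<Longrightarrow> \<xi> q = \<eta> q"
  shows "vector_field A U \<eta>"
  unfolding vector_field_def
proof
  fix c assume c: "c \<in> A"
  show "smooth_on (cmap c ` (U \<inter> cdom c)) (local_rep A c \<eta>)"
    by (rule smooth_on_cong[OF vector_field_in_chart[OF assms(1) c]]) (use assms(2) c in \<open>auto simp: local_rep_def\<close>)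
qed

lemma vector_field_zero: "vector_field A U (\<lambda>_. 0)"
  unfolding vector_field_def
proof
  fix c assume c: "c \<in> A"
  show "smooth_on (cmap c ` (U \<inter> cdom c)) (local_rep A c (\<lambda>_. 0))"
    by (rule smooth_on_cong[OF smooth_on_const[of _ 0]])
      (use c in \<open>auto simp: local_rep_def linear_0[OF components_linear]\<close>)
qed

lemma vector_field_scale:
  assumes "smooth_fun A U f" "vector_field A U \<xi>"
  shows "vector_field A U (\<lambda>q. f q *\<^sub>R \<xi> q)"
  unfolding vector_field_def
proof
  fix c assume c: "c \<in> A"
  show "smooth_on (cmap c ` (U \<inter> cdom c)) (local_rep A c (\<lambda>q. f q *\<^sub>R \<xi> q))"
    by (rule smooth_on_cong[OF smooth_on_scaleR[OF smooth_fun_in_chart[OF assms(1) c] vector_field_in_chart[OF assms(2) c]]])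
      (use c in \<open>auto simp: local_rep_scale\<close>)
qed

lemma vector_field_add:
  assumes "vector_field A U \<xi>" "vector_field A U \<eta>"
  shows "vector_field A U (\<lambda>q. \<xi> q + \<eta> q)"
  unfolding vector_field_def
proof
  fix c assume c: "c \<in> A"
  show "smooth_on (cmap c ` (U \<inter> cdom c)) (local_rep A c (\<lambda>q. \<xi> q + \<eta> q))"
    by (rule smooth_on_cong[OF smooth_on_add[OF vector_field_in_chart[OF assms(1) c] vector_field_in_chart[OF assms(2) c]]])
      (use c in \<open>auto simp: local_rep_add[symmetric]\<close>)
qed

lemma vector_field_sum:
  assumes "\<And>i. i \<in> I \<Longrightarrow> vector_field A U (X i)"
  shows "vector_field A U (\<lambda>q. \<Sum>i\<in>I. X i q)"
  using assms
  by (induction I rule: infinite_finite_induct) (auto intro: vector_field_zero vector_field_add)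

lemma vector_field_diff:
  assumes "vector_field A U \<xi>" "vector_field A U \<eta>"
  shows "vector_field A U (\<lambda>q. \<xi> q - \<eta> q)"
  using vector_field_add[OF assms(1) vector_field_scale[OF smooth_fun_const[of U "-1"] assms(2)]] by simp

lemma field_expansion:
  assumes "c \<in> A" "q \<in> cdom c"
  shows "\<xi> q = (\<Sum>b\<in>Basis. (local_rep A c \<xi> (cmap c q) \<bullet> b) *\<^sub>R coord_field A c b q)"
  using linear_Basis_expansion[OF coord_field_linear[OF assms], of "components A c q (\<xi> q)"] assms
  by (simp add: local_rep_def)

lemma component_smooth_fun:
  assumes "c \<in> A" "U \<subseteq> cdom c" "vector_field A U \<xi>"
  shows "smooth_fun A U (\<lambda>q. local_rep A c \<xi> (cmap c q) \<bullet> b)"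
  by (rule smooth_funI_chart[OF assms(1,2)], rule smooth_on_cong)
   (rule smooth_on_bounded_linear[OF bounded_linear_inner_left vector_field_in_chart[OF assms(3,1)]], use assms in auto)

end

section \<open>The Levi-Civita connection in a chart\<close>

locale levi_civita_metric = boundary_atlas A
  for A :: "('m::{t2_space, second_countable_topology}, 'a::euclidean_space) chart set" +
  fixes g :: "'m \<Rightarrow> 'a \<Rightarrow> 'a \<Rightarrow> real"
    and nabla :: "('m \<Rightarrow> 'a) \<Rightarrow> ('m \<Rightarrow> 'a) \<Rightarrow> 'm \<Rightarrow> 'a"
  assumes metric: "pseudo_riemannian_metric A (mfd_interior A) g"
    and levi_civita: "levi_civita_connection A (mfd_interior A) g nabla"
begin

lemma metric_bilinear: "p \<in> mfd_interior A \<Longrightarrow> bilinear (g p)"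
  and metric_sym: "p \<in> mfd_interior A \<Longrightarrow> g p u v = g p v u"
  using metric unfolding pseudo_riemannian_metric_def symmetric_form_field_def
    bilinear_form_field_def by blast+

lemma nabla_axioms:
  assumes "open U" "U \<subseteq> mfd_interior A" "vector_field A U \<xi>" "vector_field A U \<eta>" "vector_field A U \<zeta>" "smooth_fun A U f"
  shows "vector_field A U (nabla \<xi> \<eta>)"
    and "p \<in> U \<Longrightarrow> nabla (\<lambda>q. \<xi> q + \<zeta> q) \<eta> p = nabla \<xi> \<eta> p + nabla \<zeta> \<eta> p"
    and "p \<in> U \<Longrightarrow> nabla (\<lambda>q. f q *\<^sub>R \<xi> q) \<eta> p = f p *\<^sub>R nabla \<xi> \<eta> p"
    and "p \<in> U \<Longrightarrow> nabla \<xi> (\<lambda>q. \<eta> q + \<zeta> q) p = nabla \<xi> \<eta> p + nabla \<xi> \<zeta> p"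
    and "p \<in> U \<Longrightarrow> nabla \<xi> (\<lambda>q. f q *\<^sub>R \<eta> q) p = differential A f p (\<xi> p) *\<^sub>R \<eta> p + f p *\<^sub>R nabla \<xi> \<eta> p"
    and "p \<in> U \<Longrightarrow> nabla \<xi> \<eta> p - nabla \<eta> \<xi> p = lie_bracket A \<xi> \<eta> p"
    and "p \<in> U \<Longrightarrow> differential A (\<lambda>q. g q (\<eta> q) (\<zeta> q)) p (\<xi> p) =
             g p (nabla \<xi> \<eta> p) (\<zeta> p) + g p (\<eta> p) (nabla \<xi> \<zeta> p)"
  using levi_civita[unfolded levi_civita_connection_def, rule_format, of U \<xi> \<eta> \<zeta> f] assms by blast+

lemma nabla_smooth:
  assumes "open U" "U \<subseteq> mfd_interior A" "vector_field A U \<xi>" "vector_field A U \<eta>"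
  shows "vector_field A U (nabla \<xi> \<eta>)"
  using nabla_axioms(1)[OF assms assms(4) smooth_fun_const] .

lemma nabla_torsion_free:
  assumes "open U" "U \<subseteq> mfd_interior A" "vector_field A U \<xi>" "vector_field A U \<eta>" "p \<in> U"
  shows "nabla \<xi> \<eta> p - nabla \<eta> \<xi> p = lie_bracket A \<xi> \<eta> p"
  using nabla_axioms(6)[OF assms(1-4) assms(4) smooth_fun_const assms(5)] .

lemma nabla_metric:
  assumes "open U" "U \<subseteq> mfd_interior A" "vector_field A U \<xi>" "vector_field A U \<eta>" "vector_field A U \<zeta>" "p \<in> U"
  shows "differential A (\<lambda>q. g q (\<eta> q) (\<zeta> q)) p (\<xi> p) = g p (nabla \<xi> \<eta> p) (\<zeta> p) + g p (\<eta> p) (nabla \<xi> \<zeta> p)"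
  using nabla_axioms(7)[OF assms(1-5) smooth_fun_const assms(6)] .

text \<open>Locality of the connection in both arguments. A field that vanishes on \<open>U\<close>, with arbitrary
  values elsewhere, is its own multiple by the function that is \<open>0\<close> on \<open>U\<close> and \<open>1\<close> outside. This
  function is smooth on \<open>U\<close>, so linearity over functions and the Leibniz rule apply.\<close>

lemma nabla_zero_field:
  assumes U: "open U" "U \<subseteq> mfd_interior A" "p \<in> U" and vf: "vector_field A U \<eta>"
    and zero: "\<And>q. q \<in> U \<Longrightarrow> \<zeta> q = 0"
  shows "nabla \<eta> \<zeta> p = 0" "nabla \<zeta> \<eta> p = 0"
proof -
  have vz: "vector_field A U \<zeta>" using vector_field_cong[OF vector_field_zero] zero by metis
  define f :: "'m \<Rightarrow> real" where "f q = (if q \<in> U then 0 else 1)" for q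
  have sf: "smooth_fun A U f"
    unfolding smooth_fun_def o_def
  proof
    fix c assume c: "c \<in> A"
    show "smooth_on (cmap c ` (U \<inter> cdom c)) (\<lambda>x. f (cinv c x))"
      by (rule smooth_on_cong[OF smooth_on_const[of _ 0]]) (use c in \<open>auto simp: f_def\<close>)
  qed
  have f\<zeta>: "(\<lambda>q. f q *\<^sub>R \<zeta> q) = \<zeta>" using zero by (auto simp: f_def)
  show "nabla \<eta> \<zeta> p = 0"
    using nabla_axioms(5)[OF U(1,2) vf vz vz sf U(3)] zero U(3) unfolding f\<zeta> by (simp add: f_def)
  show "nabla \<zeta> \<eta> p = 0"
    using nabla_axioms(3)[OF U(1,2) vz vf vf sf U(3)] U(3) unfolding f\<zeta> by (simp add: f_def)
qed

lemma nabla_cong: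
  assumes U: "open U" "U \<subseteq> mfd_interior A" "p \<in> U"
    and vf: "vector_field A U \<xi>" "vector_field A U \<eta>"
    and eq: "\<And>q. q \<in> U \<Longrightarrow> \<xi>' q = \<xi> q" "\<And>q. q \<in> U \<Longrightarrow> \<eta>' q = \<eta> q"
  shows "nabla \<xi>' \<eta>' p = nabla \<xi> \<eta> p"
proof -
  have vf': "vector_field A U \<xi>'" "vector_field A U \<eta>'"
    using vector_field_cong[OF vf(1), of \<xi>'] vector_field_cong[OF vf(2), of \<eta>'] eq by auto
  have d: "vector_field A U (\<lambda>q. \<xi>' q - \<xi> q)" "vector_field A U (\<lambda>q. \<eta>' q - \<eta> q)"
    using vector_field_diff vf vf' by auto
  have "nabla \<xi>' \<eta>' p = nabla (\<lambda>q. \<xi> q + (\<xi>' q - \<xi> q)) \<eta>' p" by simp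
  also have "\<dots> = nabla \<xi> \<eta>' p + nabla (\<lambda>q. \<xi>' q - \<xi> q) \<eta>' p"
    by (rule nabla_axioms(2)[OF U(1,2) vf(1) vf'(2) d(1) smooth_fun_const U(3)])
  also have "nabla (\<lambda>q. \<xi>' q - \<xi> q) \<eta>' p = 0"
    by (rule nabla_zero_field(2)[OF U vf'(2)]) (use eq in simp)
  also have "nabla \<xi> \<eta>' p = nabla \<xi> (\<lambda>q. \<eta> q + (\<eta>' q - \<eta> q)) p" by simp
  also have "\<dots> = nabla \<xi> \<eta> p + nabla \<xi> (\<lambda>q. \<eta>' q - \<eta> q) p"
    by (rule nabla_axioms(4)[OF U(1,2) vf(1) vf(2) d(2) smooth_fun_const U(3)])
  also have "nabla \<xi> (\<lambda>q. \<eta>' q - \<eta> q) p = 0"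
    by (rule nabla_zero_field(1)[OF U vf(1)]) (use eq in simp)
  finally show ?thesis by simp
qed

lemma nabla_sum_left:
  assumes U: "open U" "U \<subseteq> mfd_interior A" "p \<in> U" and vf: "vector_field A U \<eta>"
    and X: "finite I" "\<And>i. i \<in> I \<Longrightarrow> vector_field A U (X i)"
  shows "nabla (\<lambda>q. \<Sum>i\<in>I. X i q) \<eta> p = (\<Sum>i\<in>I. nabla (X i) \<eta> p)"
  using X
proof (induction I rule: finite_induct)
  case empty
  then show ?case using nabla_zero_field(2)[OF U vf, of "\<lambda>_. 0"] by simp
next
  case (insert i I)
  then show ?case
    using nabla_axioms(2)[OF U(1,2) _ vf vector_field_sum smooth_fun_const U(3), of "X i" I X] by simp
qed

lemma nabla_sum_right:
  assumes U: "open U" "U \<subseteq> mfd_interior A" "p \<in> U" and vf: "vector_field A U \<xi>"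
    and X: "finite I" "\<And>i. i \<in> I \<Longrightarrow> vector_field A U (X i)"
  shows "nabla \<xi> (\<lambda>q. \<Sum>i\<in>I. X i q) p = (\<Sum>i\<in>I. nabla \<xi> (X i) p)"
  using X
proof (induction I rule: finite_induct)
  case empty
  then show ?case using nabla_zero_field(1)[OF U vf, of "\<lambda>_. 0"] by simp
next
  case (insert i I)
  then show ?case
    using nabla_axioms(4)[OF U(1,2) vf _ vector_field_sum smooth_fun_const U(3), of "X i" I X] by simp
qed

text \<open>The bilinear extension of the values on coordinate fields, so that bilinearity in \<open>u\<close> and \<open>v\<close>
  holds by construction, at every \<open>x\<close>.\<close>

definition christoffel :: "('m, 'a) chart \<Rightarrow> 'a \<Rightarrow> 'a \<Rightarrow> 'a \<Rightarrow> 'a" where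
  "christoffel c x u v = (\<Sum>a\<in>Basis. \<Sum>b\<in>Basis. ((u \<bullet> a) * (v \<bullet> b)) *\<^sub>R
     local_rep A c (nabla (coord_field A c a) (coord_field A c b)) x)"

lemma christoffel_bilinear: "bilinear (christoffel c x)"
  unfolding bilinear_def christoffel_def
  by (auto intro!: linearI simp: inner_add_left algebra_simps sum.distrib scaleR_sum_right)

text \<open>Both fields are expanded in the coordinate fields of \<open>c\<close>; the Leibniz rule for the second
  field produces the derivative term.\<close>

lemma nabla_in_chart:
  assumes c: "c \<in> A" and U: "open U" "U \<subseteq> mfd_interior A" "U \<subseteq> cdom c" "p \<in> U"
    and vf: "vector_field A U \<xi>" "vector_field A U \<eta>"
  shows "components A c p (nabla \<xi> \<eta> p) =
    Dh (local_rep A c \<eta>) (cmap c p) (local_rep A c \<xi> (cmap c p)) +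
    christoffel c (cmap c p) (local_rep A c \<xi> (cmap c p)) (local_rep A c \<eta> (cmap c p))"
proof -
  let ?x = "cmap c p" and ?E = "coord_field A c"
  let ?r = "\<lambda>\<zeta> q. local_rep A c \<zeta> (cmap c q)"
  have p: "p \<in> cdom c" using U by auto
  have sm: "smooth_fun A U (\<lambda>q. ?r \<zeta> q \<bullet> b)" if "vector_field A U \<zeta>" for \<zeta> b
    using component_smooth_fun[OF c U(3) that] .
  have E: "vector_field A U (?E b)" for b using coord_field_vector_field[OF c U(3)] .
  have fE: "vector_field A U (\<lambda>q. (?r \<zeta> q \<bullet> b) *\<^sub>R ?E b q)" if "vector_field A U \<zeta>" for \<zeta> b
    by (rule vector_field_scale[OF sm[OF that] E])
  have "nabla \<xi> \<eta> p = nabla (\<lambda>q. \<Sum>a\<in>Basis. (?r \<xi> q \<bullet> a) *\<^sub>R ?E a q) \<eta> p"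
    by (rule nabla_cong[OF U(1,2,4) vector_field_sum[OF fE[OF vf(1)]] vf(2)])
      (use field_expansion[OF c] U(3) in auto)
  also have "\<dots> = (\<Sum>a\<in>Basis. nabla (\<lambda>q. (?r \<xi> q \<bullet> a) *\<^sub>R ?E a q) \<eta> p)"
    by (rule nabla_sum_left[OF U(1,2,4) vf(2)]) (use fE vf in auto)
  also have "\<dots> = (\<Sum>a\<in>Basis. (?r \<xi> p \<bullet> a) *\<^sub>R nabla (?E a) \<eta> p)"
    by (intro sum.cong refl nabla_axioms(3)[OF U(1,2) E vf(2) vf(2) sm[OF vf(1)] U(4)])
  finally have 1: "nabla \<xi> \<eta> p = (\<Sum>a\<in>Basis. (?r \<xi> p \<bullet> a) *\<^sub>R nabla (?E a) \<eta> p)" .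
  have D\<eta>: "(local_rep A c \<eta> has_derivative Dh (local_rep A c \<eta>) ?x) (at ?x within half_space)"
    using smooth_on_D[OF image_hopen[OF c U(1)] vector_field_in_chart[OF vf(2) c]] p U by blast
  have dif: "differential A (\<lambda>q. ?r \<eta> q \<bullet> b) p (?E a p) = Dh (local_rep A c \<eta>) ?x a \<bullet> b" for a b
  proof -
    have "differential A (\<lambda>q. ?r \<eta> q \<bullet> b) p (?E a p) = Dh (\<lambda>x. ?r \<eta> (cinv c x) \<bullet> b) ?x a"
      using differential_in_chart[OF c p U(1,4) sm[OF vf(2)]] c p by simp
    also have "Dh (\<lambda>x. ?r \<eta> (cinv c x) \<bullet> b) ?x = Dh (\<lambda>x. local_rep A c \<eta> x \<bullet> b) ?x"
      by (rule Dh_cong[OF chart_image_hopen[OF c]]) (use c p in auto)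
    also have "\<dots> = (\<lambda>v. Dh (local_rep A c \<eta>) ?x v \<bullet> b)"
      by (rule Dh_eq[OF has_derivative_inner_left[OF D\<eta>] cmap_half[OF c p]])
    finally show ?thesis .
  qed
  have 2: "nabla (?E a) \<eta> p = (\<Sum>b\<in>Basis. (Dh (local_rep A c \<eta>) ?x a \<bullet> b) *\<^sub>R ?E b p + (?r \<eta> p \<bullet> b) *\<^sub>R nabla (?E a) (?E b) p)" for a
  proof -
    have "nabla (?E a) \<eta> p = nabla (?E a) (\<lambda>q. \<Sum>b\<in>Basis. (?r \<eta> q \<bullet> b) *\<^sub>R ?E b q) p"
      by (rule nabla_cong[OF U(1,2,4) E vector_field_sum[OF fE[OF vf(2)]]])
        (use field_expansion[OF c] U(3) in auto)
    also have "\<dots> = (\<Sum>b\<in>Basis. nabla (?E a) (\<lambda>q. (?r \<eta> q \<bullet> b) *\<^sub>R ?E b q) p)"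
      by (rule nabla_sum_right[OF U(1,2,4) E]) (use fE vf in auto)
    also have "\<dots> = (\<Sum>b\<in>Basis. (Dh (local_rep A c \<eta>) ?x a \<bullet> b) *\<^sub>R ?E b p + (?r \<eta> p \<bullet> b) *\<^sub>R nabla (?E a) (?E b) p)"
      unfolding dif[symmetric]
      by (intro sum.cong refl nabla_axioms(5)[OF U(1,2) E E E sm[OF vf(2)] U(4)])
    finally show ?thesis .
  qed
  have lin: "linear (components A c p)" using components_linear[OF c p] .
  have "components A c p (nabla (?E a) \<eta> p) = (\<Sum>b\<in>Basis. (Dh (local_rep A c \<eta>) ?x a \<bullet> b) *\<^sub>R b
      + (?r \<eta> p \<bullet> b) *\<^sub>R local_rep A c (nabla (?E a) (?E b)) ?x)" for a
    unfolding 2 using c p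
    by (simp add: linear_sum[OF lin] linear_add[OF lin] linear_scale[OF lin] local_rep_def)
  then have 3: "components A c p (nabla (?E a) \<eta> p) = Dh (local_rep A c \<eta>) ?x a +
      (\<Sum>b\<in>Basis. (?r \<eta> p \<bullet> b) *\<^sub>R local_rep A c (nabla (?E a) (?E b)) ?x)" for a
    by (simp add: sum.distrib euclidean_representation)
  have "components A c p (nabla \<xi> \<eta> p) = (\<Sum>a\<in>Basis. (?r \<xi> p \<bullet> a) *\<^sub>R Dh (local_rep A c \<eta>) ?x a)
      + christoffel c ?x (?r \<xi> p) (?r \<eta> p)"
    unfolding 1 christoffel_def linear_sum[OF lin] linear_scale[OF lin] 3
    by (simp add: algebra_simps sum.distrib scaleR_sum_right)
  also have "(\<Sum>a\<in>Basis. (?r \<xi> p \<bullet> a) *\<^sub>R Dh (local_rep A c \<eta>) ?x a) = Dh (local_rep A c \<eta>) ?x (?r \<xi> p)"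
    by (rule linear_Basis_expansion[symmetric, OF has_derivative_linear[OF D\<eta>]])
  finally show ?thesis .
qed

end

section \<open>Curvature\<close>

text \<open>For constant \<open>w\<close>, \<open>u\<close>, \<open>v\<close> this is the coordinate expression of \<open>R(w,u)v\<close> for the connection
  with Christoffel symbols \<open>B\<close>.\<close>

definition curvature_of :: "('a::euclidean_space \<Rightarrow> 'a \<Rightarrow> 'a \<Rightarrow> 'a) \<Rightarrow> 'a \<Rightarrow> 'a \<Rightarrow> 'a \<Rightarrow> 'a \<Rightarrow> 'a" where
  "curvature_of B x w u v =
     Dh (\<lambda>y. B y u v) x w - Dh (\<lambda>y. B y w v) x u + B x w (B x u v) - B x u (B x w v)"

text \<open>With \<open>k\<close> a change of basis, this is the independence of the trace from the chart.\<close>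

lemma trace_commute:
  fixes f :: "'a::euclidean_space \<Rightarrow> 'a" and k :: "'a \<Rightarrow> 'a"
  assumes "linear f" "linear k"
  shows "(\<Sum>w\<in>Basis. f (k w) \<bullet> w) = (\<Sum>w\<in>Basis. k (f w) \<bullet> w)"
proof -
  have expand: "p (q w) \<bullet> w = (\<Sum>b\<in>Basis. (q w \<bullet> b) * (p b \<bullet> w))" if "linear p" for p q :: "'a \<Rightarrow> 'a" and w
    by (subst linear_Basis_expansion[OF that, of "q w"]) (simp add: inner_sum_left)
  show ?thesis
    unfolding expand[OF assms(1), of k] expand[OF assms(2), of f]
    by (subst sum.swap) (simp add: mult.commute)
qed

text \<open>The symmetric connections \<open>B\<close> and \<open>N\<close> are projectively equivalent by means of the closed
  one-form \<open>\<Upsilon> = dr/r\<close>. In general the curvatures of projectively equivalent connections differ by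
  terms in \<open>\<nabla>\<Upsilon> + \<Upsilon> \<otimes> \<Upsilon>\<close>, with \<open>\<nabla>\<close> the connection \<open>N\<close>. For \<open>\<Upsilon> = dr/r\<close> the
  derivative of \<open>1/r\<close> contributes \<open>- \<Upsilon> \<otimes> \<Upsilon>\<close>, and only the Hessian of \<open>r\<close> with respect to
  \<open>N\<close>, divided by \<open>r\<close>, remains.\<close>

lemma projective_change_curvature:
  fixes r :: "'a::euclidean_space \<Rightarrow> real"
  assumes S: "hopen S" "x \<in> S" and pos: "x \<bullet> normal_dir > 0"
    and r: "smooth_on S r" "r x \<noteq> 0"
    and N: "bilinear (N x)" "\<And>u v. smooth_on S (\<lambda>y. N y u v)" "\<And>u v. N x u v = N x v u"
    and B: "\<And>y u v. y \<in> S \<Longrightarrow> B y u v = N y u v - (Dh r y u / r y) *\<^sub>R v - (Dh r y v / r y) *\<^sub>R u"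
  shows "curvature_of B x w u v = curvature_of N x w u v
    + ((Dh (\<lambda>y. Dh r y u) x v - Dh r x (N x u v)) / r x) *\<^sub>R w
    - ((Dh (\<lambda>y. Dh r y w) x v - Dh r x (N x w v)) / r x) *\<^sub>R u"
proof -
  let ?dd = "\<lambda>u v. Dh (\<lambda>y. Dh r y u) x v"
  define Y where "Y u = Dh r x u / r x" for u
  have xh: "x \<in> half_space" using hopen_half[OF S] .
  have dr: "(r has_derivative Dh r x) (at x within half_space)" by (rule smooth_on_D[OF S(1) r(1) S(2)])
  have ddr: "((\<lambda>y. Dh r y u) has_derivative ?dd u) (at x within half_space)" for u
    by (rule smooth_on_D[OF S(1) smooth_on_Dh[OF S(1) r(1)] S(2)])
  have sym: "?dd u v = ?dd v u" for u v by (rule Dh_Dh_symmetric[OF S(1) r(1) S(2) pos])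
  have dY: "((\<lambda>y. Dh r y u / r y) has_derivative (\<lambda>v. ?dd u v / r x - Y u * Y v)) (at x within half_space)" for u
    using has_derivative_divide[OF ddr[of u] dr r(2)]
    by (rule back_subst[where P="\<lambda>f'. (_ has_derivative f') _"]) (use r(2) in \<open>auto simp: Y_def fun_eq_iff field_simps\<close>)
  have dN: "((\<lambda>y. N y u v) has_derivative Dh (\<lambda>y. N y u v) x) (at x within half_space)" for u v
    by (rule smooth_on_D[OF S(1) N(2) S(2)])
  have "((\<lambda>y. N y u v - (Dh r y u / r y) *\<^sub>R v - (Dh r y v / r y) *\<^sub>R u) has_derivative
      (\<lambda>w. Dh (\<lambda>y. N y u v) x w - (?dd u w / r x - Y u * Y w) *\<^sub>R v - (?dd v w / r x - Y v * Y w) *\<^sub>R u)) (at x within half_space)" for u v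
    by (intro has_derivative_diff dN has_derivative_scaleR_left dY)
  then have hB: "((\<lambda>y. B y u v) has_derivative
      (\<lambda>w. Dh (\<lambda>y. N y u v) x w - (?dd u w / r x - Y u * Y w) *\<^sub>R v - (?dd v w / r x - Y v * Y w) *\<^sub>R u)) (at x within half_space)" for u v
    by (rule has_derivative_cong_hopen[OF S, rotated]) (rule B[symmetric])
  have DB: "Dh (\<lambda>y. B y u v) x w =
     Dh (\<lambda>y. N y u v) x w - (?dd u w / r x - Y u * Y w) *\<^sub>R v - (?dd v w / r x - Y v * Y w) *\<^sub>R u" for u v w
    by (rule fun_cong[OF Dh_eq[OF hB xh]])
  have Bx: "B x u v = N x u v - Y u *\<^sub>R v - Y v *\<^sub>R u" for u v using B[OF S(2)] by (simp add: Y_def)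
  have linr: "linear (Dh r x)" by (rule smooth_on_Dh_linear[OF S(1) r(1) S(2)])
  have Yl: "Y (a - b) = Y a - Y b" "Y (t *\<^sub>R a) = t * Y a" for a b t
    by (simp_all add: Y_def linear_diff[OF linr] linear_scale[OF linr] diff_divide_distrib)
  have Nl: "N x a (b - c) = N x a b - N x a c" "N x a (t *\<^sub>R b) = t *\<^sub>R N x a b" for a b c t
    using bilinear_rsub[OF N(1)] bilinear_rmul[OF N(1)] by auto
  have YN: "Dh r x a / r x = Y a" for a by (simp add: Y_def)
  have BB: "B x w (B x u v) = N x w (N x u v) - Y u *\<^sub>R N x w v - Y v *\<^sub>R N x w u
     - Y w *\<^sub>R N x u v + (Y w * Y u) *\<^sub>R v + (Y w * Y v) *\<^sub>R u - Y (N x u v) *\<^sub>R w + (Y u * Y v) *\<^sub>R w + (Y u * Y v) *\<^sub>R w" for w u v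
    unfolding Bx Nl Yl by (simp add: algebra_simps, simp flip: scaleR_left_distrib)
  show ?thesis
    unfolding curvature_of_def DB BB diff_divide_distrib YN sym[of v w] sym[of v u] sym[of w u]
    using N(3)[of w u] by (simp add: algebra_simps)
qed

lemma trace_projective_change:
  fixes \<beta> :: "'a::euclidean_space \<Rightarrow> real"
  assumes "linear \<beta>"
  shows "(\<Sum>w\<in>Basis. (\<beta> u *\<^sub>R w - \<beta> w *\<^sub>R u) \<bullet> w) = (real DIM('a) - 1) * \<beta> u"
proof -
  have "(\<Sum>w\<in>Basis. (\<beta> u *\<^sub>R w - \<beta> w *\<^sub>R u) \<bullet> w) = (\<Sum>w\<in>(Basis::'a set). \<beta> u) - (\<Sum>w\<in>Basis. (u \<bullet> w) *\<^sub>R \<beta> w)"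
    by (simp add: inner_diff_left sum_subtractf mult.commute)
  also have "(\<Sum>w\<in>Basis. (u \<bullet> w) *\<^sub>R \<beta> w) = \<beta> u" by (rule linear_Basis_expansion[OF assms, symmetric])
  finally show ?thesis by (simp add: algebra_simps)
qed

context boundary_atlas begin

definition form_rep :: "('m, 'a) chart \<Rightarrow> ('m \<Rightarrow> 'a \<Rightarrow> 'a \<Rightarrow> real) \<Rightarrow> 'a \<Rightarrow> 'a \<Rightarrow> 'a \<Rightarrow> real" where
  "form_rep c b x u v = b (cinv c x) (coord_field A c u (cinv c x)) (coord_field A c v (cinv c x))"

lemma form_rep_bilinear:
  assumes "c \<in> A" "p \<in> cdom c" "bilinear (b p)"
  shows "bilinear (form_rep c b (cmap c p))"
  using assms linear_compose[OF coord_field_linear[OF assms(1,2)]]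
  unfolding bilinear_def form_rep_def by (auto simp: o_def)

lemma form_rep_smooth:
  "bilinear_form_field A U b \<Longrightarrow> c \<in> A \<Longrightarrow> smooth_on (cmap c ` (U \<inter> cdom c)) (\<lambda>x. form_rep c b x u v)"
  unfolding bilinear_form_field_def form_rep_def o_def by blast

lemma form_eq_form_rep:
  "c \<in> A \<Longrightarrow> p \<in> cdom c \<Longrightarrow> b p u v = form_rep c b (cmap c p) (components A c p u) (components A c p v)"
  by (simp add: form_rep_def)

end

context levi_civita_metric begin

lemma interior_image:
  assumes "c \<in> A"
  shows "hopen (cmap c ` (mfd_interior A \<inter> cdom c))"
    and "x \<in> cmap c ` (mfd_interior A \<inter> cdom c) \<Longrightarrow> x \<bullet> normal_dir > 0"
  using image_hopen[OF assms mfd_interior_open] interior_iff[OF assms] by auto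

lemma christoffel_smooth:
  assumes c: "c \<in> A"
  shows "smooth_on (cmap c ` (mfd_interior A \<inter> cdom c)) (\<lambda>x. christoffel c x u v)"
proof -
  let ?U = "mfd_interior A \<inter> cdom c"
  have "open ?U" using mfd_interior_open chart_open[OF c] by auto
  then have "vector_field A ?U (nabla (coord_field A c a) (coord_field A c b))" for a b
    by (intro nabla_smooth coord_field_vector_field[OF c]) auto
  from vector_field_in_chart[OF this c]
  have "smooth_on (cmap c ` ?U) (local_rep A c (nabla (coord_field A c a) (coord_field A c b)))" for a b
    by (simp add: Int_assoc)
  then show ?thesis unfolding christoffel_def
    by (intro smooth_on_sum smooth_on_scaleR smooth_on_const)
qed

lemma nabla_coord_fields:
  assumes c: "c \<in> A" "p \<in> cdom c" "p \<in> mfd_interior A"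
  shows "components A c p (nabla (coord_field A c u) (coord_field A c v) p) = christoffel c (cmap c p) u v"
proof -
  let ?U = "mfd_interior A \<inter> cdom c"
  have "open ?U" using mfd_interior_open chart_open[OF c(1)] by auto
  from nabla_in_chart[OF c(1) this _ _ _ coord_field_vector_field[OF c(1)] coord_field_vector_field[OF c(1)], of p u v]
  show ?thesis using c by (simp add: local_rep_coord_field_Dh)
qed

lemma christoffel_symmetric:
  assumes c: "c \<in> A" "p \<in> cdom c" "p \<in> mfd_interior A"
  shows "christoffel c (cmap c p) u v = christoffel c (cmap c p) v u"
proof -
  let ?U = "mfd_interior A \<inter> cdom c" and ?E = "coord_field A c"
  have U: "open ?U" "?U \<subseteq> mfd_interior A" "p \<in> ?U" using mfd_interior_open chart_open[OF c(1)] c by auto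
  have E: "vector_field A ?U (?E v)" for v by (rule coord_field_vector_field[OF c(1)]) auto
  have "components A c p (lie_bracket A (?E u) (?E v) p) = 0"
    unfolding lie_bracket_in_chart[OF c(1,2) U(1,3,2) E E] using c by (simp add: local_rep_coord_field_Dh)
  then have "components A c p (nabla (?E u) (?E v) p - nabla (?E v) (?E u) p) = 0"
    unfolding nabla_torsion_free[OF U(1,2) E E U(3)] .
  then show ?thesis
    by (simp add: linear_diff[OF components_linear[OF c(1,2)]] nabla_coord_fields[OF c])
qed

lemma metric_derivative:
  assumes c: "c \<in> A" "p \<in> cdom c" "p \<in> mfd_interior A"
  shows "Dh (\<lambda>x. form_rep c g x v w) (cmap c p) u =
    form_rep c g (cmap c p) (christoffel c (cmap c p) u v) w + form_rep c g (cmap c p) v (christoffel c (cmap c p) u w)"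
proof -
  let ?U = "mfd_interior A \<inter> cdom c" and ?E = "coord_field A c"
  have U: "open ?U" "?U \<subseteq> mfd_interior A" "p \<in> ?U" using mfd_interior_open chart_open[OF c(1)] c by auto
  have E: "vector_field A ?U (?E v)" for v by (rule coord_field_vector_field[OF c(1)]) auto
  have bf: "bilinear_form_field A (mfd_interior A) g"
    using metric unfolding pseudo_riemannian_metric_def symmetric_form_field_def by blast
  have sm: "smooth_fun A ?U (\<lambda>q. g q (?E v q) (?E w q))"
    by (rule smooth_funI_chart[OF c(1)])
      (use form_rep_smooth[OF bf c(1)] in \<open>auto simp: form_rep_def intro: smooth_on_subset\<close>)
  have "Dh (\<lambda>x. form_rep c g x v w) (cmap c p) u = differential A (\<lambda>q. g q (?E v q) (?E w q)) p (?E u p)"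
    unfolding differential_in_chart[OF c(1,2) U(1,3) sm] form_rep_def using c by simp
  also have "\<dots> = g p (nabla (?E u) (?E v) p) (?E w p) + g p (?E v p) (nabla (?E u) (?E w) p)"
    by (rule nabla_metric[OF U(1,2) E E E U(3)])
  finally show ?thesis
    unfolding form_eq_form_rep[OF c(1,2), of g] nabla_coord_fields[OF c] using c by simp
qed

lemma koszul_in_chart:
  assumes c: "c \<in> A" "p \<in> cdom c" "p \<in> mfd_interior A"
  shows "2 * form_rep c g (cmap c p) (christoffel c (cmap c p) u v) w =
    Dh (\<lambda>x. form_rep c g x v w) (cmap c p) u + Dh (\<lambda>x. form_rep c g x u w) (cmap c p) v
     - Dh (\<lambda>x. form_rep c g x u v) (cmap c p) w"
proof -
  have sym: "form_rep c g (cmap c p) a b = form_rep c g (cmap c p) b a" for a b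
    unfolding form_rep_def using metric_sym c by simp
  let ?G = "christoffel c (cmap c p)"
  show ?thesis
    unfolding metric_derivative[OF c]
    using christoffel_symmetric[OF c, of v u] christoffel_symmetric[OF c, of w u] christoffel_symmetric[OF c, of w v]
      sym[of u "?G v w"] sym[of v "?G u w"] sym[of "?G u v" w] sym[of v "?G w u"] sym[of u "?G w v"] sym by simp
qed

text \<open>Stated for arbitrary local fields, because the Ricci tensor extends tangent vectors by constant
  components in the preferred chart, which varies from point to point. All derivatives of
  the three fields cancel: second derivatives of \<open>\<zeta>\<close> by symmetry, derivatives of \<open>\<xi>\<close> and \<open>\<eta>\<close> against the
  bracket.\<close>

lemma curvature_in_chart:
  assumes c: "c \<in> A" and U: "open U" "U \<subseteq> mfd_interior A" "U \<subseteq> cdom c" "p \<in> U"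
    and vf: "vector_field A U \<xi>" "vector_field A U \<eta>" "vector_field A U \<zeta>"
  shows "components A c p (curvature A nabla \<xi> \<eta> \<zeta> p) = curvature_of (christoffel c) (cmap c p)
    (local_rep A c \<xi> (cmap c p)) (local_rep A c \<eta> (cmap c p)) (local_rep A c \<zeta> (cmap c p))"
proof -
  let ?x = "cmap c p" and ?r = "local_rep A c" and ?\<Gamma> = "christoffel c"
  have p: "p \<in> cdom c" using U by auto
  let ?S = "cmap c ` (U \<inter> cdom c)"
  have S: "hopen ?S" "?x \<in> ?S" using image_hopen[OF c U(1)] p U by auto
  have pos: "?x \<bullet> normal_dir > 0" using interior_iff[OF c p] U by auto
  have sm: "smooth_on ?S (?r X)" if "vector_field A U X" for X using vector_field_in_chart[OF that c] .
  have der: "(?r X has_derivative Dh (?r X) ?x) (at ?x within half_space)" if "vector_field A U X" for X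
    using smooth_on_D[OF S(1) sm[OF that] S(2)] .
  have sm\<Gamma>: "smooth_on ?S (\<lambda>x. ?\<Gamma> x u v)" for u v
    by (rule smooth_on_subset[OF christoffel_smooth[OF c]]) (use U in auto)
  have d\<Gamma>: "((\<lambda>x. ?\<Gamma> x u v) has_derivative Dh (\<lambda>x. ?\<Gamma> x u v) ?x) (at ?x within half_space)" for u v
    using smooth_on_D[OF S(1) sm\<Gamma> S(2)] .
  have nab: "?r (nabla X Y) y = Dh (?r Y) y (?r X y) + ?\<Gamma> y (?r X y) (?r Y y)"
    if "vector_field A U X" "vector_field A U Y" "y \<in> ?S" for X Y y
    using nabla_in_chart[OF c U(1,2,3) _ that(1,2)] that(3) c by (auto simp: local_rep_def)
  have D2: "Dh (?r (nabla Y Z)) ?x v = Dh (?r Z) ?x (Dh (?r Y) ?x v) + Dh (\<lambda>y. Dh (?r Z) y (?r Y ?x)) ?x v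
      + (?\<Gamma> ?x (Dh (?r Y) ?x v) (?r Z ?x) + (?\<Gamma> ?x (?r Y ?x) (Dh (?r Z) ?x v) + Dh (\<lambda>y. ?\<Gamma> y (?r Y ?x) (?r Z ?x)) ?x v))"
    if Y: "vector_field A U Y" and Z: "vector_field A U Z" for Y Z v
  proof -
    have "((\<lambda>y. Dh (?r Z) y (?r Y y)) has_derivative
       (\<lambda>v. Dh (?r Z) ?x (Dh (?r Y) ?x v) + Dh (\<lambda>y. Dh (?r Z) y (?r Y ?x)) ?x v)) (at ?x within half_space)"
      by (rule has_derivative_linear_family[OF S _ _ der[OF Y]])
        (erule smooth_on_Dh_linear[OF S(1) sm[OF Z]], rule smooth_on_D[OF S(1) smooth_on_Dh[OF S(1) sm[OF Z]] S(2)])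
    moreover have "((\<lambda>y. ?\<Gamma> y (?r Y y) (?r Z y)) has_derivative
      (\<lambda>v. ?\<Gamma> ?x (Dh (?r Y) ?x v) (?r Z ?x) + (?\<Gamma> ?x (?r Y ?x) (Dh (?r Z) ?x v) + Dh (\<lambda>y. ?\<Gamma> y (?r Y ?x) (?r Z ?x)) ?x v))) (at ?x within half_space)"
      by (rule has_derivative_bilinear_family[OF S christoffel_bilinear d\<Gamma> der[OF Y] der[OF Z]])
    ultimately have "(?r (nabla Y Z) has_derivative
        (\<lambda>v. Dh (?r Z) ?x (Dh (?r Y) ?x v) + Dh (\<lambda>y. Dh (?r Z) y (?r Y ?x)) ?x v
      + (?\<Gamma> ?x (Dh (?r Y) ?x v) (?r Z ?x) + (?\<Gamma> ?x (?r Y ?x) (Dh (?r Z) ?x v) + Dh (\<lambda>y. ?\<Gamma> y (?r Y ?x) (?r Z ?x)) ?x v)))) (at ?x within half_space)"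
      by (rule has_derivative_cong_hopen[OF S _ has_derivative_add, rotated 1]) (rule nab[OF Y Z, symmetric])
    from Dh_eq[OF this hopen_half[OF S]] show ?thesis by metis
  qed
  have vfL: "vector_field A U (lie_bracket A \<xi> \<eta>)"
    by (rule vector_field_cong[OF vector_field_diff[OF nabla_smooth[OF U(1,2) vf(1,2)] nabla_smooth[OF U(1,2) vf(2,1)]]])
      (rule nabla_torsion_free[OF U(1,2) vf(1,2)])
  have rL: "?r (lie_bracket A \<xi> \<eta>) ?x = Dh (?r \<eta>) ?x (?r \<xi> ?x) - Dh (?r \<xi>) ?x (?r \<eta> ?x)"
    using lie_bracket_in_chart[OF c p U(1,4,2) vf(1,2)] c p by (simp add: local_rep_def)
  have lin\<zeta>: "linear (Dh (?r \<zeta>) ?x)" using der[OF vf(3)] has_derivative_linear by blast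
  note bl = christoffel_bilinear[of c ?x]
  have "components A c p (curvature A nabla \<xi> \<eta> \<zeta> p) =
      ?r (nabla \<xi> (nabla \<eta> \<zeta>)) ?x - ?r (nabla \<eta> (nabla \<xi> \<zeta>)) ?x - ?r (nabla (lie_bracket A \<xi> \<eta>) \<zeta>) ?x"
    unfolding curvature_def local_rep_def using c p by (simp add: linear_diff[OF components_linear[OF c p]])
  also have "\<dots> = curvature_of ?\<Gamma> ?x (?r \<xi> ?x) (?r \<eta> ?x) (?r \<zeta> ?x)"
    unfolding nab[OF vf(1) nabla_smooth[OF U(1,2) vf(2,3)] S(2)] nab[OF vf(2) nabla_smooth[OF U(1,2) vf(1,3)] S(2)]
      nab[OF vfL vf(3) S(2)] D2[OF vf(2,3)] D2[OF vf(1,3)] nab[OF vf(2,3) S(2)] nab[OF vf(1,3) S(2)] rL curvature_of_def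
    using Dh_Dh_symmetric[OF S(1) sm[OF vf(3)] S(2) pos, of "?r \<xi> ?x" "?r \<eta> ?x"]
    by (simp add: linear_diff[OF lin\<zeta>] bilinear_lsub[OF bl] bilinear_radd[OF bl])
  finally show ?thesis .
qed

lemma ricci_in_chart:
  assumes c: "c \<in> A" "p \<in> cdom c" "p \<in> mfd_interior A"
  shows "ricci A nabla p u v =
    (\<Sum>w\<in>Basis. curvature_of (christoffel c) (cmap c p) w (components A c p u) (components A c p v) \<bullet> w)"
proof -
  let ?d = "chart_at A p"
  have d: "?d \<in> A" "p \<in> cdom ?d" using chart_at_mem by auto
  let ?U = "mfd_interior A \<inter> (cdom c \<inter> cdom ?d)" and ?E = "coord_field A ?d" and ?x = "cmap c p"
  let ?J = "jacobian ?d c p" and ?J' = "jacobian c ?d p" and ?R = "curvature_of (christoffel c) (cmap c p)"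
  have U: "open ?U" "?U \<subseteq> mfd_interior A" "?U \<subseteq> cdom c" "p \<in> ?U"
    using mfd_interior_open chart_open[OF c(1)] chart_open[OF d(1)] c d by auto
  have E: "vector_field A ?U (?E v)" for v by (rule coord_field_vector_field[OF d(1)]) auto
  have rE: "local_rep A c (?E w) ?x = ?J w" for w
    using c d components_change[OF d(1) c(1) d(2) c(2)] components_coord_field[OF d, of w] by (simp add: local_rep_def)
  have cu: "components A c p u = ?J u" for u by (simp add: components_def)
  have R: "curvature A nabla (?E w) (?E u) (?E v) p = ?J' (?R (?J w) (?J u) (?J v))" for w
    using curvature_in_chart[OF c(1) U E E E, of w u v] components_change[OF c(1) d(1) c(2) d(2)]
    unfolding rE by (metis components_chart_at)
  let ?S = "cmap c ` (mfd_interior A \<inter> cdom c)"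
  have S: "hopen ?S" "?x \<in> ?S" using interior_image[OF c(1)] c by auto
  have d\<Gamma>: "((\<lambda>x. christoffel c x u v) has_derivative Dh (\<lambda>x. christoffel c x u v) ?x) (at ?x within half_space)" for u v
    using smooth_on_D[OF S(1) christoffel_smooth[OF c(1)] S(2)] .
  have bl: "linear (\<lambda>u. christoffel c y u v)" "linear (christoffel c y u)" for y u v
    using christoffel_bilinear[of c y] by (auto simp: bilinear_def)
  have "linear (\<lambda>w. ?R w u v)" for u v
    unfolding curvature_of_def
    by (intro linear_compose_sub linear_compose_add has_derivative_linear[OF d\<Gamma>] bl
        family_derivative_linear[OF S bl(1) d\<Gamma>] linear_compose[OF bl(1) bl(2), unfolded o_def])
  then have lin: "linear (\<lambda>w. ?R w (?J u) (?J v))" .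
  have "ricci A nabla p u v = (\<Sum>w\<in>Basis. ?J' (?R (?J w) (?J u) (?J v)) \<bullet> w)"
    unfolding ricci_def Let_def R ..
  also have "\<dots> = (\<Sum>w\<in>Basis. ?R (?J (?J' w)) (?J u) (?J v) \<bullet> w)"
    using trace_commute[OF linear_compose[OF linear_compose[OF jacobian_linear lin] jacobian_linear] linear_id] 
      trace_commute[OF jacobian_linear[OF c(1) d(1) c(2) d(2)] linear_compose[OF jacobian_linear[OF d(1) c(1) d(2) c(2)] lin]] by (simp add: o_def)
  also have "\<dots> = (\<Sum>w\<in>Basis. ?R w (?J u) (?J v) \<bullet> w)" using c d by simp
  finally show ?thesis unfolding cu .
qed

end

section \<open>Extension to the boundary\<close>

lemma smooth_on_linear_family:
  fixes L :: "'a::euclidean_space \<Rightarrow> 'b::euclidean_space \<Rightarrow> 'c::real_normed_vector"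
  assumes L: "\<And>y. y \<in> S \<Longrightarrow> linear (L y)" and sm: "\<And>u. smooth_on S (\<lambda>y. L y u)" and X: "smooth_on S X"
  shows "smooth_on S (\<lambda>y. L y (X y))"
proof (rule smooth_on_cong)
  show "smooth_on S (\<lambda>y. \<Sum>b\<in>Basis. (X y \<bullet> b) *\<^sub>R L y b)"
    by (intro smooth_on_sum smooth_on_scaleR smooth_on_bounded_linear[OF bounded_linear_inner_left] X sm)
qed (rule linear_Basis_expansion[OF L, symmetric])

lemma smooth_on_bilinear_family:
  fixes B :: "'a::euclidean_space \<Rightarrow> 'b::euclidean_space \<Rightarrow> 'd::euclidean_space \<Rightarrow> 'c::real_normed_vector"
  assumes B: "\<And>y. y \<in> S \<Longrightarrow> bilinear (B y)" and sm: "\<And>u v. smooth_on S (\<lambda>y. B y u v)"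
    and X: "smooth_on S X" "smooth_on S Y"
  shows "smooth_on S (\<lambda>y. B y (X y) (Y y))"
  by (rule smooth_on_linear_family[OF _ smooth_on_linear_family[OF _ sm X(2)] X(1)])
    (use B in \<open>auto simp: bilinear_def\<close>)

lemma smooth_on_Dh_field:
  assumes "hopen S" "smooth_on S f" "smooth_on S X"
  shows "smooth_on S (\<lambda>y. Dh f y (X y))"
  by (rule smooth_on_linear_family[OF smooth_on_Dh_linear[OF assms(1,2)] smooth_on_Dh[OF assms(1,2)] assms(3)])

lemma normal_quotient_derivative:
  fixes f :: "'a::euclidean_space \<Rightarrow> 'b::banach"
  assumes S: "hopen S" and f: "smooth_on S f" and zero: "\<And>x. x \<in> S \<Longrightarrow> x \<bullet> normal_dir = 0 \<Longrightarrow> f x = 0"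
    and x: "x \<in> S" "x \<bullet> normal_dir = 0"
  shows "Dh f x v = (v \<bullet> normal_dir) *\<^sub>R normal_quotient f x"
proof -
  let ?q = "normal_quotient f"
  have "((\<lambda>x. (x \<bullet> normal_dir) *\<^sub>R ?q x) has_derivative
      (\<lambda>v. (x \<bullet> normal_dir) *\<^sub>R Dh ?q x v + (v \<bullet> normal_dir) *\<^sub>R ?q x)) (at x within half_space)"
    by (intro has_derivative_scaleR has_derivative_inner_left has_derivative_ident
        smooth_on_D[OF S smooth_on_normal_quotient[OF S f zero] x(1)])
  then have "(f has_derivative (\<lambda>v. (x \<bullet> normal_dir) *\<^sub>R Dh ?q x v + (v \<bullet> normal_dir) *\<^sub>R ?q x)) (at x within half_space)"
    by (rule has_derivative_cong_hopen[OF S x(1), rotated]) (rule normal_quotient_eq[OF zero, symmetric])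
  from fun_cong[OF Dh_eq[OF this hopen_half[OF S x(1)]], of v] show ?thesis using x by simp
qed

context boundary_atlas begin

lemma image_boundary_iff:
  assumes "c \<in> A" "x \<in> cmap c ` (U \<inter> cdom c)"
  shows "cinv c x \<in> mfd_boundary A \<longleftrightarrow> x \<bullet> normal_dir = 0"
  using assms boundary_iff[OF assms(1)] by auto

lemma image_interior_iff:
  assumes "c \<in> A" "x \<in> cmap c ` (U \<inter> cdom c)"
  shows "cinv c x \<in> mfd_interior A \<longleftrightarrow> x \<bullet> normal_dir > 0"
  using assms interior_iff[OF assms(1)] by auto

text \<open>Extensions in the individual charts glue: on overlaps they agree at interior points, hence by
  continuity also at boundary points.\<close>

lemma fun_smooth_up_to_boundaryI:
  assumes U: "open U" and loc: "\<And>c. c \<in> A \<Longrightarrow>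
    \<exists>q::'a \<Rightarrow> real. smooth_on (cmap c ` (U \<inter> cdom c)) q \<and> (\<forall>p\<in>U \<inter> mfd_interior A \<inter> cdom c. f p = q (cmap c p))"
  shows "fun_smooth_up_to_boundary A U f"
proof -
  have "\<forall>c\<in>A. \<exists>q::'a \<Rightarrow> real. smooth_on (cmap c ` (U \<inter> cdom c)) q \<and> (\<forall>p\<in>U \<inter> mfd_interior A \<inter> cdom c. f p = q (cmap c p))"
    using loc by blast
  from bchoice[OF this] obtain q :: "('m, 'a) chart \<Rightarrow> 'a \<Rightarrow> real" where
    q: "\<And>c. c \<in> A \<Longrightarrow> smooth_on (cmap c ` (U \<inter> cdom c)) (q c)"
    and eq: "\<And>c p. c \<in> A \<Longrightarrow> p \<in> U \<Longrightarrow> p \<in> mfd_interior A \<Longrightarrow> p \<in> cdom c \<Longrightarrow> f p = q c (cmap c p)"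
    by fast
  define F where "F p = q (chart_at A p) (cmap (chart_at A p) p)" for p
  have F: "F p = q c (cmap c p)" if c: "c \<in> A" "p \<in> cdom c" "p \<in> U" for c p
  proof -
    let ?d = "chart_at A p"
    have d: "?d \<in> A" "p \<in> cdom ?d" using chart_at_mem by auto
    let ?S = "cmap c ` ((U \<inter> cdom ?d) \<inter> cdom c)"
    have S: "hopen ?S" "cmap c p \<in> ?S"
      using c d U chart_open[OF d(1)] by (auto intro!: image_hopen)
    have tr: "cmap ?d (cinv c y) \<in> cmap ?d ` (U \<inter> cdom ?d)" if "y \<in> ?S" for y using that c(1) by auto
    have s1: "smooth_on ?S (\<lambda>y. q ?d (cmap ?d (cinv c y)))"
      by (rule smooth_on_compose[OF q[OF d(1)] smooth_on_subset[OF transition_smooth[OF c(1) d(1)]] tr]) auto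
    have s2: "smooth_on ?S (q c)" by (rule smooth_on_subset[OF q[OF c(1)]]) auto
    have "q ?d (cmap ?d (cinv c (cmap c p))) = q c (cmap c p)"
    proof (rule eq_at_boundary_by_continuity[OF S(1) smooth_on_continuous[OF s1] smooth_on_continuous[OF s2] _ S(2)])
      fix y assume y: "y \<in> ?S" "y \<bullet> normal_dir > 0"
      then have "cinv c y \<in> mfd_interior A" using image_interior_iff[OF c(1) y(1)] by simp
      then show "q ?d (cmap ?d (cinv c y)) = q c y"
        using y c(1) eq[OF d(1), of "cinv c y"] eq[OF c(1), of "cinv c y"] by auto
    qed
    then show ?thesis using c by (simp add: F_def)
  qed
  have "smooth_fun A U F"
    unfolding smooth_fun_def o_def
  proof
    fix c assume c: "c \<in> A"
    show "smooth_on (cmap c ` (U \<inter> cdom c)) (\<lambda>x. F (cinv c x))"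
      by (rule smooth_on_cong[OF q[OF c]]) (use F[OF c] c in auto)
  qed
  moreover have "F p = f p" if "p \<in> U \<inter> mfd_interior A" for p
    using that F[of "chart_at A p" p] eq[of "chart_at A p" p] chart_at_mem by auto
  ultimately show ?thesis unfolding fun_smooth_up_to_boundary_def by blast
qed

text \<open>The gluing argument for fields, where the extensions are compared by means of the Jacobian.\<close>

lemma field_smooth_up_to_boundaryI:
  assumes U: "open U" and loc: "\<And>c. c \<in> A \<Longrightarrow>
    \<exists>q::'a \<Rightarrow> 'a. smooth_on (cmap c ` (U \<inter> cdom c)) q \<and>
      (\<forall>p\<in>U \<inter> mfd_interior A \<inter> cdom c. components A c p (\<xi> p) = q (cmap c p))"
  shows "field_smooth_up_to_boundary A U \<xi>"
proof -
  have "\<forall>c\<in>A. \<exists>q::'a \<Rightarrow> 'a. smooth_on (cmap c ` (U \<inter> cdom c)) q \<and>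
      (\<forall>p\<in>U \<inter> mfd_interior A \<inter> cdom c. components A c p (\<xi> p) = q (cmap c p))"
    using loc by blast
  from bchoice[OF this] obtain q :: "('m, 'a) chart \<Rightarrow> 'a \<Rightarrow> 'a" where
    q: "\<And>c. c \<in> A \<Longrightarrow> smooth_on (cmap c ` (U \<inter> cdom c)) (q c)"
    and eq: "\<And>c p. c \<in> A \<Longrightarrow> p \<in> U \<Longrightarrow> p \<in> mfd_interior A \<Longrightarrow> p \<in> cdom c \<Longrightarrow>
       components A c p (\<xi> p) = q c (cmap c p)"
    by fast
  define \<zeta> where "\<zeta> p = q (chart_at A p) (cmap (chart_at A p) p)" for p
  have \<zeta>: "components A c p (\<zeta> p) = q c (cmap c p)" if c: "c \<in> A" "p \<in> cdom c" "p \<in> U" for c p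
  proof -
    let ?d = "chart_at A p"
    have d: "?d \<in> A" "p \<in> cdom ?d" using chart_at_mem by auto
    let ?S = "cmap c ` ((U \<inter> cdom ?d) \<inter> cdom c)"
    let ?t = "\<lambda>y. cmap ?d (cinv c y)"
    have S: "hopen ?S" "cmap c p \<in> ?S"
      using c d U chart_open[OF d(1)] by (auto intro!: image_hopen)
    have tr: "?t y \<in> cmap ?d ` (U \<inter> cdom ?d)" "?t y \<in> cmap ?d ` (cdom c \<inter> cdom ?d)" if "y \<in> ?S" for y
      using that c(1) by auto
    have sm: "smooth_on ?S ?t" by (rule smooth_on_subset[OF transition_smooth[OF c(1) d(1)]]) auto
    have s1: "smooth_on ?S (\<lambda>y. jacobian ?d c (cinv ?d (?t y)) (q ?d (?t y)))"
    proof (rule smooth_on_linear_family[where L="\<lambda>y. jacobian ?d c (cinv ?d (?t y))" and X="\<lambda>y. q ?d (?t y)"])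
      show "linear (jacobian ?d c (cinv ?d (?t y)))" if "y \<in> ?S" for y
        using that c(1) d(1) by (auto intro!: jacobian_linear)
      show "smooth_on ?S (\<lambda>y. jacobian ?d c (cinv ?d (?t y)) u)" for u
        by (rule smooth_on_compose[OF jacobian_smooth[OF d(1) c(1)] sm tr(2)])
      show "smooth_on ?S (\<lambda>y. q ?d (?t y))"
        by (rule smooth_on_compose[OF q[OF d(1)] sm tr(1)])
    qed
    have s2: "smooth_on ?S (q c)" by (rule smooth_on_subset[OF q[OF c(1)]]) auto
    have "jacobian ?d c (cinv ?d (?t (cmap c p))) (q ?d (?t (cmap c p))) = q c (cmap c p)"
    proof (rule eq_at_boundary_by_continuity[OF S(1) smooth_on_continuous[OF s1] smooth_on_continuous[OF s2] _ S(2)])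
      fix y assume y: "y \<in> ?S" "y \<bullet> normal_dir > 0"
      then obtain p' where p': "p' \<in> U" "p' \<in> cdom ?d" "p' \<in> cdom c" "y = cmap c p'" by auto
      then have "p' \<in> mfd_interior A" using image_interior_iff[OF c(1) y(1)] y c(1) by simp
      then show "jacobian ?d c (cinv ?d (?t y)) (q ?d (?t y)) = q c y"
        using p' c(1) d(1) eq[OF d(1) p'(1) _ p'(2)] eq[OF c(1) p'(1) _ p'(3)] components_change[OF d(1) c(1) p'(2,3), of "\<xi> p'"]
        by simp
    qed
    then show ?thesis using c d components_change[OF d(1) c(1) d(2) c(2), of "\<zeta> p"] by (simp add: \<zeta>_def)
  qed
  have "vector_field A U \<zeta>"
    unfolding vector_field_def
  proof
    fix c assume c: "c \<in> A"
    show "smooth_on (cmap c ` (U \<inter> cdom c)) (local_rep A c \<zeta>)"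
      by (rule smooth_on_cong[OF q[OF c]]) (use \<zeta>[OF c] c in \<open>auto simp: local_rep_def\<close>)
  qed
  moreover have "\<zeta> p = \<xi> p" if "p \<in> U \<inter> mfd_interior A" for p
    using that eq[of "chart_at A p" p] chart_at_mem unfolding \<zeta>_def by auto
  ultimately show ?thesis unfolding field_smooth_up_to_boundary_def by blast
qed

section \<open>Defining functions in a chart\<close>

lemma defining_function_subset: "defining_function A U \<rho> \<Longrightarrow> V \<subseteq> U \<Longrightarrow> defining_function A V \<rho>"
  unfolding defining_function_def using smooth_fun_subset by blast

lemma defining_function_zero_iff:
  "defining_function A U \<rho> \<Longrightarrow> p \<in> U \<Longrightarrow> \<rho> p = 0 \<longleftrightarrow> p \<in> mfd_boundary A"
  unfolding defining_function_def by blast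

text \<open>In a chart, a defining function is the normal coordinate times a nowhere vanishing smooth
  function. At boundary points the value of this factor is the normal derivative, and it is
  non-zero because the differential is.\<close>

lemma defining_function_in_chart:
  assumes \<rho>: "defining_function A U \<rho>" and U: "open U" and c: "c \<in> A"
  defines "S \<equiv> cmap c ` (U \<inter> cdom c)" and "r \<equiv> \<lambda>x. \<rho> (cinv c x)"
  shows "smooth_on S r"
    and "x \<in> S \<Longrightarrow> r x = 0 \<longleftrightarrow> x \<bullet> normal_dir = 0"
    and "smooth_on S (normal_quotient r)"
    and "x \<in> S \<Longrightarrow> r x = (x \<bullet> normal_dir) * normal_quotient r x"
    and "x \<in> S \<Longrightarrow> x \<bullet> normal_dir = 0 \<Longrightarrow> Dh r x v = (v \<bullet> normal_dir) * normal_quotient r x"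
    and "x \<in> S \<Longrightarrow> normal_quotient r x \<noteq> 0"
proof -
  have sf: "smooth_fun A U \<rho>" using \<rho> unfolding defining_function_def by blast
  have S: "hopen S" unfolding S_def by (rule image_hopen[OF c U])
  show sm: "smooth_on S r" unfolding S_def r_def by (rule smooth_fun_in_chart[OF sf c])
  show z: "r x = 0 \<longleftrightarrow> x \<bullet> normal_dir = 0" if "x \<in> S" for x
    using that c defining_function_zero_iff[OF \<rho>] boundary_iff[OF c] by (auto simp: S_def r_def)
  show "smooth_on S (normal_quotient r)" by (rule smooth_on_normal_quotient[OF S sm]) (use z in auto)
  show mult: "r x = (x \<bullet> normal_dir) * normal_quotient r x" if "x \<in> S" for x
    using normal_quotient_eq[of x r] z[OF that] by simp
  show D: "Dh r x v = (v \<bullet> normal_dir) * normal_quotient r x" if "x \<in> S" "x \<bullet> normal_dir = 0" for x v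
    using normal_quotient_derivative[OF S sm _ that, of v] z by simp
  show "normal_quotient r x \<noteq> 0" if x: "x \<in> S" for x
  proof (cases "x \<bullet> normal_dir = 0")
    case True
    obtain p where p: "p \<in> U" "p \<in> cdom c" "x = cmap c p" using x by (auto simp: S_def)
    then have "p \<in> U \<inter> mfd_boundary A" using boundary_iff[OF c] True by auto
    then obtain v where "differential A \<rho> p v \<noteq> 0" using \<rho> unfolding defining_function_def by blast
    then show ?thesis
      using differential_in_chart[OF c p(2) U p(1) sf] D[OF x True] p by (auto simp: r_def)
  next
    case False
    then show ?thesis using mult[OF x] z[OF x] by auto
  qed
qed

text \<open>In every chart, vanishing of the normal component means that \<open>v\<close> lies in the kernel of the
  differential of \<open>\<rho>\<close>.\<close>

lemma boundary_tangent_iff: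
  assumes \<rho>: "defining_function A UNIV \<rho>" and c: "c \<in> A" "p \<in> cdom c" and p: "p \<in> mfd_boundary A"
  shows "v \<in> boundary_tangent A p \<longleftrightarrow> components A c p v \<bullet> normal_dir = 0"
proof -
  have "components A d p v \<bullet> normal_dir = 0 \<longleftrightarrow> differential A \<rho> p v = 0" if d: "d \<in> A" "p \<in> cdom d" for d
  proof -
    have x: "cmap d p \<in> cmap d ` (UNIV \<inter> cdom d)" "cmap d p \<bullet> normal_dir = 0" using d p boundary_iff by auto
    have "smooth_fun A UNIV \<rho>" using \<rho> unfolding defining_function_def by blast
    from differential_in_chart[OF d open_UNIV UNIV_I this]
    show ?thesis
      using defining_function_in_chart(5,6)[OF \<rho> open_UNIV d(1) x(1)] x(2) by simp
  qed
  then show ?thesis unfolding boundary_tangent_def using c by blast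
qed

end

section \<open>Metrics in asymptotic form\<close>

lemma sum_inner_Basis_scaleR:
  fixes f :: "'a::euclidean_space \<Rightarrow> 'b::real_vector"
  assumes "j \<in> Basis" shows "(\<Sum>b\<in>Basis. (j \<bullet> b) *\<^sub>R f b) = f j"
proof -
  have "(\<Sum>b\<in>Basis. (j \<bullet> b) *\<^sub>R f b) = (\<Sum>b\<in>Basis. if b = j then f j else 0)"
    using assms by (intro sum.cong) (auto simp: inner_Basis)
  then show ?thesis using assms by simp
qed

locale asymptotic_metric = levi_civita_metric A g nabla
  for A :: "('m::{t2_space, second_countable_topology}, 'a::euclidean_space) chart set"
    and g :: "'m \<Rightarrow> 'a \<Rightarrow> 'a \<Rightarrow> real"
    and nabla :: "('m \<Rightarrow> 'a) \<Rightarrow> ('m \<Rightarrow> 'a) \<Rightarrow> 'm \<Rightarrow> 'a" +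
  fixes \<rho> C :: "'m \<Rightarrow> real" and h :: "'m \<Rightarrow> 'a \<Rightarrow> 'a \<Rightarrow> real" and s :: real
  assumes defining: "defining_function A UNIV \<rho>"
    and C_smooth: "smooth_fun A UNIV C"
    and C_boundary: "big_O_boundary A UNIV \<rho> 1 (\<lambda>p. C p - s)"
    and h_form: "symmetric_form_field A UNIV h"
    and h_boundary: "\<forall>p\<in>mfd_boundary A. nondegenerate_on (boundary_tangent A p) (h p)"
    and asymptotic: "\<forall>p\<in>mfd_interior A. \<forall>u v.
      g p u v = C p / \<rho> p ^ 4 * (differential A \<rho> p u * differential A \<rho> p v) + h p u v / (\<rho> p)\<^sup>2"
begin

lemma rho_smooth: "smooth_fun A UNIV \<rho>"
  using defining unfolding defining_function_def by blast

lemma h_bilinear: "bilinear (h p)" and h_sym: "h p u v = h p v u"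
  and h_bilinear_form: "bilinear_form_field A UNIV h"
  using h_form unfolding symmetric_form_field_def bilinear_form_field_def by blast+

definition rho_chart :: "('m, 'a) chart \<Rightarrow> 'a \<Rightarrow> real" where "rho_chart c x = \<rho> (cinv c x)"
definition C_chart :: "('m, 'a) chart \<Rightarrow> 'a \<Rightarrow> real" where "C_chart c x = C (cinv c x)"
definition hessian_rho :: "('m, 'a) chart \<Rightarrow> 'a \<Rightarrow> 'a \<Rightarrow> 'a \<Rightarrow> real" where
  "hessian_rho c x u v = Dh (\<lambda>y. Dh (rho_chart c) y u) x v"

text \<open>Twice the Christoffel symbol of the first kind of \<open>h\<close>.\<close>
definition koszul_h :: "('m, 'a) chart \<Rightarrow> 'a \<Rightarrow> 'a \<Rightarrow> 'a \<Rightarrow> 'a \<Rightarrow> real" where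
  "koszul_h c x u v w = Dh (\<lambda>y. form_rep c h y v w) x u + Dh (\<lambda>y. form_rep c h y u w) x v
     - Dh (\<lambda>y. form_rep c h y u v) x w"

lemmas rho_in_chart = defining_function_in_chart[OF defining open_UNIV, folded rho_chart_def, simplified]

lemma rho_chart_smooth: "c \<in> A \<Longrightarrow> smooth_on (cmap c ` cdom c) (rho_chart c)"
  using smooth_fun_in_chart[OF rho_smooth] unfolding rho_chart_def by fastforce

lemma C_chart_smooth: "c \<in> A \<Longrightarrow> smooth_on (cmap c ` cdom c) (C_chart c)"
  using smooth_fun_in_chart[OF C_smooth] unfolding C_chart_def by fastforce

lemma h_chart_smooth: "c \<in> A \<Longrightarrow> smooth_on (cmap c ` cdom c) (\<lambda>x. form_rep c h x u v)"
  using form_rep_smooth[OF h_bilinear_form] by fastforce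

lemma h_chart_bilinear: "c \<in> A \<Longrightarrow> x \<in> cmap c ` cdom c \<Longrightarrow> bilinear (form_rep c h x)"
  by (auto intro: form_rep_bilinear[where b=h] h_bilinear)

lemma rho_chart_nonzero:
  assumes "c \<in> A" "p \<in> cdom c" "p \<in> mfd_interior A" shows "rho_chart c (cmap c p) \<noteq> 0"
  using defining_function_zero_iff[OF defining, of p] assms by (simp add: rho_chart_def mfd_interior_def)

lemma asymptotic_in_chart:
  assumes c: "c \<in> A" and y: "y \<in> cmap c ` (mfd_interior A \<inter> cdom c)"
  shows "rho_chart c y ^ 4 * form_rep c g y u v =
    C_chart c y * (Dh (rho_chart c) y u * Dh (rho_chart c) y v) + (rho_chart c y)\<^sup>2 * form_rep c h y u v"
proof -
  obtain p where p: "p \<in> mfd_interior A" "p \<in> cdom c" "y = cmap c p" using y by auto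
  have d: "differential A \<rho> p (coord_field A c u p) = Dh (rho_chart c) y u" for u
    using differential_in_chart[OF c p(2) open_UNIV UNIV_I rho_smooth] c p by (simp add: rho_chart_def[abs_def])
  have r: "\<rho> p \<noteq> 0" using rho_chart_nonzero[OF c p(2,1)] c p by (simp add: rho_chart_def)
  have "form_rep c g y u v = C p / \<rho> p ^ 4 * (Dh (rho_chart c) y u * Dh (rho_chart c) y v) + form_rep c h y u v / (\<rho> p)\<^sup>2"
    unfolding d[symmetric] using asymptotic p c by (simp add: form_rep_def)
  then show ?thesis using r c p
    by (simp add: rho_chart_def C_chart_def field_simps power2_eq_square power4_eq_xxxx)
qed

text \<open>The two sides of \<open>asymptotic_in_chart\<close>, both free of quotients, are differentiated.\<close>

lemma rescaled_metric_derivative: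
  assumes c: "c \<in> A" "p \<in> cdom c" "p \<in> mfd_interior A"
  defines "x \<equiv> cmap c p" and "r \<equiv> rho_chart c" and "K \<equiv> C_chart c" and "H \<equiv> form_rep c h" and "G \<equiv> form_rep c g"
  shows "r x ^ 4 * Dh (\<lambda>y. G y v w) x u = Dh K x u * (Dh r x v * Dh r x w)
      + K x * (hessian_rho c x v u * Dh r x w + Dh r x v * hessian_rho c x w u)
      + 2 * r x * Dh r x u * H x v w + (r x)\<^sup>2 * Dh (\<lambda>y. H y v w) x u
      - 4 * r x ^ 3 * Dh r x u * G x v w"
proof -
  let ?S = "cmap c ` (mfd_interior A \<inter> cdom c)" and ?T = "cmap c ` cdom c"
  have S: "hopen ?S" "x \<in> ?S" using interior_image[OF c(1)] c by (auto simp: x_def)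
  have T: "hopen ?T" "x \<in> ?T" using chart_image_hopen[OF c(1)] c by (auto simp: x_def)
  have xh: "x \<in> half_space" using hopen_half[OF S] .
  have dr: "(r has_derivative Dh r x) (at x within half_space)"
    unfolding r_def by (rule smooth_on_D[OF T(1) rho_chart_smooth[OF c(1)] T(2)])
  have ddr: "((\<lambda>y. Dh r y a) has_derivative hessian_rho c x a) (at x within half_space)" for a
    unfolding r_def hessian_rho_def
    by (rule smooth_on_D[OF T(1) smooth_on_Dh[OF T(1) rho_chart_smooth[OF c(1)]] T(2)])
  have dK: "(K has_derivative Dh K x) (at x within half_space)"
    unfolding K_def by (rule smooth_on_D[OF T(1) C_chart_smooth[OF c(1)] T(2)])
  have dH: "((\<lambda>y. H y v w) has_derivative Dh (\<lambda>y. H y v w) x) (at x within half_space)"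
    unfolding H_def by (rule smooth_on_D[OF T(1) h_chart_smooth[OF c(1)] T(2)])
  have bf: "bilinear_form_field A (mfd_interior A) g"
    using metric unfolding pseudo_riemannian_metric_def symmetric_form_field_def by blast
  have dG: "((\<lambda>y. G y v w) has_derivative Dh (\<lambda>y. G y v w) x) (at x within half_space)"
    unfolding G_def by (rule smooth_on_D[OF S(1) form_rep_smooth[OF bf c(1)] S(2)])
  have 1: "((\<lambda>y. r y ^ 4 * G y v w) has_derivative
      (\<lambda>u. r x ^ 4 * Dh (\<lambda>y. G y v w) x u + (4 * Dh r x u * r x ^ 3) * G x v w)) (at x within half_space)"
    using has_derivative_mult[OF has_derivative_power[OF dr, of 4] dG] by simp
  have "((\<lambda>y. K y * (Dh r y v * Dh r y w) + (r y)\<^sup>2 * H y v w) has_derivative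
      (\<lambda>u. (K x * (Dh r x v * hessian_rho c x w u + hessian_rho c x v u * Dh r x w) + Dh K x u * (Dh r x v * Dh r x w))
        + ((r x)\<^sup>2 * Dh (\<lambda>y. H y v w) x u + (2 * Dh r x u * r x) * H x v w))) (at x within half_space)"
    using has_derivative_add[OF has_derivative_mult[OF dK has_derivative_mult[OF ddr[of v] ddr[of w]]]
       has_derivative_mult[OF has_derivative_power[OF dr, of 2] dH]] by simp
  then have 2: "((\<lambda>y. r y ^ 4 * G y v w) has_derivative
      (\<lambda>u. (K x * (Dh r x v * hessian_rho c x w u + hessian_rho c x v u * Dh r x w) + Dh K x u * (Dh r x v * Dh r x w))
        + ((r x)\<^sup>2 * Dh (\<lambda>y. H y v w) x u + (2 * Dh r x u * r x) * H x v w))) (at x within half_space)"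
    by (rule has_derivative_cong_hopen[OF S, rotated])
      (simp add: asymptotic_in_chart[OF c(1)] r_def K_def H_def G_def)
  from fun_cong[OF half_space_derivative_unique[OF 1 2 xh], of u]
  show ?thesis by (simp add: algebra_simps)
qed

text \<open>The coordinate expression of \<open>\<nabla>\<^sup>\<rho>\<close> on constant fields.\<close>

definition nabla_rho_chart :: "('m, 'a) chart \<Rightarrow> 'a \<Rightarrow> 'a \<Rightarrow> 'a \<Rightarrow> 'a" where
  "nabla_rho_chart c x u v = christoffel c x u v + (Dh (rho_chart c) x u / rho_chart c x) *\<^sub>R v
     + (Dh (rho_chart c) x v / rho_chart c x) *\<^sub>R u"

text \<open>The central identity. Of the terms of the Koszul formula in which a derivative falls on a power of
  \<open>\<rho>\<close>, only the one with \<open>\<rho>\<^sub>w h(u,v)\<close> survives the correction in \<open>\<nabla>\<^sup>\<rho>\<close>, and the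
  right-hand side is smooth up to the boundary.\<close>

lemma rescaled_koszul:
  assumes c: "c \<in> A" "p \<in> cdom c" "p \<in> mfd_interior A"
  defines "x \<equiv> cmap c p" and "r \<equiv> rho_chart c" and "K \<equiv> C_chart c" and "H \<equiv> form_rep c h"
  shows "2 * (K x * (Dh r x (nabla_rho_chart c x u v) * Dh r x w) + (r x)\<^sup>2 * H x (nabla_rho_chart c x u v) w) =
    Dh K x u * (Dh r x v * Dh r x w) + Dh K x v * (Dh r x u * Dh r x w) - Dh K x w * (Dh r x u * Dh r x v)
    + 2 * K x * hessian_rho c x u v * Dh r x w + (r x)\<^sup>2 * koszul_h c x u v w + 2 * r x * Dh r x w * H x u v"
proof -
  let ?T = "cmap c ` cdom c" and ?S = "cmap c ` (mfd_interior A \<inter> cdom c)" and ?G = "form_rep c g x" and ?\<Gamma> = "christoffel c x u v"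
  have T: "hopen ?T" "x \<in> ?T" using chart_image_hopen[OF c(1)] c by (auto simp: x_def)
  have xS: "x \<in> ?S" using c by (auto simp: x_def)
  have pos: "x \<bullet> normal_dir > 0" using interior_iff[OF c(1,2)] c(3) by (simp add: x_def)
  have r0: "r x \<noteq> 0" unfolding r_def x_def by (rule rho_chart_nonzero[OF c])
  have sym: "hessian_rho c x a b = hessian_rho c x b a" for a b
    unfolding hessian_rho_def by (rule Dh_Dh_symmetric[OF T(1) rho_chart_smooth[OF c(1)] T(2) pos])
  have blG: "bilinear ?G" unfolding x_def by (rule form_rep_bilinear[where b=g, OF c(1,2) metric_bilinear[OF c(3)]])
  have Hs: "H x a b = H x b a" for a b unfolding H_def form_rep_def by (rule h_sym)
  have G: "r x ^ 4 * ?G a b = K x * (Dh r x a * Dh r x b) + (r x)\<^sup>2 * H x a b" for a b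
    unfolding r_def K_def H_def by (rule asymptotic_in_chart[OF c(1) xS])
  note D = rescaled_metric_derivative[OF c, folded x_def r_def K_def H_def]
  \<comment> \<open>one more factor \<open>r\<close> than in the claim, because \<open>\<nabla>\<^sup>\<rho>\<close> contains \<open>d\<rho>/\<rho>\<close>; it is cancelled at the end\<close>
  have "2 * (r x ^ 4 * ?G ?\<Gamma> w) = r x ^ 4 * Dh (\<lambda>y. form_rep c g y v w) x u + r x ^ 4 * Dh (\<lambda>y. form_rep c g y u w) x v
      - r x ^ 4 * Dh (\<lambda>y. form_rep c g y u v) x w"
    using arg_cong[OF koszul_in_chart[OF c, folded x_def, of u v w], of "\<lambda>t. r x ^ 4 * t"] by (simp add: algebra_simps)
  note e0 = this[unfolded D]
  have "2 * r x * (r x ^ 4 * ?G ?\<Gamma> w) = r x * (2 * (r x ^ 4 * ?G ?\<Gamma> w))" by simp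
  also note e0
  finally have k: "2 * r x * (r x ^ 4 * ?G ?\<Gamma> w) = r x * (Dh K x u * (Dh r x v * Dh r x w) + Dh K x v * (Dh r x u * Dh r x w) - Dh K x w * (Dh r x u * Dh r x v)
      + 2 * K x * hessian_rho c x u v * Dh r x w + (r x)\<^sup>2 * koszul_h c x u v w
      + 2 * r x * (Dh r x u * H x v w + Dh r x v * H x u w - Dh r x w * H x u v))
      - 4 * (Dh r x u * (r x ^ 4 * ?G v w) + Dh r x v * (r x ^ 4 * ?G u w) - Dh r x w * (r x ^ 4 * ?G u v))"
    unfolding koszul_h_def H_def[symmetric] sym[of v u] sym[of w u] sym[of w v]
    by (simp add: algebra_simps power4_eq_xxxx power3_eq_cube power2_eq_square)
  have "r x * (r x ^ 4 * ?G (nabla_rho_chart c x u v) w) =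
      r x * (r x ^ 4 * ?G ?\<Gamma> w) + Dh r x u * (r x ^ 4 * ?G v w) + Dh r x v * (r x ^ 4 * ?G u w)"
    unfolding nabla_rho_chart_def bilinear_ladd[OF blG] bilinear_lmul[OF blG] r_def[symmetric]
    using r0 by (simp add: field_simps)
  then have "r x * (2 * (r x ^ 4 * ?G (nabla_rho_chart c x u v) w)) =
     r x * (Dh K x u * (Dh r x v * Dh r x w) + Dh K x v * (Dh r x u * Dh r x w) - Dh K x w * (Dh r x u * Dh r x v)
      + 2 * K x * hessian_rho c x u v * Dh r x w + (r x)\<^sup>2 * koszul_h c x u v w + 2 * r x * Dh r x w * H x u v)"
    using k unfolding G by (simp add: algebra_simps power2_eq_square)
  from this[unfolded G] r0 show ?thesis by (simp only: mult_cancel_left simp_thms)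
qed

lemma nabla_rho_in_chart:
  assumes c: "c \<in> A" and U: "open U" "p \<in> U" "p \<in> mfd_interior A" "p \<in> cdom c"
    and \<sigma>: "smooth_fun A U \<sigma>" and vf: "vector_field A U \<xi>" "vector_field A U \<eta>"
  defines "x \<equiv> cmap c p" and "t \<equiv> \<lambda>y. \<sigma> (cinv c y)"
  shows "components A c p (nabla_rho A nabla \<sigma> \<xi> \<eta> p) =
     Dh (local_rep A c \<eta>) x (local_rep A c \<xi> x) + christoffel c x (local_rep A c \<xi> x) (local_rep A c \<eta> x)
     + (Dh t x (local_rep A c \<xi> x) / t x) *\<^sub>R local_rep A c \<eta> x
     + (Dh t x (local_rep A c \<eta> x) / t x) *\<^sub>R local_rep A c \<xi> x"
proof -
  let ?U = "U \<inter> mfd_interior A \<inter> cdom c"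
  have U': "open ?U" "?U \<subseteq> mfd_interior A" "?U \<subseteq> cdom c" "p \<in> ?U"
    using U mfd_interior_open chart_open[OF c] by auto
  have vf': "vector_field A ?U \<xi>" "vector_field A ?U \<eta>" by (auto intro: vector_field_subset vf)
  have own: "local_rep A c X x = components A c p (X p)" for X using c U by (simp add: local_rep_def x_def)
  show ?thesis
    unfolding nabla_rho_def linear_add[OF components_linear[OF c U(4)]] linear_scale[OF components_linear[OF c U(4)]]
      nabla_in_chart[OF c U' vf'] differential_in_chart[OF c U(4) U(1,2) \<sigma>]
    using c U by (simp add: own[symmetric] x_def t_def)
qed

lemma C_expansion:
  obtains C\<^sub>1 where "smooth_fun A UNIV C\<^sub>1" "\<And>p. C p = s + \<rho> p * C\<^sub>1 p"
  using C_boundary unfolding big_O_boundary_def by (metis UNIV_I add.commute diff_eq_eq power_one_right)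

section \<open>Projective compactness forces \<open>C = s + O(\<rho>\<^sup>2)\<close>\<close>

text \<open>Projective compactness is applied to the coordinate fields on the chart domain, and the
  resulting extensions are combined bilinearly.\<close>

lemma nabla_rho_chart_extension:
  assumes comp: "projectively_compact A nabla" and c: "c \<in> A"
  obtains N where "\<And>x. bilinear (N x)" "\<And>u v. smooth_on (cmap c ` cdom c) (\<lambda>x. N x u v)"
    "\<And>p u v. p \<in> cdom c \<Longrightarrow> p \<in> mfd_interior A \<Longrightarrow> N (cmap c p) u v = nabla_rho_chart c (cmap c p) u v"
proof -
  let ?E = "coord_field A c" and ?T = "cmap c ` cdom c"
  have E: "vector_field A (cdom c) (?E v)" for v by (rule coord_field_vector_field[OF c]) auto
  have "\<exists>\<zeta>. vector_field A (cdom c) \<zeta> \<and> (\<forall>p\<in>cdom c \<inter> mfd_interior A. \<zeta> p = nabla_rho A nabla \<rho> (?E a) (?E b) p)" for a b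
    using comp defining_function_subset[OF defining, of "cdom c"] E chart_open[OF c]
    unfolding projectively_compact_def field_smooth_up_to_boundary_def by blast
  then obtain \<zeta> where \<zeta>: "\<And>a b. vector_field A (cdom c) (\<zeta> a b)"
    "\<And>a b p. p \<in> cdom c \<Longrightarrow> p \<in> mfd_interior A \<Longrightarrow> \<zeta> a b p = nabla_rho A nabla \<rho> (?E a) (?E b) p"
    by (metis IntI)
  define N where "N x u v = (\<Sum>a\<in>Basis. \<Sum>b\<in>Basis. ((u \<bullet> a) * (v \<bullet> b)) *\<^sub>R local_rep A c (\<zeta> a b) x)" for x u v
  have bl: "bilinear (N x)" for x
    unfolding bilinear_def N_def
    by (auto intro!: linearI simp: inner_add_left algebra_simps sum.distrib scaleR_sum_right)
  have sm: "smooth_on ?T (\<lambda>x. N x u v)" for u v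
    unfolding N_def using vector_field_in_chart[OF \<zeta>(1) c]
    by (intro smooth_on_sum smooth_on_scaleR smooth_on_const) simp
  have "N (cmap c p) = nabla_rho_chart c (cmap c p)" if p: "p \<in> cdom c" "p \<in> mfd_interior A" for p
  proof (rule bilinear_eq_stdbasis[OF bl])
    have "linear (Dh (rho_chart c) (cmap c p))"
      by (rule smooth_on_Dh_linear[OF chart_image_hopen[OF c] rho_chart_smooth[OF c]]) (use p in auto)
    then show "bilinear (nabla_rho_chart c (cmap c p))"
      unfolding bilinear_def[of "nabla_rho_chart c (cmap c p)"] nabla_rho_chart_def
      by (auto intro!: linearI simp: linear_add linear_scale algebra_simps add_divide_distrib
        bilinear_ladd[OF christoffel_bilinear] bilinear_radd[OF christoffel_bilinear]
        bilinear_lmul[OF christoffel_bilinear] bilinear_rmul[OF christoffel_bilinear])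
    fix i j :: 'a assume ij: "i \<in> Basis" "j \<in> Basis"
    have "N (cmap c p) i j = (\<Sum>a\<in>Basis. (i \<bullet> a) *\<^sub>R (\<Sum>b\<in>Basis. (j \<bullet> b) *\<^sub>R local_rep A c (\<zeta> a b) (cmap c p)))"
      by (simp add: N_def scaleR_sum_right)
    also have "\<dots> = local_rep A c (\<zeta> i j) (cmap c p)" using ij by (simp add: sum_inner_Basis_scaleR)
    also have "\<dots> = components A c p (nabla_rho A nabla \<rho> (?E i) (?E j) p)"
      using \<zeta>(2)[OF p] c p by (simp add: local_rep_def)
    also have "\<dots> = nabla_rho_chart c (cmap c p) i j"
      unfolding nabla_rho_in_chart[OF c chart_open[OF c] p(1,2,1) smooth_fun_subset[OF rho_smooth subset_UNIV] E E]
        nabla_rho_chart_def using c p by (simp add: local_rep_coord_field_Dh rho_chart_def[abs_def])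
    finally show "N (cmap c p) i j = nabla_rho_chart c (cmap c p) i j" .
  qed
  then show ?thesis using that[of N] bl sm by metis
qed

text \<open>The only place where the Ricci curvature enters. At interior points
  \<open>\<rho> (Ric(u,v) - Ric\<^sup>N(u,v)) = (n - 1)(\<rho>\<^sub>u\<^sub>v - d\<rho>(N(u,v)))\<close>. Both sides are continuous up to the
  boundary, where the left-hand side vanishes.\<close>

lemma hessian_at_boundary:
  assumes dim: "DIM('a) \<ge> 2"
    and ric: "bilinear_form_field A UNIV Ric" "\<And>p. p \<in> mfd_interior A \<Longrightarrow> Ric p = ricci A nabla p"
    and c: "c \<in> A" "p \<in> cdom c" "p \<in> mfd_boundary A"
    and N: "\<And>x. bilinear (N x)" "\<And>u v. smooth_on (cmap c ` cdom c) (\<lambda>x. N x u v)"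
      "\<And>p u v. p \<in> cdom c \<Longrightarrow> p \<in> mfd_interior A \<Longrightarrow> N (cmap c p) u v = nabla_rho_chart c (cmap c p) u v"
  shows "hessian_rho c (cmap c p) u v = Dh (rho_chart c) (cmap c p) (N (cmap c p) u v)"
proof -
  let ?T = "cmap c ` cdom c" and ?r = "rho_chart c"
  define \<beta> where "\<beta> y u v = hessian_rho c y u v - Dh ?r y (N y u v)" for y u v
  have T: "hopen ?T" using chart_image_hopen[OF c(1)] .
  have sr: "smooth_on ?T ?r" by (rule rho_chart_smooth[OF c(1)])
  have s\<beta>: "smooth_on ?T (\<lambda>y. \<beta> y u v)" for u v
  proof -
    have "smooth_on ?T (\<lambda>y. hessian_rho c y u v + (-1) *\<^sub>R Dh ?r y (N y u v))"
      unfolding hessian_rho_def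
      by (intro smooth_on_add smooth_on_scaleR smooth_on_const smooth_on_Dh smooth_on_Dh_field T sr N(2))
    then show ?thesis by (simp add: \<beta>_def)
  qed
  have cR: "continuous_on ?T (\<lambda>y. form_rep c Ric y u v)"
    using smooth_on_continuous[OF form_rep_smooth[OF ric(1) c(1)]] by simp
  have cC: "continuous_on ?T (\<lambda>y. \<Sum>w\<in>Basis. curvature_of N y w u v \<bullet> w)"
  proof -
    have NN: "smooth_on ?T (\<lambda>y. N y a (N y b d))" for a b d
      by (rule smooth_on_bilinear_family[OF N(1) N(2) smooth_on_const N(2)])
    have "continuous_on ?T (\<lambda>y. curvature_of N y w u v)" for w
      unfolding curvature_of_def
      by (intro continuous_intros smooth_on_continuous[OF smooth_on_Dh[OF T N(2)]] smooth_on_continuous[OF NN])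
    then show ?thesis by (intro continuous_intros)
  qed
  have "?r (cmap c p) * (form_rep c Ric (cmap c p) u v - (\<Sum>w\<in>Basis. curvature_of N (cmap c p) w u v \<bullet> w))
      = (real DIM('a) - 1) * \<beta> (cmap c p) u v"
  proof (rule eq_at_boundary_by_continuity[OF T, where f="\<lambda>y. ?r y * (form_rep c Ric y u v - (\<Sum>w\<in>Basis. curvature_of N y w u v \<bullet> w))"
        and g="\<lambda>y. (real DIM('a) - 1) * \<beta> y u v"])
    show "continuous_on ?T (\<lambda>y. ?r y * (form_rep c Ric y u v - (\<Sum>w\<in>Basis. curvature_of N y w u v \<bullet> w)))"
      by (intro continuous_intros smooth_on_continuous[OF sr] cR cC)
    show "continuous_on ?T (\<lambda>y. (real DIM('a) - 1) * \<beta> y u v)"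
      by (intro continuous_intros smooth_on_continuous[OF s\<beta>])
    show "cmap c p \<in> ?T" using c by auto
    fix y assume y: "y \<in> ?T" "y \<bullet> normal_dir > 0"
    then obtain q where q: "q \<in> cdom c" "y = cmap c q" "q \<in> mfd_interior A" using interior_iff[OF c(1)] by auto
    let ?S = "cmap c ` (mfd_interior A \<inter> cdom c)"
    have S: "hopen ?S" "y \<in> ?S" "?S \<subseteq> ?T" using interior_image[OF c(1)] q by auto
    have r0: "?r y \<noteq> 0" using rho_chart_nonzero[OF c(1) q(1,3)] q by simp
    have B: "christoffel c z a b = N z a b - (Dh ?r z a / ?r z) *\<^sub>R b - (Dh ?r z b / ?r z) *\<^sub>R a" if z: "z \<in> ?S" for z a b
    proof -
      obtain q' where "q' \<in> cdom c" "q' \<in> mfd_interior A" "z = cmap c q'" using z by auto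
      then show ?thesis using N(3)[of q' a b] by (simp add: nabla_rho_chart_def)
    qed
    have Nsym: "N y a b = N y b a" for a b
      using N(3)[OF q(1,3)] christoffel_symmetric[OF c(1) q(1,3)] unfolding nabla_rho_chart_def q(2) by (simp add: add_ac)
    have cur: "curvature_of (christoffel c) y w u v = curvature_of N y w u v + (\<beta> y u v / ?r y) *\<^sub>R w - (\<beta> y w v / ?r y) *\<^sub>R u" for w
      unfolding \<beta>_def hessian_rho_def
      by (rule projective_change_curvature[OF S(1,2) y(2) smooth_on_subset[OF sr S(3)] r0 N(1) smooth_on_subset[OF N(2) S(3)] Nsym B])
    have ddr: "((\<lambda>y. Dh ?r y a) has_derivative Dh (\<lambda>y. Dh ?r y a) y) (at y within half_space)" for a
      by (rule smooth_on_D[OF T smooth_on_Dh[OF T sr] y(1)])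
    have "linear (\<lambda>w. hessian_rho c y w v)"
      unfolding hessian_rho_def
      by (rule family_derivative_linear[OF T y(1) smooth_on_Dh_linear[OF T sr] ddr])
    moreover have "linear (\<lambda>w. Dh ?r y (N y w v))"
      using linear_compose[OF _ smooth_on_Dh_linear[OF T sr y(1)], of "\<lambda>w. N y w v"] N(1)[of y]
      by (simp add: bilinear_def o_def)
    ultimately have "linear (\<lambda>w. inverse (?r y) *\<^sub>R \<beta> y w v)"
      unfolding \<beta>_def by (intro linear_compose_scale_right linear_compose_sub)
    then have "linear (\<lambda>w. \<beta> y w v / ?r y)" by (simp add: divide_inverse mult.commute)
    from trace_projective_change[OF this, of u]
    have "(\<Sum>w\<in>Basis. curvature_of (christoffel c) y w u v \<bullet> w) - (\<Sum>w\<in>Basis. curvature_of N y w u v \<bullet> w)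
        = (real DIM('a) - 1) * (\<beta> y u v / ?r y)"
      unfolding cur by (simp add: inner_add_left inner_diff_left sum.distrib sum_subtractf algebra_simps)
    moreover have "form_rep c Ric y u v = (\<Sum>w\<in>Basis. curvature_of (christoffel c) y w u v \<bullet> w)"
      using ric(2)[OF q(3)] ricci_in_chart[OF c(1) q(1,3)] c q by (simp add: form_rep_def)
    ultimately show "?r y * (form_rep c Ric y u v - (\<Sum>w\<in>Basis. curvature_of N y w u v \<bullet> w)) = (real DIM('a) - 1) * \<beta> y u v"
      using r0 by simp
  qed
  moreover have "?r (cmap c p) = 0"
    using defining_function_zero_iff[OF defining] c by (simp add: rho_chart_def)
  ultimately have "(real DIM('a) - 1) * \<beta> (cmap c p) u v = 0" by simp
  then show ?thesis using dim by (simp add: \<beta>_def)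
qed

text \<open>The central identity for \<open>u = v = w\<close> equal to the normal coordinate vector. On the boundary
  the terms in \<open>C\<close> cancel by \<open>hessian_at_boundary\<close>, so that the normal derivative of \<open>C\<close> is zero;
  this derivative is \<open>C\<^sub>1\<close> times the normal derivative of \<open>\<rho>\<close>.\<close>

lemma C\<^sub>1_vanishes_at_boundary:
  assumes dim: "DIM('a) \<ge> 2" and comp: "projectively_compact A nabla"
    and ric: "bilinear_form_field A UNIV Ric" "\<And>p. p \<in> mfd_interior A \<Longrightarrow> Ric p = ricci A nabla p"
    and C1: "smooth_fun A UNIV C\<^sub>1" "\<And>p. C p = s + \<rho> p * C\<^sub>1 p"
    and p: "p \<in> mfd_boundary A"
  shows "C\<^sub>1 p = 0"
proof -
  let ?c = "chart_at A p" and ?n = "normal_dir :: 'a"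
  have c: "?c \<in> A" "p \<in> cdom ?c" using chart_at_mem by auto
  let ?T = "cmap ?c ` cdom ?c" and ?r = "rho_chart ?c" and ?K = "C_chart ?c" and ?x = "cmap ?c p"
  have T: "hopen ?T" "?x \<in> ?T" using chart_image_hopen[OF c(1)] c by auto
  obtain N where N: "\<And>x. bilinear (N x)" "\<And>u v. smooth_on ?T (\<lambda>x. N x u v)"
      "\<And>p u v. p \<in> cdom ?c \<Longrightarrow> p \<in> mfd_interior A \<Longrightarrow> N (cmap ?c p) u v = nabla_rho_chart ?c (cmap ?c p) u v"
    using nabla_rho_chart_extension[OF comp c(1)] by metis
  have sr: "smooth_on ?T ?r" by (rule rho_chart_smooth[OF c(1)])
  have sK: "smooth_on ?T ?K" by (rule C_chart_smooth[OF c(1)])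
  note cont = smooth_on_continuous[OF sr] smooth_on_continuous[OF sK]
    smooth_on_continuous[OF smooth_on_Dh[OF T(1) sr]] smooth_on_continuous[OF smooth_on_Dh[OF T(1) sK]]
    smooth_on_continuous[OF smooth_on_Dh_field[OF T(1) sr N(2)]]
    smooth_on_continuous[OF h_chart_smooth[OF c(1)]]
    smooth_on_continuous[OF smooth_on_Dh[OF T(1) h_chart_smooth[OF c(1)]]]
    smooth_on_continuous[OF smooth_on_Dh[OF T(1) smooth_on_Dh[OF T(1) sr]]]
    smooth_on_continuous[OF smooth_on_bilinear_family[OF h_chart_bilinear[OF c(1)] h_chart_smooth[OF c(1)] N(2) smooth_on_const]]
  let ?l = "\<lambda>y. 2 * (?K y * (Dh ?r y (N y ?n ?n) * Dh ?r y ?n) + (?r y)\<^sup>2 * form_rep ?c h y (N y ?n ?n) ?n)"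
  let ?rr = "\<lambda>y. Dh ?K y ?n * (Dh ?r y ?n * Dh ?r y ?n) + Dh ?K y ?n * (Dh ?r y ?n * Dh ?r y ?n) - Dh ?K y ?n * (Dh ?r y ?n * Dh ?r y ?n)
    + 2 * ?K y * hessian_rho ?c y ?n ?n * Dh ?r y ?n + (?r y)\<^sup>2 * koszul_h ?c y ?n ?n ?n + 2 * ?r y * Dh ?r y ?n * form_rep ?c h y ?n ?n"
  have "?l ?x = ?rr ?x"
  proof (rule eq_at_boundary_by_continuity[OF T(1) _ _ _ T(2), where f="?l" and g="?rr"])
    show "continuous_on ?T ?l" by (intro continuous_intros cont)
    show "continuous_on ?T ?rr" unfolding koszul_h_def hessian_rho_def by (intro continuous_intros cont)
    fix y assume y: "y \<in> ?T" "y \<bullet> normal_dir > 0"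
    then obtain q where q: "q \<in> cdom ?c" "y = cmap ?c q" "q \<in> mfd_interior A" using interior_iff[OF c(1)] by auto
    show "?l y = ?rr y" unfolding q(2) N(3)[OF q(1,3)] by (rule rescaled_koszul[OF c(1) q(1,3)])
  qed
  moreover have r0: "?r ?x = 0"
    using defining_function_zero_iff[OF defining] p c by (simp add: rho_chart_def)
  moreover have "hessian_rho ?c ?x ?n ?n = Dh ?r ?x (N ?x ?n ?n)"
    by (rule hessian_at_boundary[OF dim ric c p N])
  ultimately have K0: "Dh ?K ?x ?n * (Dh ?r ?x ?n * Dh ?r ?x ?n) = 0" by simp
  have xn: "?x \<bullet> ?n = 0" using boundary_iff[OF c] p by simp
  have rn: "Dh ?r ?x ?n \<noteq> 0"
    using rho_in_chart(5,6)[OF c(1) T(2)] xn by simp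
  have s1: "smooth_on ?T (\<lambda>x. C\<^sub>1 (cinv ?c x))" using smooth_fun_in_chart[OF C1(1) c(1)] by simp
  have hd: "((\<lambda>y. s + ?r y * C\<^sub>1 (cinv ?c y)) has_derivative
     (\<lambda>v. 0 + (?r ?x * Dh (\<lambda>x. C\<^sub>1 (cinv ?c x)) ?x v + Dh ?r ?x v * C\<^sub>1 (cinv ?c ?x)))) (at ?x within half_space)"
    by (intro has_derivative_add has_derivative_const has_derivative_mult smooth_on_D[OF T(1) sr T(2)] smooth_on_D[OF T(1) s1 T(2)])
  have Keq: "(\<lambda>y. s + ?r y * C\<^sub>1 (cinv ?c y)) = ?K" by (simp add: C_chart_def[abs_def] rho_chart_def[abs_def] C1(2))
  have "Dh ?K ?x = (\<lambda>v. 0 + (?r ?x * Dh (\<lambda>x. C\<^sub>1 (cinv ?c x)) ?x v + Dh ?r ?x v * C\<^sub>1 (cinv ?c ?x)))"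
    by (rule Dh_eq[OF hd[unfolded Keq] hopen_half[OF T]])
  then have "Dh ?K ?x ?n = Dh ?r ?x ?n * C\<^sub>1 p" using r0 c by simp
  then show ?thesis using K0 rn by simp
qed

lemma projectively_compact_imp_O2:
  assumes dim: "DIM('a) \<ge> 2" and comp: "projectively_compact A nabla"
    and ric: "bilinear_form_field A UNIV Ric" "\<And>p. p \<in> mfd_interior A \<Longrightarrow> Ric p = ricci A nabla p"
  shows "big_O_boundary A UNIV \<rho> 2 (\<lambda>p. C p - s)"
proof -
  obtain C\<^sub>1 where C1: "smooth_fun A UNIV C\<^sub>1" "\<And>p. C p = s + \<rho> p * C\<^sub>1 p" using C_expansion by metis
  have "fun_smooth_up_to_boundary A UNIV (\<lambda>p. C\<^sub>1 p / \<rho> p)"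
  proof (rule fun_smooth_up_to_boundaryI[OF open_UNIV])
    fix c assume c: "c \<in> A"
    let ?T = "cmap c ` (UNIV \<inter> cdom c)" and ?k = "\<lambda>x. C\<^sub>1 (cinv c x)"
    have T: "hopen ?T" using image_hopen[OF c open_UNIV] .
    have s1: "smooth_on ?T ?k" using smooth_fun_in_chart[OF C1(1) c] .
    have z: "?k x = 0" if "x \<in> ?T" "x \<bullet> normal_dir = 0" for x
      using C\<^sub>1_vanishes_at_boundary[OF dim comp ric C1, of "cinv c x"] image_boundary_iff[OF c that(1)] that(2) by simp
    note rc = defining_function_in_chart[OF defining open_UNIV c]
    have "smooth_on ?T (\<lambda>x. inverse (normal_quotient (\<lambda>x. \<rho> (cinv c x)) x) *\<^sub>R normal_quotient ?k x)"
      by (intro smooth_on_scaleR smooth_on_inverse rc(3) rc(6) smooth_on_normal_quotient[OF T s1 z])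
    moreover have "C\<^sub>1 p / \<rho> p = inverse (normal_quotient (\<lambda>x. \<rho> (cinv c x)) (cmap c p)) *\<^sub>R normal_quotient ?k (cmap c p)"
      if p: "p \<in> mfd_interior A" "p \<in> cdom c" for p
      using interior_iff[OF c p(2)] p c by (simp add: normal_quotient_def field_simps)
    ultimately show "\<exists>q::'a \<Rightarrow> real. smooth_on ?T q \<and> (\<forall>p\<in>UNIV \<inter> mfd_interior A \<inter> cdom c. C\<^sub>1 p / \<rho> p = q (cmap c p))"
      by (intro exI[of _ "\<lambda>x. inverse (normal_quotient (\<lambda>x. \<rho> (cinv c x)) x) *\<^sub>R normal_quotient ?k x"]) auto
  qed
  then obtain F where F: "smooth_fun A UNIV F" "\<And>p. p \<in> mfd_interior A \<Longrightarrow> F p = C\<^sub>1 p / \<rho> p"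
    unfolding fun_smooth_up_to_boundary_def by auto
  have "C p - s = \<rho> p ^ 2 * F p" for p
  proof (cases "p \<in> mfd_interior A")
    case True
    then have "\<rho> p \<noteq> 0" using defining_function_zero_iff[OF defining] by (simp add: mfd_interior_def)
    then show ?thesis using F(2)[OF True] C1(2) by (simp add: power2_eq_square)
  next
    case False
    then have "\<rho> p = 0" using defining_function_zero_iff[OF defining] by (simp add: mfd_interior_def)
    then show ?thesis using C1(2) by simp
  qed
  then show ?thesis unfolding big_O_boundary_def using F(1) by blast
qed

end

section \<open>\<open>C = s + O(\<rho>\<^sup>2)\<close> implies projective compactness\<close>

context asymptotic_metric begin

text \<open>The derivative of \<open>h\<close> is trilinear in the three vectors, and they are replaced by fields one
  after the other.\<close>

lemma h_derivative_smooth: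
  assumes c: "c \<in> A" and S: "S \<subseteq> cmap c ` cdom c"
    and X: "smooth_on S X" and V: "smooth_on S V" and W: "smooth_on S W"
  shows "smooth_on S (\<lambda>y. Dh (\<lambda>z. form_rep c h z (V y) (W y)) y (X y))"
proof -
  let ?T = "cmap c ` cdom c" and ?H = "form_rep c h"
  have T: "hopen ?T" using chart_image_hopen[OF c] .
  note sH = h_chart_smooth[OF c]
  have dH: "((\<lambda>z. ?H z v w) has_derivative (\<lambda>u. Dh (\<lambda>z. ?H z v w) y u)) (at y within half_space)" if "y \<in> S" for y v w
    using smooth_on_D[OF T sH, of y] that S by auto
  have sD: "smooth_on S (\<lambda>y. Dh (\<lambda>z. ?H z v w) y u)" for u v w
    by (rule smooth_on_subset[OF smooth_on_Dh[OF T sH] S])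
  have lw: "linear (\<lambda>w. Dh (\<lambda>z. ?H z v w) y u)" if "y \<in> S" for y u v
    by (rule family_derivative_linear[where L="\<lambda>z. ?H z v", OF T _ _ dH[OF that]])
      (use that S h_chart_bilinear[OF c] in \<open>auto simp: bilinear_def\<close>)
  have lv: "linear (\<lambda>v. Dh (\<lambda>z. ?H z v w) y u)" if "y \<in> S" for y u w
    by (rule family_derivative_linear[where L="\<lambda>z v. ?H z v w", OF T _ _ dH[OF that]])
      (use that S h_chart_bilinear[OF c] in \<open>auto simp: bilinear_def\<close>)
  have sW: "smooth_on S (\<lambda>y. Dh (\<lambda>z. ?H z v (W y)) y u)" for u v
    by (rule smooth_on_linear_family[OF lw sD W])
  have sVW: "smooth_on S (\<lambda>y. Dh (\<lambda>z. ?H z (V y) (W y)) y u)" for u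
    by (rule smooth_on_linear_family[OF lv sW V])
  show ?thesis
    by (rule smooth_on_linear_family[OF has_derivative_linear[OF dH] sVW X])
qed

lemma koszul_h_continuous:
  assumes c: "c \<in> A" and S: "S \<subseteq> cmap c ` cdom c"
    and X: "smooth_on S X" and V: "smooth_on S V" and W: "smooth_on S W"
  shows "continuous_on S (\<lambda>y. koszul_h c y (X y) (V y) (W y))"
  unfolding koszul_h_def
  by (intro continuous_intros smooth_on_continuous h_derivative_smooth[OF c S] X V W)

text \<open>The defining function \<open>\<sigma>\<close> is a local one, as in the definition of projective compactness, and
  may differ from \<open>\<rho>\<close>. By the first part of pre-compactness, \<open>d\<sigma>(Z) = \<sigma> F\<close>, so \<open>Z\<close> is tangent
  to the boundary at boundary points. The pairing of \<open>Z\<close> with tangent vectors is computed from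
  \<open>\<nabla>\<^sup>\<rho>\<close> by the central identity.\<close>

lemma rescaled_nabla_rho_vanishes:
  assumes C2: "smooth_fun A UNIV C\<^sub>2" "\<And>p. C p = s + (\<rho> p)\<^sup>2 * C\<^sub>2 p"
    and U: "open U" and \<sigma>: "defining_function A U \<sigma>"
    and vf: "vector_field A U \<xi>" "vector_field A U \<eta>"
    and F: "smooth_fun A U F" "\<And>q. q \<in> U \<Longrightarrow> q \<in> mfd_interior A \<Longrightarrow> F q = differential A \<sigma> q (nabla_rho A nabla \<sigma> \<xi> \<eta> q)"
    and Z: "vector_field A U Z" "\<And>q. q \<in> U \<Longrightarrow> q \<in> mfd_interior A \<Longrightarrow> Z q = \<sigma> q *\<^sub>R nabla_rho A nabla \<sigma> \<xi> \<eta> q"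
    and p: "p \<in> U" "p \<in> mfd_boundary A"
  shows "Z p = 0"
proof -
  let ?c = "chart_at A p" and ?n = "normal_dir :: 'a"
  have c: "?c \<in> A" "p \<in> cdom ?c" using chart_at_mem by auto
  let ?S = "cmap ?c ` (U \<inter> cdom ?c)" and ?T = "cmap ?c ` cdom ?c" and ?x = "cmap ?c p"
  let ?t = "\<lambda>y. \<sigma> (cinv ?c y)" and ?r = "rho_chart ?c" and ?H = "form_rep ?c h"
  let ?X = "local_rep A ?c \<xi>" and ?Y = "local_rep A ?c \<eta>" and ?Z = "local_rep A ?c Z"
  let ?k = "\<lambda>y. C\<^sub>2 (cinv ?c y)" and ?nab = "nabla_rho A nabla \<sigma> \<xi> \<eta>"
  have S: "hopen ?S" "?x \<in> ?S" "?S \<subseteq> ?T" using image_hopen[OF c(1) U] c p by auto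
  have T: "hopen ?T" using chart_image_hopen[OF c(1)] .
  have xn: "?x \<bullet> ?n = 0" using boundary_iff[OF c] p by simp
  have s\<sigma>: "smooth_fun A U \<sigma>" using \<sigma> unfolding defining_function_def by blast
  note tc = defining_function_in_chart[OF \<sigma> U c(1)]
  note rc = rho_in_chart[OF c(1)]
  have st: "smooth_on ?S ?t" by (rule tc(1))
  have sr: "smooth_on ?S ?r" by (rule smooth_on_subset[OF rho_chart_smooth[OF c(1)] S(3)])
  have sX: "smooth_on ?S ?X" and sY: "smooth_on ?S ?Y" and sZ: "smooth_on ?S ?Z"
    using vector_field_in_chart[OF _ c(1)] vf Z(1) by blast+
  have sk: "smooth_on ?T ?k" using smooth_fun_in_chart[OF C2(1) c(1)] by simp
  have sH: "smooth_on ?S (\<lambda>y. ?H y u v)" for u v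
    by (rule smooth_on_subset[OF h_chart_smooth[OF c(1)] S(3)])
  have int: "\<exists>q. q \<in> U \<and> q \<in> mfd_interior A \<and> q \<in> cdom ?c \<and> y = cmap ?c q" if "y \<in> ?S" "y \<bullet> ?n > 0" for y
    using that interior_iff[OF c(1)] by auto
  have Zcomp: "?Z y = ?t y *\<^sub>R components A ?c (cinv ?c y) (?nab (cinv ?c y))" if "y \<in> ?S" "y \<bullet> ?n > 0" for y
    using int[OF that] Z(2) c(1) by (auto simp: local_rep_def linear_scale[OF components_linear])
  have Zrep: "?Z y = ?t y *\<^sub>R Dh ?Y y (?X y) + ?t y *\<^sub>R christoffel ?c y (?X y) (?Y y)
      + Dh ?t y (?X y) *\<^sub>R ?Y y + Dh ?t y (?Y y) *\<^sub>R ?X y" if y: "y \<in> ?S" "y \<bullet> ?n > 0" for y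
  proof -
    obtain q where q: "q \<in> U" "q \<in> mfd_interior A" "q \<in> cdom ?c" "y = cmap ?c q" using int[OF y] by blast
    have "?t y \<noteq> 0" using tc(2)[OF y(1)] y(2) by simp
    then show ?thesis
      unfolding Zcomp[OF y] using nabla_rho_in_chart[OF c(1) U q(1,2,3) s\<sigma> vf] q c(1)
      by (simp add: algebra_simps)
  qed
  have tangent: "?Z ?x \<bullet> ?n = 0"
  proof -
    have "Dh ?t ?x (?Z ?x) = ?t ?x * F (cinv ?c ?x)"
    proof (rule eq_at_boundary_by_continuity[OF S(1) _ _ _ S(2), where f="\<lambda>y. Dh ?t y (?Z y)" and g="\<lambda>y. ?t y * F (cinv ?c y)"])
      show "continuous_on ?S (\<lambda>y. Dh ?t y (?Z y))"
        by (rule smooth_on_continuous[OF smooth_on_Dh_field[OF S(1) st sZ]])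
      show "continuous_on ?S (\<lambda>y. ?t y * F (cinv ?c y))"
        by (intro continuous_intros smooth_on_continuous st smooth_fun_in_chart[OF F(1) c(1)])
      fix y assume y: "y \<in> ?S" "y \<bullet> ?n > 0"
      obtain q where q: "q \<in> U" "q \<in> mfd_interior A" "q \<in> cdom ?c" "y = cmap ?c q" using int[OF y] by blast
      show "Dh ?t y (?Z y) = ?t y * F (cinv ?c y)"
        unfolding Zcomp[OF y] linear_scale[OF smooth_on_Dh_linear[OF S(1) st y(1)]]
        using q c(1) F(2)[OF q(1,2)] differential_in_chart[OF c(1) q(3) U q(1) s\<sigma>] by simp
    qed
    then show ?thesis using tc(2,5,6)[OF S(2)] xn by simp
  qed
  have pairing: "?H ?x (?Z ?x) w\<^sub>0 = 0" if w0: "w\<^sub>0 \<bullet> ?n = 0" for w\<^sub>0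
  proof -
    \<comment> \<open>\<open>w\<^sub>0\<close> is extended to a field \<open>\<omega>\<close> tangent to the level sets of \<open>\<rho>\<close>; then \<open>C\<^sub>\<omega> = O(\<rho>\<^sup>2)\<close>\<close>
    let ?S1 = "?S \<inter> (\<lambda>y. Dh ?r y ?n) -` (-{0})"
    have S1: "hopen ?S1"
      by (rule openin_trans[OF continuous_openin_preimage_gen[OF smooth_on_continuous[OF smooth_on_Dh[OF S(1) sr]]] S(1)]) auto
    have xS1: "?x \<in> ?S1" using S(2) rc(5)[of ?x ?n] rc(6)[of ?x] xn c by auto
    have sub: "?S1 \<subseteq> ?S" "?S1 \<subseteq> ?T" using S(3) by auto
    define \<omega> where "\<omega> y = w\<^sub>0 + (- 1 * (Dh ?r y w\<^sub>0 * inverse (Dh ?r y ?n))) *\<^sub>R ?n" for y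
    note sm1 = smooth_on_subset[OF _ sub(1)]
    have s\<omega>: "smooth_on ?S1 \<omega>"
      unfolding \<omega>_def real_scaleR_def[symmetric]
      by (intro smooth_on_add smooth_on_scaleR smooth_on_const smooth_on_inverse sm1[OF smooth_on_Dh[OF S(1) sr]]) auto
    have r\<omega>: "Dh ?r y (\<omega> y) = 0" if "y \<in> ?S1" for y
    proof -
      have "linear (Dh ?r y)" using smooth_on_Dh_linear[OF S(1) sr] that by auto
      then show ?thesis using that unfolding \<omega>_def by (simp add: linear_diff linear_scale)
    qed
    have \<omega>x: "\<omega> ?x = w\<^sub>0" using rc(5)[of ?x w\<^sub>0] xn w0 c unfolding \<omega>_def by simp
    \<comment> \<open>\<open>\<kappa>\<close> is the smooth extension of \<open>\<sigma>/\<rho>\<close>\<close>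
    define \<kappa> where "\<kappa> y = normal_quotient ?t y * inverse (normal_quotient ?r y)" for y
    \<comment> \<open>\<open>R\<close> is the pairing of \<open>Z\<close> with \<open>\<omega>\<close>, with \<open>\<nabla>\<close> eliminated by the central identity\<close>
    define R where "R y = ?t y * ?H y (Dh ?Y y (?X y)) (\<omega> y)
        + \<kappa> y * (?r y * (1 / 2 * (koszul_h ?c y (?X y) (?Y y) (\<omega> y) - Dh ?k y (\<omega> y) * (Dh ?r y (?X y) * Dh ?r y (?Y y)))))
        + (Dh ?t y (?X y) - \<kappa> y * Dh ?r y (?X y)) * ?H y (?Y y) (\<omega> y)
        + (Dh ?t y (?Y y) - \<kappa> y * Dh ?r y (?Y y)) * ?H y (?X y) (\<omega> y)" for y
    have cH: "continuous_on ?S1 (\<lambda>y. ?H y (V y) (\<omega> y))" if "smooth_on ?S V" for V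
      by (rule smooth_on_continuous[OF smooth_on_bilinear_family[OF h_chart_bilinear[OF c(1)] sm1[OF sH] sm1[OF that] s\<omega>]])
        (use sub in auto)
    have cD: "continuous_on ?S1 (\<lambda>y. Dh f y (V y))" if "smooth_on ?S f" "smooth_on ?S V" for f :: "'a \<Rightarrow> real" and V
      by (rule smooth_on_continuous[OF sm1[OF smooth_on_Dh_field[OF S(1) that]]])
    have ck: "continuous_on ?S1 (\<lambda>y. Dh ?k y (\<omega> y))"
      by (rule smooth_on_continuous[OF smooth_on_Dh_field[OF S1 smooth_on_subset[OF sk sub(2)] s\<omega>]])
    have c\<kappa>: "continuous_on ?S1 \<kappa>"
      unfolding \<kappa>_def
      by (intro continuous_on_mult continuous_on_inverse smooth_on_continuous[OF sm1[OF tc(3)]] smooth_on_continuous[OF smooth_on_subset[OF rc(3) sub(2)]])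
        (use rc(6) sub in auto)
    have "?H ?x (?Z ?x) (\<omega> ?x) = R ?x"
    proof (rule eq_at_boundary_by_continuity[OF S1 cH[OF sZ] _ _ xS1, where g=R])
      show "continuous_on ?S1 R"
        unfolding R_def
        by (intro continuous_intros cH cD ck c\<kappa> smooth_on_Dh_field[OF S(1)] sX sY st sr smooth_on_continuous[OF sm1[OF st]]
            smooth_on_continuous[OF sm1[OF sr]] koszul_h_continuous[OF c(1) sub(2)] sm1[OF sX] sm1[OF sY] s\<omega>)
      fix y assume y: "y \<in> ?S1" "y \<bullet> ?n > 0"
      have yS: "y \<in> ?S" "y \<in> ?T" using y sub by auto
      obtain q where q: "q \<in> U" "q \<in> mfd_interior A" "q \<in> cdom ?c" "y = cmap ?c q" using int[OF yS(1) y(2)] by blast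
      let ?W = "\<omega> y" and ?N = "nabla_rho_chart ?c y (?X y) (?Y y)" and ?\<Gamma> = "christoffel ?c y (?X y) (?Y y)"
      have r0: "?r y \<noteq> 0" using rho_chart_nonzero[OF c(1) q(3,2)] q by simp
      have t\<kappa>: "?t y = \<kappa> y * ?r y"
        using tc(4)[OF yS(1)] rc(4)[OF yS(2)] rc(6)[OF yS(2)] by (simp add: \<kappa>_def)
      have "((\<lambda>z. s + (?r z)\<^sup>2 * ?k z) has_derivative
          (\<lambda>v. 0 + ((?r y)\<^sup>2 * Dh ?k y v + (2 * Dh ?r y v * ?r y) * ?k y))) (at y within half_space)"
        using has_derivative_add[OF has_derivative_const has_derivative_mult[OF has_derivative_power[OF smooth_on_D[OF S(1) sr yS(1)], of 2]
            smooth_on_D[OF T sk yS(2)]]] by simp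
      moreover have "(\<lambda>z. s + (?r z)\<^sup>2 * ?k z) = C_chart ?c" by (simp add: C_chart_def[abs_def] rho_chart_def[abs_def] C2(2))
      ultimately have hd: "(C_chart ?c has_derivative
          (\<lambda>v. 0 + ((?r y)\<^sup>2 * Dh ?k y v + (2 * Dh ?r y v * ?r y) * ?k y))) (at y within half_space)" by simp
      have K\<omega>: "Dh (C_chart ?c) y ?W = (?r y)\<^sup>2 * Dh ?k y ?W"
        using fun_cong[OF Dh_eq[OF hd hopen_half[OF T yS(2)]], of ?W] r\<omega>[OF y(1)] by simp
      have "(?r y)\<^sup>2 * (2 * ?H y ?N ?W) = (?r y)\<^sup>2 * (koszul_h ?c y (?X y) (?Y y) ?W - Dh ?k y ?W * (Dh ?r y (?X y) * Dh ?r y (?Y y)))"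
        using rescaled_koszul[OF c(1) q(3,2), of "?X y" "?Y y" ?W] r\<omega>[OF y(1)] K\<omega> unfolding q(4)[symmetric]
        by (simp add: algebra_simps)
      then have HN: "?H y ?N ?W = 1 / 2 * (koszul_h ?c y (?X y) (?Y y) ?W - Dh ?k y ?W * (Dh ?r y (?X y) * Dh ?r y (?Y y)))"
        using r0 by simp
      have bl: "bilinear (?H y)" by (rule h_chart_bilinear[OF c(1) yS(2)])
      have "?H y ?N ?W = ?H y ?\<Gamma> ?W + Dh ?r y (?X y) / ?r y * ?H y (?Y y) ?W + Dh ?r y (?Y y) / ?r y * ?H y (?X y) ?W"
        unfolding nabla_rho_chart_def by (simp add: bilinear_ladd[OF bl] bilinear_lmul[OF bl])
      then have rG: "?r y * ?H y ?\<Gamma> ?W = ?r y * ?H y ?N ?W - Dh ?r y (?X y) * ?H y (?Y y) ?W - Dh ?r y (?Y y) * ?H y (?X y) ?W"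
        using r0 by (simp add: field_simps)
      have "?t y * ?H y ?\<Gamma> ?W = \<kappa> y * (?r y * ?H y ?\<Gamma> ?W)" by (simp add: t\<kappa>)
      then have "?t y * ?H y ?\<Gamma> ?W = \<kappa> y * (?r y * ?H y ?N ?W) - \<kappa> y * Dh ?r y (?X y) * ?H y (?Y y) ?W - \<kappa> y * Dh ?r y (?Y y) * ?H y (?X y) ?W"
        unfolding rG by (simp add: algebra_simps)
      then show "?H y (?Z y) ?W = R y"
        unfolding Zrep[OF yS(1) y(2)] R_def HN[symmetric]
        by (simp add: bilinear_ladd[OF bl] bilinear_lmul[OF bl] algebra_simps)
    qed
    also have "R ?x = 0"
    proof -
      have "\<kappa> ?x * Dh ?r ?x v = Dh ?t ?x v" for v
        unfolding \<kappa>_def using tc(5)[OF S(2) xn] rc(5,6)[of ?x] xn c by simp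
      moreover have "?t ?x = 0" "?r ?x = 0" using tc(2)[OF S(2)] rc(2)[of ?x] xn c by simp_all
      ultimately show ?thesis unfolding R_def by simp
    qed
    finally show ?thesis unfolding \<omega>x .
  qed
  have ZZ: "?Z ?x = Z p" using c by (simp add: local_rep_def)
  have "Z p \<in> boundary_tangent A p"
    using boundary_tangent_iff[OF defining c p(2)] tangent ZZ by simp
  moreover have "h p (Z p) v = 0" if "v \<in> boundary_tangent A p" for v
    using pairing[of "components A ?c p v"] boundary_tangent_iff[OF defining c p(2)] that ZZ
      form_eq_form_rep[OF c, of h "Z p" v] by simp
  ultimately show ?thesis using h_boundary p(2) unfolding nondegenerate_on_def by blast
qed

lemma O2_imp_projectively_compact:
  assumes pre: "projectively_precompact A nabla" and O2: "big_O_boundary A UNIV \<rho> 2 (\<lambda>p. C p - s)"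
  shows "projectively_compact A nabla"
  unfolding projectively_compact_def
proof (intro allI impI, elim conjE)
  fix U \<sigma> \<xi> \<eta>
  assume U: "open U" and \<sigma>: "defining_function A U \<sigma>" and vf: "vector_field A U \<xi>" "vector_field A U \<eta>"
  let ?nab = "nabla_rho A nabla \<sigma> \<xi> \<eta>"
  obtain C\<^sub>2 where C2: "smooth_fun A UNIV C\<^sub>2" "\<And>p. C p = s + (\<rho> p)\<^sup>2 * C\<^sub>2 p"
    using O2 unfolding big_O_boundary_def by (metis UNIV_I add.commute diff_eq_eq)
  have "fun_smooth_up_to_boundary A U (\<lambda>p. differential A \<sigma> p (?nab p))"
    "field_smooth_up_to_boundary A U (\<lambda>p. \<sigma> p *\<^sub>R ?nab p)"
    using pre U \<sigma> vf unfolding projectively_precompact_def by blast+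
  then obtain F Z where F: "smooth_fun A U F" "\<And>q. q \<in> U \<Longrightarrow> q \<in> mfd_interior A \<Longrightarrow> F q = differential A \<sigma> q (?nab q)"
    and Z: "vector_field A U Z" "\<And>q. q \<in> U \<Longrightarrow> q \<in> mfd_interior A \<Longrightarrow> Z q = \<sigma> q *\<^sub>R ?nab q"
    unfolding fun_smooth_up_to_boundary_def field_smooth_up_to_boundary_def by (metis IntI)
  have Z0: "Z p = 0" if "p \<in> U" "p \<in> mfd_boundary A" for p
    by (rule rescaled_nabla_rho_vanishes[OF C2 U \<sigma> vf F Z that])
  show "field_smooth_up_to_boundary A U ?nab"
  proof (rule field_smooth_up_to_boundaryI[OF U])
    fix c assume c: "c \<in> A"
    let ?S = "cmap c ` (U \<inter> cdom c)" and ?t = "\<lambda>x. \<sigma> (cinv c x)"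
    let ?q = "\<lambda>x. inverse (normal_quotient ?t x) *\<^sub>R normal_quotient (local_rep A c Z) x"
    have S: "hopen ?S" using image_hopen[OF c U] .
    note tc = defining_function_in_chart[OF \<sigma> U c]
    have z: "local_rep A c Z x = 0" if "x \<in> ?S" "x \<bullet> normal_dir = 0" for x
      using that Z0 boundary_iff[OF c] c by (auto simp: local_rep_def linear_0[OF components_linear])
    have "smooth_on ?S ?q"
      by (intro smooth_on_scaleR smooth_on_inverse tc(3) tc(6) smooth_on_normal_quotient[OF S vector_field_in_chart[OF Z(1) c] z])
    moreover have "components A c p (?nab p) = ?q (cmap c p)" if p: "p \<in> U" "p \<in> mfd_interior A" "p \<in> cdom c" for p
    proof -
      have pos: "cmap c p \<bullet> normal_dir > 0" using interior_iff[OF c p(3)] p by simp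
      have "local_rep A c Z (cmap c p) = \<sigma> p *\<^sub>R components A c p (?nab p)"
        using Z(2)[OF p(1,2)] c p by (simp add: local_rep_def linear_scale[OF components_linear])
      moreover have "\<sigma> p \<noteq> 0" using defining_function_zero_iff[OF \<sigma> p(1)] p by (simp add: mfd_interior_def)
      moreover from this pos have "(cmap c p \<bullet> normal_dir * inverse (\<sigma> p)) * (inverse (cmap c p \<bullet> normal_dir) * \<sigma> p) = 1"
        by (simp add: field_simps)
      ultimately show ?thesis using pos c p by (simp add: normal_quotient_def)
    qed
    ultimately show "\<exists>q::'a \<Rightarrow> 'a. smooth_on ?S q \<and> (\<forall>p\<in>U \<inter> mfd_interior A \<inter> cdom c. components A c p (?nab p) = q (cmap c p))"
      by (intro exI[of _ ?q]) auto
  qed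
qed

end

theorem theorem3p9:
  fixes A :: "('m::{t2_space, second_countable_topology}, 'a::euclidean_space) chart set"
    and g h :: "'m \<Rightarrow> 'a \<Rightarrow> 'a \<Rightarrow> real"
    and nabla :: "('m \<Rightarrow> 'a) \<Rightarrow> ('m \<Rightarrow> 'a) \<Rightarrow> 'm \<Rightarrow> 'a"
    and \<rho> C :: "'m \<Rightarrow> real"
    and s :: real
  assumes atlas: "smooth_atlas A"
    and dim: "DIM('a) \<ge> 2"
    and metric: "pseudo_riemannian_metric A (mfd_interior A) g"
    and levi_civita: "levi_civita_connection A (mfd_interior A) g nabla"
    and precompact: "projectively_precompact A nabla"
    and defining: "defining_function A UNIV \<rho>"
    and C_smooth: "smooth_fun A UNIV C"
    and sign: "s = 1 \<or> s = - 1"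
    and C_boundary: "big_O_boundary A UNIV \<rho> 1 (\<lambda>p. C p - s)"
    and h_form: "symmetric_form_field A UNIV h"
    and h_boundary: "\<forall>p\<in>mfd_boundary A. nondegenerate_on (boundary_tangent A p) (h p)"
    and asymptotic: "\<forall>p\<in>mfd_interior A. \<forall>u v.
      g p u v = C p / \<rho> p ^ 4 * (differential A \<rho> p u * differential A \<rho> p v) + h p u v / (\<rho> p)\<^sup>2"
    and ricci: "\<exists>Ric. symmetric_form_field A UNIV Ric \<and>
      (\<forall>p\<in>mfd_interior A. Ric p = ricci A nabla p) \<and>
      (\<forall>p\<in>mfd_boundary A. \<forall>u v. u \<in> boundary_tangent A p \<or> v \<in> boundary_tangent A p \<longrightarrow>
         Ric p u v = 0)"
  shows "projectively_compact A nabla \<longleftrightarrow> big_O_boundary A UNIV \<rho> 2 (\<lambda>p. C p - s)"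
proof -
  interpret asymptotic_metric A g nabla \<rho> C h s
    by unfold_locales (fact atlas metric levi_civita defining C_smooth C_boundary h_form h_boundary asymptotic)+
  obtain Ric where Ric: "bilinear_form_field A UNIV Ric" "\<And>p. p \<in> mfd_interior A \<Longrightarrow> Ric p = ricci A nabla p"
    using ricci unfolding symmetric_form_field_def by blast
  show ?thesis
    using projectively_compact_imp_O2[OF dim _ Ric] O2_imp_projectively_compact[OF precompact] by blast
qed

end
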